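(* Let $f,g,h,R$ satisfy the data assumption stated in the context. Let $(u,\Omega)$ be an admissible controller--domain pair with $u\in C^\infty(\Omega,\mathbb{R}^M)$, and for $x\in\Omega$ let $$v_u(x)=\int_0^\infty\Bigl[h(\mathbf{x}_u(t;x))+\langle u(\mathbf{x}_u(t;x)),R\,u(\mathbf{x}_u(t;x))\rangle\Bigr]\,\mathrm{d}t .$$ Then: 1. $v_u\in C^\infty(\Omega,\mathbb{R})$. 2. $v_u$ is positive-definite (i.e. $v_u(0)=0$ and $v_u(x)>0$ for all $x\in\Omega\setminus\{0\}$); it is the unique (continuously differentiable) solution $v:\Omega\to\mathbb{R}$ of the generalized Hamilton--Jacobi--Bellman equation associated with $u$, $$\langle f(x)+g(x)u(x),\nabla v(x)\rangle+h(x)+\langle u(x),R\,u(x)\rangle=0\quad\text{for all }x\in\Omega,\qquad v(0)=0;$$ and $\nabla v_u(x)\neq 0$ for all $x\in\Omega\setminus\{0\}$. 3. The updated controller $u^+(x):=-\tfrac12R^{-1}g(x)^\top\nabla v_u(x)$ satisfies $u^+\in C^\infty(\Omega,\mathbb{R}^M)$.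
   Context: A domain is a non-empty, open and connected subset of $\mathbb{R}^N$; $\|\cdot\|$ is the Euclidean norm; $B_\varepsilon(0)$ is the open ball of radius $\varepsilon$ about $0$. Data assumption: $f\in C^\infty(\mathbb{R}^N,\mathbb{R}^N)$, $g\in C^\infty(\mathbb{R}^N,\mathbb{R}^{N\times M})$, $h\in C^\infty(\mathbb{R}^N,\mathbb{R})$, $R\in\mathbb{R}^{M\times M}$ is symmetric positive-definite, $f(0)=0$, and $h$ is a positive-definite function, i.e. $h(0)=0$ and $h(x)>0$ for $x\ne0$. For a feedback controller $u:\Omega\to\mathbb{R}^M$, $\mathbf{x}_u(t;x)$ denotes the solution of the closed-loop system $\dot{\mathbf{x}}_u(t;x)=f(\mathbf{x}_u(t;x))+g(\mathbf{x}_u(t;x))u(\mathbf{x}_u(t;x))$, $\mathbf{x}_u(0;x)=x$. Admissible controller--domain pair: for a domain $\Omega\subset\mathbb{R}^N$ and $u\in C^0(\Omega,\mathbb{R}^M)$, the pair $(u,\Omega)$ is admissible if (1) $0\in\Omega$; (2) $u(0)=0$; (3) for every $x\in\Omega$, $\mathbf{x}_u(t;x)\in\Omega$ for all $t\ge0$; (4) $\lim_{t\to\infty}\|\mathbf{x}_u(t;x)\|=0$ for all $x\in\Omega$; (5) there exist constants $\varepsilon,C,\nu>0$ with $B_\varepsilon(0)\subset\Omega$ such that $\|\mathbf{x}_u(t;x)\|\le Ce^{-\nu t}\|x\|$ for all $x\in B_\varepsilon(0)$ and $t\ge0$. *)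

theory Defs
  imports "HOL-Analysis.Analysis"
begin

text \<open>
  \<open>Ck_on k S f\<close>: \<open>f\<close> is of class \<open>C\<^sup>k\<close> on the open set \<open>S\<close>. In finite dimension it suffices to
  ask that all directional derivatives (equivalently, all partial derivatives) are again of
  class \<open>C\<^sup>k\<^sup>-\<^sup>1\<close>. For open \<open>S\<close> only the values of \<open>f\<close> on \<open>S\<close> matter.
\<close>

primrec Ck_on ::
  "nat \<Rightarrow> 'a::euclidean_space set \<Rightarrow> ('a \<Rightarrow> 'b::real_normed_vector) \<Rightarrow> bool" where
  "Ck_on 0 S f \<longleftrightarrow> continuous_on S f"
| "Ck_on (Suc k) S f \<longleftrightarrow>
     (\<forall>x\<in>S. f differentiable (at x)) \<and>
     (\<forall>v. Ck_on k S (\<lambda>x. frechet_derivative f (at x) v))"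

definition smooth_on ::
  "'a::euclidean_space set \<Rightarrow> ('a \<Rightarrow> 'b::real_normed_vector) \<Rightarrow> bool" where
  "smooth_on S f \<longleftrightarrow> (\<forall>k. Ck_on k S f)"

definition gradient :: "('a::euclidean_space \<Rightarrow> real) \<Rightarrow> 'a \<Rightarrow> 'a" where
  "gradient v x = (THE D. GDERIV v x :> D)"

definition is_domain :: "'a::euclidean_space set \<Rightarrow> bool" where
  "is_domain S \<longleftrightarrow> S \<noteq> {} \<and> open S \<and> connected S"

definition pos_def_fun_on :: "'a::euclidean_space set \<Rightarrow> ('a \<Rightarrow> real) \<Rightarrow> bool" where
  "pos_def_fun_on S v \<longleftrightarrow> v 0 = 0 \<and> (\<forall>x\<in>S - {0}. v x > 0)"

definition sym_pos_def_matrix :: "real^'m^'m \<Rightarrow> bool" where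
  "sym_pos_def_matrix R \<longleftrightarrow> transpose R = R \<and> (\<forall>w. w \<noteq> 0 \<longrightarrow> w \<bullet> (R *v w) > 0)"

definition closed_loop_field ::
  "(real^'n \<Rightarrow> real^'n) \<Rightarrow> (real^'n \<Rightarrow> real^'m^'n) \<Rightarrow> (real^'n \<Rightarrow> real^'m) \<Rightarrow> real^'n \<Rightarrow> real^'n" where
  "closed_loop_field f g u x = f x + g x *v u x"

text \<open>
  The controller is a map on \<open>\<Omega>\<close> only, so its values outside \<open>\<Omega>\<close> must be irrelevant: a
  solution for all \<open>t \<ge> 0\<close> is by definition a curve in \<open>\<Omega>\<close>. Values at \<open>t < 0\<close> are arbitrary.
\<close>

definition closed_loop_solution ::
  "(real^'n \<Rightarrow> real^'n) \<Rightarrow> (real^'n \<Rightarrow> real^'m^'n) \<Rightarrow> (real^'n \<Rightarrow> real^'m) \<Rightarrow> (real^'n) set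
    \<Rightarrow> real^'n \<Rightarrow> (real \<Rightarrow> real^'n) \<Rightarrow> bool" where
  "closed_loop_solution f g u \<Omega> x \<phi> \<longleftrightarrow>
     \<phi> 0 = x \<and>
     (\<forall>t\<ge>0. \<phi> t \<in> \<Omega> \<and>
        (\<phi> has_vector_derivative closed_loop_field f g u (\<phi> t)) (at t within {0..}))"

text \<open>
  \<open>closed_loop_traj f g u \<Omega> x t\<close> is \<open>\<^bold>x\<^sub>u(t;x)\<close>. If \<open>f\<close>, \<open>g\<close>, \<open>u\<close> are locally Lipschitz, the solution
  is unique on \<open>t \<ge> 0\<close> and the choice is immaterial.
\<close>

definition closed_loop_traj ::
  "(real^'n \<Rightarrow> real^'n) \<Rightarrow> (real^'n \<Rightarrow> real^'m^'n) \<Rightarrow> (real^'n \<Rightarrow> real^'m) \<Rightarrow> (real^'n) set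
    \<Rightarrow> real^'n \<Rightarrow> real \<Rightarrow> real^'n" where
  "closed_loop_traj f g u \<Omega> x = (SOME \<phi>. closed_loop_solution f g u \<Omega> x \<phi>)"

text \<open>
  The third condition says that the solution exists for all \<open>t \<ge> 0\<close> and remains in \<open>\<Omega>\<close>.
\<close>

definition admissible ::
  "(real^'n \<Rightarrow> real^'n) \<Rightarrow> (real^'n \<Rightarrow> real^'m^'n) \<Rightarrow> (real^'n \<Rightarrow> real^'m) \<Rightarrow> (real^'n) set \<Rightarrow> bool" where
  "admissible f g u \<Omega> \<longleftrightarrow>
     is_domain \<Omega> \<and> continuous_on \<Omega> u \<and>
     0 \<in> \<Omega> \<and>
     u 0 = 0 \<and>
     (\<forall>x\<in>\<Omega>. closed_loop_solution f g u \<Omega> x (closed_loop_traj f g u \<Omega> x)) \<and>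
     (\<forall>x\<in>\<Omega>. ((\<lambda>t. norm (closed_loop_traj f g u \<Omega> x t)) \<longlongrightarrow> 0) at_top) \<and>
     (\<exists>\<epsilon> C \<nu>. \<epsilon> > 0 \<and> C > 0 \<and> \<nu> > 0 \<and> ball 0 \<epsilon> \<subseteq> \<Omega> \<and>
        (\<forall>x\<in>ball 0 \<epsilon>. \<forall>t\<ge>0.
           norm (closed_loop_traj f g u \<Omega> x t) \<le> C * exp (- \<nu> * t) * norm x))"

definition running_cost ::
  "(real^'n \<Rightarrow> real) \<Rightarrow> real^'m^'m \<Rightarrow> (real^'n \<Rightarrow> real^'m) \<Rightarrow> real^'n \<Rightarrow> real" where
  "running_cost h R u x = h x + u x \<bullet> (R *v u x)"

definition value_fun ::
  "(real^'n \<Rightarrow> real^'n) \<Rightarrow> (real^'n \<Rightarrow> real^'m^'n) \<Rightarrow> (real^'n \<Rightarrow> real) \<Rightarrow> real^'m^'m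
    \<Rightarrow> (real^'n \<Rightarrow> real^'m) \<Rightarrow> (real^'n) set \<Rightarrow> real^'n \<Rightarrow> real" where
  "value_fun f g h R u \<Omega> x =
     integral {0..} (\<lambda>t. running_cost h R u (closed_loop_traj f g u \<Omega> x t))"

definition ghjb_solution ::
  "(real^'n \<Rightarrow> real^'n) \<Rightarrow> (real^'n \<Rightarrow> real^'m^'n) \<Rightarrow> (real^'n \<Rightarrow> real) \<Rightarrow> real^'m^'m
    \<Rightarrow> (real^'n \<Rightarrow> real^'m) \<Rightarrow> (real^'n) set \<Rightarrow> (real^'n \<Rightarrow> real) \<Rightarrow> bool" where
  "ghjb_solution f g h R u \<Omega> v \<longleftrightarrow>
     Ck_on 1 \<Omega> v \<and>
     (\<forall>x\<in>\<Omega>. (f x + g x *v u x) \<bullet> gradient v x + h x + u x \<bullet> (R *v u x) = 0) \<and>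
     v 0 = 0"

definition updated_controller ::
  "(real^'n \<Rightarrow> real^'m^'n) \<Rightarrow> real^'m^'m \<Rightarrow> (real^'n \<Rightarrow> real) \<Rightarrow> real^'n \<Rightarrow> real^'m" where
  "updated_controller g R v x =
     - ((1 / 2) *\<^sub>R (matrix_inv R *v (transpose (g x) *v gradient v x)))"

end

theory Submission
  imports Defs
begin

text \<open>
  The trajectories of the closed loop form a semiflow \<open>\<phi>\<close> of the smooth field \<open>F = f + g u\<close>, and
  \<open>\<phi>\<close> is smooth in the initial value: the derivative of \<open>\<phi>\<close> in a direction solves the
  variational equation, and for a linear equation with parameters \<open>C\<^sup>k\<close> coefficients give \<open>C\<^sup>k\<close>
  solutions, because a directional derivative of a solution solves the same linear equation with
  another inhomogeneity.

  On the infinite horizon only a neighbourhood of \<open>0\<close> matters. By exponential stability the time-\<open>T\<close>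
  map \<open>P\<close> of the flow satisfies \<open>P 0 = 0\<close>, and for large \<open>T\<close> its derivative near \<open>0\<close> has norm at most
  \<open>1/2\<close>. Hence all derivatives of the iterates \<open>P\<^sup>n\<close> decay geometrically, so
  \<open>W = (\<Sum>n. w \<circ> P\<^sup>n)\<close> is smooth, where \<open>w\<close> is the cost over \<open>[0, T]\<close>. Near an arbitrary point the value
  function is the cost over some \<open>[0, s]\<close> plus \<open>W \<circ> \<phi> s\<close>. The remaining claims come from
  differentiating along trajectories: any \<open>C\<^sup>1\<close> solution of the generalized
  HJB equation differs from the value function by a constant along each trajectory, and this
  constant vanishes because trajectories tend to \<open>0\<close>.
\<close>

section \<open>Families of class \<open>C\<^sup>k\<close> in a parameter\<close>

text \<open>The obstacle is the infinite horizon: differentiating under the integral over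
  \<open>{0..}\<close> would require decay of every spatial derivative of the flow, while
  exponential stability bounds only the flow itself. That bound passes to a derivative at one point,
  the fixed point \<open>0\<close>, where it controls difference quotients; continuity of the
  derivative then spreads it to a ball at the cost of a worse constant. Sampling at multiples of
  \<open>T\<close> replaces estimates for all times by a linear recursion: each derivative of the
  iterates obeys it with factor \<open>1/2\<close> and a source built from lower orders. The source
  decays like \<open>(3/4)^n\<close>, and the strict gap between the two rates absorbs it without
  polynomial factors, so one rate serves all orders.

  Smoothness is defined through iterated directional derivatives. Hence continuity and bounds have
  to be carried through all orders within one class of families that is closed under
  differentiation. The trajectories are picked by \<open>SOME\<close>, so whatever a flow has beyond
  solving the equation, such as the semigroup law, must come from uniqueness.\<close>

text \<open>
  In \<open>Ck_family k I J W U y\<close> the derivatives of \<open>y t x\<close> are taken in \<open>x \<in> U\<close> only and are jointly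
  continuous on \<open>I \<times> U\<close>; for \<open>t \<in> J\<close> they are also bounded by a multiple of \<open>W t\<close>. With \<open>J = {}\<close> there is no
  bound (solutions of differential equations); \<open>J = I = UNIV\<close> over \<open>nat\<close> with \<open>W n = \<rho> ^ n\<close> is geometric decay.
\<close>

primrec Ck_family ::
  "nat \<Rightarrow> 'i::topological_space set \<Rightarrow> 'i set \<Rightarrow> ('i \<Rightarrow> real) \<Rightarrow> 'a::euclidean_space set
    \<Rightarrow> ('i \<Rightarrow> 'a \<Rightarrow> 'b::real_normed_vector) \<Rightarrow> bool" where
  "Ck_family 0 I J W U y \<longleftrightarrow>
     continuous_on (I \<times> U) (\<lambda>(t, x). y t x) \<and>
     (\<exists>c. \<forall>t\<in>J. \<forall>x\<in>U. norm (y t x) \<le> c * W t)"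
| "Ck_family (Suc k) I J W U y \<longleftrightarrow>
     continuous_on (I \<times> U) (\<lambda>(t, x). y t x) \<and>
     (\<exists>c. \<forall>t\<in>J. \<forall>x\<in>U. norm (y t x) \<le> c * W t) \<and>
     (\<forall>t\<in>I. \<forall>x\<in>U. y t differentiable (at x)) \<and>
     (\<forall>v. Ck_family k I J W U (\<lambda>t x. frechet_derivative (y t) (at x) v))"

declare Ck_family.simps(2) [simp del]

text \<open>With continuity and bound folded into \<open>Ck_family 0\<close>, each closure proof
  below settles that part once (\<open>base\<close>) and reuses it in the successor case.\<close>

lemma Ck_family_Suc:
  "Ck_family (Suc k) I J W U y \<longleftrightarrow>
     Ck_family 0 I J W U y \<and>
     (\<forall>t\<in>I. \<forall>x\<in>U. y t differentiable (at x)) \<and>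
     (\<forall>v. Ck_family k I J W U (\<lambda>t x. frechet_derivative (y t) (at x) v))"
  by (simp add: Ck_family.simps(2))

text \<open>\<open>frechet_derivative\<close> is a \<open>SOME\<close>-choice. Both functions have
  the same derivatives at \<open>x\<close>, so the choices agree, even if there is no derivative at
  all.\<close>

lemma frechet_derivative_cong_open:
  assumes "open U" "x \<in> U" "\<And>z. z \<in> U \<Longrightarrow> f z = g z"
  shows "frechet_derivative f (at x) = frechet_derivative g (at x)"
proof -
  have "(f has_derivative D) (at x) \<longleftrightarrow> (g has_derivative D) (at x)" for D
    using assms has_derivative_transform_within_open by (metis (full_types))
  then show ?thesis
    unfolding frechet_derivative_def by simp
qed

lemma differentiable_cong_open:
  assumes "open U" "x \<in> U" "\<And>z. z \<in> U \<Longrightarrow> f z = g z" "f differentiable (at x)"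
  shows "g differentiable (at x)"
  using assms has_derivative_transform_within_open unfolding differentiable_def
  by (metis (full_types))

lemma Ck_family_0: "Ck_family k I J W U y \<Longrightarrow> Ck_family 0 I J W U y"
  by (cases k) (auto simp: Ck_family_Suc)

lemma Ck_family_continuous:
  "Ck_family k I J W U y \<Longrightarrow> continuous_on (I \<times> U) (\<lambda>(t, x). y t x)"
  using Ck_family_0[of k I J W U y] by simp

lemma Ck_family_bound:
  assumes "Ck_family k I J W U y"
  obtains c where "\<And>t x. t \<in> J \<Longrightarrow> x \<in> U \<Longrightarrow> norm (y t x) \<le> c * W t"
  using Ck_family_0[OF assms] by auto

lemma Ck_family_derivative:
  assumes "Ck_family (Suc k) I J W U y"
  shows "Ck_family k I J W U (\<lambda>t x. frechet_derivative (y t) (at x) v)"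
  using assms by (simp add: Ck_family_Suc)

lemma Ck_family_has_derivative:
  assumes "Ck_family (Suc k) I J W U y" "t \<in> I" "x \<in> U"
  shows "(y t has_derivative frechet_derivative (y t) (at x)) (at x)"
  using assms by (simp add: Ck_family_Suc flip: frechet_derivative_works)

lemma Ck_family_Suc_le: "Ck_family (Suc k) I J W U y \<Longrightarrow> Ck_family k I J W U y"
proof (induction k arbitrary: y)
  case 0
  then show ?case by (simp add: Ck_family_Suc)
next
  case (Suc k)
  then show ?case
    unfolding Ck_family_Suc[of "Suc k"] Ck_family_Suc[of k] by blast
qed

lemma Ck_family_cong:
  assumes "open U" "J \<subseteq> I"
  shows "Ck_family k I J W U y \<Longrightarrow> (\<And>t x. t \<in> I \<Longrightarrow> x \<in> U \<Longrightarrow> y t x = z t x) \<Longrightarrow>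
    Ck_family k I J W U z"
proof (induction k arbitrary: y z)
  case 0
  have "continuous_on (I \<times> U) (\<lambda>(t, x). z t x) = continuous_on (I \<times> U) (\<lambda>(t, x). y t x)"
    using 0 by (intro continuous_on_cong) auto
  moreover have "norm (z t x) = norm (y t x)" if "t \<in> J" "x \<in> U" for t x
    using 0 that assms by auto
  ultimately show ?case using 0(1) by auto
next
  case (Suc k)
  have "continuous_on (I \<times> U) (\<lambda>(t, x). z t x) = continuous_on (I \<times> U) (\<lambda>(t, x). y t x)"
    using Suc.prems(2) by (intro continuous_on_cong) auto
  moreover have "norm (z t x) = norm (y t x)" if "t \<in> J" "x \<in> U" for t x
    using Suc.prems(2) that assms by auto
  ultimately have "Ck_family 0 I J W U z"
    using Ck_family_0[OF Suc.prems(1)] by auto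
  moreover have "z t differentiable (at x)" if "t \<in> I" "x \<in> U" for t x
    using Suc.prems(1) that
    by (intro differentiable_cong_open[OF \<open>open U\<close> \<open>x \<in> U\<close> Suc.prems(2)])
      (simp_all add: Ck_family_Suc)
  moreover have "Ck_family k I J W U (\<lambda>t x. frechet_derivative (z t) (at x) v)" for v
  proof (rule Suc.IH[OF Ck_family_derivative[OF Suc.prems(1)]])
    fix t x assume tx: "t \<in> I" "x \<in> U"
    have "frechet_derivative (y t) (at x) = frechet_derivative (z t) (at x)"
      by (rule frechet_derivative_cong_open[OF \<open>open U\<close> tx(2)]) (rule Suc.prems(2)[OF tx(1)])
    then show "frechet_derivative (y t) (at x) v = frechet_derivative (z t) (at x) v" by simp
  qed
  ultimately show ?case
    by (simp add: Ck_family_Suc)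
qed

text \<open>Lets an induction step work with an explicit formula \<open>D\<close> for the
  derivative; congruence on the open set \<open>U\<close> exchanges it for the chosen
  \<open>frechet_derivative\<close>.\<close>

lemma Ck_family_SucI:
  assumes "open U" "J \<subseteq> I" "Ck_family 0 I J W U y"
    and D: "\<And>t x. t \<in> I \<Longrightarrow> x \<in> U \<Longrightarrow> (y t has_derivative D t x) (at x)"
    and "\<And>v. Ck_family k I J W U (\<lambda>t x. D t x v)"
  shows "Ck_family (Suc k) I J W U y"
proof -
  have "frechet_derivative (y t) (at x) = D t x" if "t \<in> I" "x \<in> U" for t x
    using frechet_derivative_at[OF D[OF that]] by simp
  then have "Ck_family k I J W U (\<lambda>t x. frechet_derivative (y t) (at x) v)" for v
    by (intro Ck_family_cong[OF assms(1,2) assms(5)[of v]]) simp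
  then show ?thesis
    using assms(3) D unfolding Ck_family_Suc differentiable_def by blast
qed

text \<open>\<open>{0}\<close> serves as a one-point index space, and \<open>J = {}\<close> makes
  the weight immaterial. Through this equivalence the closure lemmas for families also serve single
  functions.\<close>

lemma Ck_on_iff_Ck_family:
  fixes U :: "'a::euclidean_space set" and f :: "'a \<Rightarrow> 'b::real_normed_vector"
  shows "Ck_on k U f \<longleftrightarrow> Ck_family k {0::real} {} W U (\<lambda>_. f)"
proof (induction k arbitrary: f)
  have cont: "continuous_on ({0::real} \<times> U) (\<lambda>(t, x). f x) \<longleftrightarrow> continuous_on U f"
    for f :: "'a \<Rightarrow> 'b"
  proof
    assume "continuous_on ({0::real} \<times> U) (\<lambda>(t, x). f x)"
    then have "continuous_on U ((\<lambda>(t, x). f x) \<circ> (\<lambda>x. (0::real, x)))"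
      by (intro continuous_on_compose continuous_intros) (auto elim: continuous_on_subset)
    then show "continuous_on U f"
      by (simp add: o_def)
  next
    assume "continuous_on U f"
    then show "continuous_on ({0::real} \<times> U) (\<lambda>(t, x). f x)"
      unfolding case_prod_unfold
      by (rule continuous_on_compose2) (auto intro: continuous_intros)
  qed
  {
    case 0
    then show ?case by (simp add: cont)
  next
    case (Suc k)
    then show ?case
      by (auto simp: Ck_family_Suc cont
          intro!: continuous_at_imp_continuous_on differentiable_imp_continuous_within)
  }
qed

lemma Ck_on_cong:
  fixes f g :: "'a::euclidean_space \<Rightarrow> 'b::real_normed_vector"
  assumes "open U" "Ck_on k U f" "\<And>x. x \<in> U \<Longrightarrow> f x = g x"
  shows "Ck_on k U g"
proof -
  have "Ck_family k {0::real} {} (\<lambda>_. 1) U (\<lambda>_. f)"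
    using assms(2) by (simp only: Ck_on_iff_Ck_family[symmetric])
  then have "Ck_family k {0::real} {} (\<lambda>_. 1) U (\<lambda>_. g)"
    by (rule Ck_family_cong[OF assms(1), rotated]) (simp_all add: assms(3))
  then show ?thesis by (simp only: Ck_on_iff_Ck_family[symmetric])
qed

lemma Ck_on_const: "Ck_on k U (\<lambda>x. c)"
  by (induction k arbitrary: c) simp_all

lemma Ck_on_family:
  fixes U :: "'a::euclidean_space set" and f :: "'a \<Rightarrow> 'b::real_normed_vector"
  assumes "Ck_on k U f"
  shows "Ck_family k I {} W U (\<lambda>_. f)"
  using assms
proof (induction k arbitrary: f)
  have cont: "continuous_on U f \<Longrightarrow> continuous_on (I \<times> U) (\<lambda>(t, x). f x)" for f :: "'a \<Rightarrow> 'b"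
    unfolding case_prod_unfold
    by (rule continuous_on_compose2) (auto intro: continuous_intros)
  {
    case 0
    then show ?case by (simp add: cont)
  next
    case (Suc k)
    then show ?case
      by (auto simp: Ck_family_Suc
          intro!: cont continuous_at_imp_continuous_on differentiable_imp_continuous_within)
  }
qed

lemma Ck_on_continuous: "Ck_on k U f \<Longrightarrow> continuous_on U f"
  by (cases k)
    (auto intro!: continuous_at_imp_continuous_on differentiable_imp_continuous_within)

section \<open>Change of index set, domain and weight\<close>

lemma Ck_family_subset:
  fixes I :: "'i::topological_space set" and U :: "'a::euclidean_space set"
    and y :: "'i \<Rightarrow> 'a \<Rightarrow> 'b::real_normed_vector"
  assumes "I' \<subseteq> I" "J' \<subseteq> J" "U' \<subseteq> U"
  shows "Ck_family k I J W U y \<Longrightarrow> Ck_family k I' J' W U' y"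
proof (induction k arbitrary: y)
  have base: "Ck_family 0 I J W U y \<Longrightarrow> Ck_family 0 I' J' W U' y" for y :: "'i \<Rightarrow> 'a \<Rightarrow> 'b"
    using assms by (auto elim!: continuous_on_subset) (meson subsetD)
  {
    case 0
    then show ?case by (rule base)
  next
    case (Suc k)
    then show ?case
      using assms Suc.IH base[of y] unfolding Ck_family_Suc by blast
  }
qed

text \<open>Continuity refers to \<open>I\<close>, the bound to \<open>J\<close>, and
  differentiation to neither, so the two may come from different sources. This serves where a bound
  is at hand for the index \<open>0\<close> only.\<close>

lemma Ck_family_combine:
  "Ck_family k I {} W U y \<Longrightarrow> Ck_family k J J W U y \<Longrightarrow> Ck_family k I J W U y"
proof (induction k arbitrary: y)
  case (Suc k)
  have "Ck_family 0 I J W U y"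
    using Ck_family_0[OF Suc.prems(1)] Ck_family_0[OF Suc.prems(2)] by simp
  then show ?case
    using Suc unfolding Ck_family_Suc by blast
qed simp

text \<open>A continuous change of index commutes with differentiation in the other argument. It
  freezes the flow at one time (\<open>Ck_family_at\<close>) and samples it at the times
  \<open>n * T\<close>.\<close>

lemma Ck_family_reindex:
  fixes I :: "'i::topological_space set" and U :: "'a::euclidean_space set"
    and y :: "'i \<Rightarrow> 'a \<Rightarrow> 'b::real_normed_vector"
  assumes "continuous_on I' p" "p ` I' \<subseteq> I"
  shows "Ck_family k I {} W U y \<Longrightarrow> Ck_family k I' {} W' U (\<lambda>t. y (p t))"
proof (induction k arbitrary: y)
  have base: "Ck_family 0 I {} W U y \<Longrightarrow> Ck_family 0 I' {} W' U (\<lambda>t. y (p t))"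
    for y :: "'i \<Rightarrow> 'a \<Rightarrow> 'b"
  proof -
    assume "Ck_family 0 I {} W U y"
    then have *: "continuous_on (I \<times> U) (\<lambda>z. y (fst z) (snd z))"
      by (simp add: case_prod_unfold)
    have "continuous_on (I' \<times> U) (\<lambda>z. y (fst (p (fst z), snd z)) (snd (p (fst z), snd z)))"
      by (rule continuous_on_compose2[OF *])
        (use assms in \<open>auto intro!: continuous_intros continuous_on_compose2[OF assms(1)]\<close>)
    then show ?thesis by (simp add: case_prod_unfold)
  qed
  {
    case 0
    then show ?case by (rule base)
  next
    case (Suc k)
    then show ?case
      using assms(2) Suc.IH base[of y] unfolding Ck_family_Suc by blast
  }
qed

lemma Ck_family_at:
  assumes "Ck_family k I {} W U y" "t \<in> I"
  shows "Ck_on k U (y t)"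
proof -
  have "Ck_family k {0::real} {} (\<lambda>_. 1) U (\<lambda>_. y t)"
    by (rule Ck_family_reindex[where p = "\<lambda>_. t", OF _ _ assms(1)]) (use assms(2) in auto)
  then show ?thesis by (simp add: Ck_on_iff_Ck_family[where W = "\<lambda>_. 1"])
qed

lemma Ck_family_weight_mono:
  fixes I :: "'i::topological_space set" and U :: "'a::euclidean_space set"
    and y :: "'i \<Rightarrow> 'a \<Rightarrow> 'b::real_normed_vector"
  assumes "\<And>t. t \<in> J \<Longrightarrow> 0 \<le> W t \<and> W t \<le> W' t"
  shows "Ck_family k I J W U y \<Longrightarrow> Ck_family k I J W' U y"
proof (induction k arbitrary: y)
  have base: "Ck_family 0 I J W U y \<Longrightarrow> Ck_family 0 I J W' U y" for y :: "'i \<Rightarrow> 'a \<Rightarrow> 'b"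
  proof -
    assume *: "Ck_family 0 I J W U y"
    then obtain c where c: "\<And>t x. t \<in> J \<Longrightarrow> x \<in> U \<Longrightarrow> norm (y t x) \<le> c * W t"
      by auto
    \<comment> \<open>The constant \<open>c\<close> may be negative, and enlarging the weight
      preserves the bound only for a nonnegative factor.\<close>
    have "norm (y t x) \<le> \<bar>c\<bar> * W' t" if "t \<in> J" "x \<in> U" for t x
    proof -
      have "norm (y t x) \<le> \<bar>c\<bar> * W t"
        using c[OF that] assms[OF that(1)] mult_right_mono[OF abs_ge_self[of c], of "W t"] by simp
      also have "\<dots> \<le> \<bar>c\<bar> * W' t"
        using assms[OF that(1)] by (intro mult_left_mono) auto
      finally show ?thesis .
    qed
    then show ?thesis using * by auto
  qed
  {
    case 0
    then show ?case by (rule base)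
  next
    case (Suc k)
    then show ?case
      using Suc.IH base[of y] unfolding Ck_family_Suc by blast
  }
qed

section \<open>Constants, linear and bilinear images, sums and composites\<close>

lemma Ck_family_const:
  fixes c :: "'b::real_normed_vector"
  assumes "\<And>t. t \<in> J \<Longrightarrow> 1 \<le> W t"
  shows "Ck_family k I J W U (\<lambda>t x. c)"
proof (induction k arbitrary: c)
  have base: "Ck_family 0 I J W U (\<lambda>t x. c)" for c :: 'b
  proof -
    have "norm c \<le> norm c * W t" if "t \<in> J" for t
      using mult_left_mono[OF assms[OF that] norm_ge_zero[of c]] by simp
    then show ?thesis
      by (auto simp: case_prod_unfold intro!: exI[of _ "norm c"])
  qed
  {
    case 0
    then show ?case by (rule base)
  next
    case (Suc k)
    then show ?case
      using base[of c] by (simp add: Ck_family_Suc del: Ck_family.simps(1))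
  }
qed

lemma Ck_family_zero: "Ck_family k I J W U (\<lambda>t x. 0)"
proof (induction k)
  have base: "Ck_family 0 I J W U (\<lambda>t x. 0)"
    by (auto simp: case_prod_unfold intro!: exI[of _ 0])
  {
    case 0
    then show ?case by (rule base)
  next
    case (Suc k)
    then show ?case
      using base by (simp add: Ck_family_Suc del: Ck_family.simps(1))
  }
qed

lemma Ck_family_linear:
  fixes I :: "'i::topological_space set" and U :: "'a::euclidean_space set"
    and y :: "'i \<Rightarrow> 'a \<Rightarrow> 'b::real_normed_vector"
  assumes L: "bounded_linear L" and U: "open U" "J \<subseteq> I"
    and W: "\<And>t. t \<in> J \<Longrightarrow> 0 \<le> W t"
  shows "Ck_family k I J W U y \<Longrightarrow> Ck_family k I J W U (\<lambda>t x. L (y t x))"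
proof (induction k arbitrary: y)
  have base: "Ck_family 0 I J W U (\<lambda>t x. L (y t x))"
    if *: "Ck_family 0 I J W U y" for y :: "'i \<Rightarrow> 'a \<Rightarrow> 'b"
  proof -
    obtain c where c: "\<And>t x. t \<in> J \<Longrightarrow> x \<in> U \<Longrightarrow> norm (y t x) \<le> c * W t"
      using Ck_family_bound[OF *(1)] by blast
    obtain K where K: "\<And>x. norm (L x) \<le> norm x * K" "K > 0"
      using bounded_linear.pos_bounded[OF L] by blast
    have "norm (L (y t x)) \<le> (K * c) * W t" if "t \<in> J" "x \<in> U" for t x
    proof -
      have "norm (L (y t x)) \<le> norm (y t x) * K" by (rule K)
      also have "\<dots> \<le> (c * W t) * K"
        using c[OF that] K(2) by (intro mult_right_mono) auto
      finally show ?thesis by (simp add: mult_ac)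
    qed
    moreover have "continuous_on (I \<times> U) (\<lambda>(t, x). L (y t x))"
      using * bounded_linear.continuous_on[OF L, of "I \<times> U" "\<lambda>(t, x). y t x"]
      by (simp add: case_prod_unfold)
    ultimately show ?thesis by auto
  qed
  {
    case 0
    then show ?case by (rule base)
  next
    case (Suc k)
    show ?case
    proof (rule Ck_family_SucI[OF U base])
      show "Ck_family 0 I J W U y" using Suc.prems by (rule Ck_family_0)
      show "((\<lambda>x. L (y t x)) has_derivative (\<lambda>v. L (frechet_derivative (y t) (at x) v))) (at x)"
        if "t \<in> I" "x \<in> U" for t x
        using bounded_linear.has_derivative[OF L Ck_family_has_derivative[OF Suc.prems that]] .
      show "Ck_family k I J W U (\<lambda>t x. L (frechet_derivative (y t) (at x) v))" for v
        by (rule Suc.IH[OF Ck_family_derivative[OF Suc.prems]])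
    qed
  }
qed

lemma Ck_family_add:
  fixes I :: "'i::topological_space set" and U :: "'a::euclidean_space set"
    and y :: "'i \<Rightarrow> 'a \<Rightarrow> 'b::real_normed_vector"
  assumes U: "open U" "J \<subseteq> I"
  shows "Ck_family k I J W U y \<Longrightarrow> Ck_family k I J W U z \<Longrightarrow>
    Ck_family k I J W U (\<lambda>t x. y t x + z t x)"
proof (induction k arbitrary: y z)
  have base: "Ck_family 0 I J W U (\<lambda>t x. y t x + z t x)"
    if *: "Ck_family 0 I J W U y" "Ck_family 0 I J W U z" for y z :: "'i \<Rightarrow> 'a \<Rightarrow> 'b"
  proof -
    obtain c where c: "\<And>t x. t \<in> J \<Longrightarrow> x \<in> U \<Longrightarrow> norm (y t x) \<le> c * W t"
      using Ck_family_bound[OF *(1)] by blast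
    obtain d where d: "\<And>t x. t \<in> J \<Longrightarrow> x \<in> U \<Longrightarrow> norm (z t x) \<le> d * W t"
      using Ck_family_bound[OF *(2)] by blast
    have "norm (y t x + z t x) \<le> (c + d) * W t" if "t \<in> J" "x \<in> U" for t x
      using norm_triangle_le[OF add_mono[OF c[OF that] d[OF that]]] by (simp add: algebra_simps)
    moreover have "continuous_on (I \<times> U) (\<lambda>(t, x). y t x + z t x)"
      using * by (auto simp: case_prod_unfold intro: continuous_intros)
    ultimately show ?thesis by auto
  qed
  {
    case 0
    then show ?case by (intro base)
  next
    case (Suc k)
    show ?case
    proof (rule Ck_family_SucI[OF U base])
      show "Ck_family 0 I J W U y" "Ck_family 0 I J W U z" by (rule Suc.prems[THEN Ck_family_0])+
      show "((\<lambda>x. y t x + z t x) has_derivative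
        (\<lambda>v. frechet_derivative (y t) (at x) v + frechet_derivative (z t) (at x) v)) (at x)"
        if "t \<in> I" "x \<in> U" for t x
        using Suc.prems that by (intro has_derivative_add Ck_family_has_derivative)
      show "Ck_family k I J W U
        (\<lambda>t x. frechet_derivative (y t) (at x) v + frechet_derivative (z t) (at x) v)" for v
        by (intro Suc.IH Ck_family_derivative Suc.prems)
    qed
  }
qed

lemma Ck_family_sum:
  assumes U: "open U" "J \<subseteq> I"
    and "\<And>i. i \<in> A \<Longrightarrow> Ck_family k I J W U (y i)"
  shows "Ck_family k I J W U (\<lambda>t x. \<Sum>i\<in>A. y i t x)"
  using assms(3)
proof (induction A rule: infinite_finite_induct)
  case (insert i A)
  then show ?case
    using Ck_family_add[OF U, of k W "y i" "\<lambda>t x. \<Sum>i\<in>A. y i t x"] by simp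
qed (simp_all add: Ck_family_zero)

text \<open>Weights multiply: a bounded coefficient (weight 1) times a family of weight
  \<open>\<rho> ^ n\<close> again has weight \<open>\<rho> ^ n\<close>. This is how decay passes
  through the product rule.\<close>

lemma Ck_family_bilinear:
  assumes B: "bounded_bilinear B" and U: "open U" "J \<subseteq> I"
    and W: "\<And>t. t \<in> J \<Longrightarrow> 0 \<le> W t" "\<And>t. t \<in> J \<Longrightarrow> 0 \<le> W' t"
  shows "Ck_family k I J W U y \<Longrightarrow> Ck_family k I J W' U z \<Longrightarrow>
    Ck_family k I J (\<lambda>t. W t * W' t) U (\<lambda>t x. B (y t x) (z t x))"
proof (induction k arbitrary: y z)
  have base: "Ck_family 0 I J (\<lambda>t. W t * W' t) U (\<lambda>t x. B (y t x) (z t x))"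
    if *: "Ck_family 0 I J W U y" "Ck_family 0 I J W' U z" for y z
  proof -
    obtain c where c: "\<And>t x. t \<in> J \<Longrightarrow> x \<in> U \<Longrightarrow> norm (y t x) \<le> c * W t"
      using Ck_family_bound[OF *(1)] by blast
    obtain d where d: "\<And>t x. t \<in> J \<Longrightarrow> x \<in> U \<Longrightarrow> norm (z t x) \<le> d * W' t"
      using Ck_family_bound[OF *(2)] by blast
    obtain K where K: "\<And>x y. norm (B x y) \<le> norm x * norm y * K" "K > 0"
      using bounded_bilinear.pos_bounded[OF B] by blast
    have "norm (B (y t x) (z t x)) \<le> (K * \<bar>c\<bar> * \<bar>d\<bar>) * (W t * W' t)"
      if "t \<in> J" "x \<in> U" for t x
    proof -
      have 1: "norm (y t x) \<le> \<bar>c\<bar> * W t"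
        using c[OF that] W(1)[OF that(1)] mult_right_mono[OF abs_ge_self[of c], of "W t"] by simp
      have 2: "norm (z t x) \<le> \<bar>d\<bar> * W' t"
        using d[OF that] W(2)[OF that(1)] mult_right_mono[OF abs_ge_self[of d], of "W' t"] by simp
      have "norm (B (y t x) (z t x)) \<le> norm (y t x) * norm (z t x) * K" by (rule K)
      also have "\<dots> \<le> ((\<bar>c\<bar> * W t) * (\<bar>d\<bar> * W' t)) * K"
        using 1 2 K(2) W that by (intro mult_right_mono mult_mono) auto
      finally show ?thesis by (simp add: mult_ac)
    qed
    moreover have "continuous_on (I \<times> U) (\<lambda>(t, x). B (y t x) (z t x))"
      using * bounded_bilinear.continuous_on[OF B]
      by (auto simp: case_prod_unfold)
    ultimately show ?thesis by auto
  qed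
  {
    case 0
    then show ?case by (intro base)
  next
    case (Suc k)
    show ?case
    proof (rule Ck_family_SucI[OF U base])
      show "Ck_family 0 I J W U y" "Ck_family 0 I J W' U z" by (rule Suc.prems[THEN Ck_family_0])+
      show "((\<lambda>x. B (y t x) (z t x)) has_derivative
        (\<lambda>v. B (y t x) (frechet_derivative (z t) (at x) v)
           + B (frechet_derivative (y t) (at x) v) (z t x))) (at x)"
        if "t \<in> I" "x \<in> U" for t x
        using Suc.prems that by (intro bounded_bilinear.FDERIV[OF B] Ck_family_has_derivative)
      show "Ck_family k I J (\<lambda>t. W t * W' t) U (\<lambda>t x. B (y t x) (frechet_derivative (z t) (at x) v)
           + B (frechet_derivative (y t) (at x) v) (z t x))" for v
        by (intro Ck_family_add U Suc.IH Ck_family_derivative Suc.prems Ck_family_Suc_le[of k])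
    qed
  }
qed

lemma frechet_derivative_expand:
  assumes "f differentiable (at x)"
  shows "frechet_derivative f (at x) v = (\<Sum>b\<in>Basis. (v \<bullet> b) *\<^sub>R frechet_derivative f (at x) b)"
proof -
  interpret linear "frechet_derivative f (at x)"
    using assms by (rule linear_frechet_derivative)
  show ?thesis
    by (subst (1) euclidean_representation[of v, symmetric]) (simp add: sum scale)
qed

lemma Ck_on_differentiable: "Ck_on (Suc k) U f \<Longrightarrow> x \<in> U \<Longrightarrow> f differentiable (at x)"
  by simp

lemma Ck_on_Suc_le: "Ck_on (Suc k) U f \<Longrightarrow> Ck_on k U f"
  using Ck_on_iff_Ck_family[where W = "\<lambda>_. 1"] Ck_family_Suc_le by blast

text \<open>The shape of the chain rule and of a matrix-vector product in coordinates. Expanding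
  over \<open>Basis\<close> keeps all coefficients vector-valued, so that no operator-valued
  derivatives appear.\<close>

lemma Ck_family_inner_scale:
  assumes U: "open U" "J \<subseteq> I"
    and W: "\<And>t. t \<in> J \<Longrightarrow> 0 \<le> W t" "\<And>t. t \<in> J \<Longrightarrow> 0 \<le> W' t"
    and y: "Ck_family k I J W U y" and a: "\<And>b. b \<in> Basis \<Longrightarrow> Ck_family k I J W' U (a b)"
  shows "Ck_family k I J (\<lambda>t. W t * W' t) U (\<lambda>t x. \<Sum>b\<in>Basis. (y t x \<bullet> b) *\<^sub>R a b t x)"
  by (intro Ck_family_sum U Ck_family_bilinear bounded_bilinear_scaleR W a
      Ck_family_linear[OF bounded_linear_inner_left] y)

text \<open>Induction on \<open>k\<close> with \<open>y\<close> fixed and \<open>F\<close> varying: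
  by the chain rule the coefficients are composites of the same \<open>y\<close> with directional
  derivatives of \<open>F\<close>, which have one order less. Compactness of \<open>K\<close> bounds
  \<open>F\<close> along \<open>J\<close>; for \<open>J = {}\<close> one takes
  \<open>K = {}\<close>.\<close>

lemma Ck_family_compose:
  fixes F :: "'c::euclidean_space \<Rightarrow> 'd::real_normed_vector"
  assumes U: "open U" "J \<subseteq> I" and \<Omega>: "open \<Omega>"
    and y\<Omega>: "\<And>t x. t \<in> I \<Longrightarrow> x \<in> U \<Longrightarrow> y t x \<in> \<Omega>"
    and K: "compact K" "K \<subseteq> \<Omega>" "\<And>t x. t \<in> J \<Longrightarrow> x \<in> U \<Longrightarrow> y t x \<in> K"
  shows "Ck_on k \<Omega> F \<Longrightarrow> Ck_family k I J (\<lambda>_. 1) U y \<Longrightarrow>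
    Ck_family k I J (\<lambda>_. 1) U (\<lambda>t x. F (y t x))"
proof (induction k arbitrary: F)
  have base: "Ck_family 0 I J (\<lambda>_. 1) U (\<lambda>t x. F (y t x))"
    if F: "continuous_on \<Omega> F" and y: "Ck_family 0 I J (\<lambda>_. 1) U y" for F :: "'c \<Rightarrow> 'd"
  proof -
    have "bounded (F ` K)"
      using F K by (intro compact_imp_bounded compact_continuous_image)
        (auto elim: continuous_on_subset)
    then obtain c where c: "\<And>z. z \<in> K \<Longrightarrow> norm (F z) \<le> c"
      unfolding bounded_iff by auto
    have "continuous_on (I \<times> U) (\<lambda>z. F ((\<lambda>(t, x). y t x) z))"
      using y y\<Omega> by (intro continuous_on_compose2[OF F]) auto
    then show ?thesis
      using c K(3) by (auto simp: case_prod_unfold)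
  qed
  {
    case 0
    then show ?case by (intro base) auto
  next
    case (Suc k)
    show ?case
    proof (rule Ck_family_SucI[OF U base])
      show "continuous_on \<Omega> F" "Ck_family 0 I J (\<lambda>_. 1) U y"
        using Suc.prems Ck_on_continuous Ck_family_0 by blast+
      show "((\<lambda>x. F (y t x)) has_derivative
        (\<lambda>v. \<Sum>b\<in>Basis. (frechet_derivative (y t) (at x) v \<bullet> b) *\<^sub>R
           frechet_derivative F (at (y t x)) b)) (at x)"
        if "t \<in> I" "x \<in> U" for t x
      proof -
        have F: "F differentiable (at (y t x))"
          using Suc.prems(1) y\<Omega>[OF that] by simp
        show ?thesis
          using has_derivative_compose[OF Ck_family_has_derivative[OF Suc.prems(2) that]
              F[unfolded frechet_derivative_works]]
          by (subst (asm) frechet_derivative_expand[OF F])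
      qed
      have "Ck_family k I J (\<lambda>t. 1 * 1) U (\<lambda>t x. \<Sum>b\<in>Basis.
          (frechet_derivative (y t) (at x) v \<bullet> b) *\<^sub>R frechet_derivative F (at (y t x)) b)" for v
        by (rule Ck_family_inner_scale[OF U _ _ Ck_family_derivative[OF Suc.prems(2)] Suc.IH])
          (use Suc.prems Ck_family_Suc_le in auto)
      then show "Ck_family k I J (\<lambda>_. 1) U (\<lambda>t x. \<Sum>b\<in>Basis.
          (frechet_derivative (y t) (at x) v \<bullet> b) *\<^sub>R frechet_derivative F (at (y t x)) b)" for v
        by simp
    qed
  }
qed

section \<open>Gronwall estimates and locally uniform expansions\<close>

text \<open>The growth bound is demanded on the open interval only. This lets the estimate reach up
  to a first exit time, at which the bound itself is not yet available.\<close>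

lemma gronwall_norm:
  fixes w :: "real \<Rightarrow> 'b::real_inner"
  assumes T: "0 \<le> T" and L: "0 \<le> L" and \<beta>: "0 \<le> \<beta>"
    and w': "\<And>t. t \<in> {0..T} \<Longrightarrow> (w has_vector_derivative w' t) (at t within {0..T})"
    and bd: "\<And>t. 0 < t \<Longrightarrow> t < T \<Longrightarrow> norm (w' t) \<le> L * norm (w t) + \<beta>"
  shows "norm (w T) \<le> (norm (w 0) + \<beta> * T) * exp (L * T)"
proof (rule field_le_epsilon)
  fix e :: real assume "e > 0"
  \<comment> \<open>The initial error \<open>\<eta>\<close>, amplified by
    \<open>exp (L * T)\<close>, becomes exactly \<open>e\<close>.\<close>
  define \<eta> where "\<eta> = e / exp (L * T)"
  have "\<eta> > 0" using \<open>e > 0\<close> by (simp add: \<eta>_def)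
  \<comment> \<open>smoothing of the norm, which is not differentiable at the origin\<close>
  define \<psi> where "\<psi> t = sqrt (w t \<bullet> w t + \<eta>\<^sup>2)" for t
  have pos: "w t \<bullet> w t + \<eta>\<^sup>2 > 0" for t
    using \<open>\<eta> > 0\<close> by (intro add_nonneg_pos) auto
  have \<psi>pos: "\<psi> t > 0" for t using pos by (simp add: \<psi>_def)
  have \<psi>ge: "norm (w t) \<le> \<psi> t" for t
    unfolding \<psi>_def norm_eq_sqrt_inner by simp
  have "norm (w 0) + \<eta> \<ge> \<psi> 0"
    using sqrt_add_le_add_sqrt[of "w 0 \<bullet> w 0" "\<eta>\<^sup>2"] \<open>\<eta> > 0\<close>
    by (simp add: \<psi>_def norm_eq_sqrt_inner)
  \<comment> \<open>The derivative of \<open>\<psi>\<close> is at most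
    \<open>L * \<psi> + \<beta>\<close>, so that of \<open>\<psi> t * exp (- L * t)\<close> is at
    most \<open>\<beta> * exp (- L * t)\<close>, hence at most \<open>\<beta>\<close>.\<close>
  moreover have "\<psi> T * exp (- L * T) - \<beta> * T \<le> \<psi> 0 * exp (- L * 0) - \<beta> * 0"
  proof (rule DERIV_nonpos_imp_decreasing_open[OF T])
    fix t assume t: "0 < t" "t < T"
    have "(w has_vector_derivative w' t) (at t)"
      using w'[of t] t by (simp add: at_within_Icc_at)
    then have w_der: "(w has_derivative (\<lambda>h. h *\<^sub>R w' t)) (at t)"
      by (simp add: has_vector_derivative_def)
    have "((\<lambda>t. w t \<bullet> w t) has_derivative (\<lambda>h. w t \<bullet> (h *\<^sub>R w' t) + (h *\<^sub>R w' t) \<bullet> w t)) (at t)"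
      by (rule has_derivative_inner[OF w_der w_der])
    then have ww: "((\<lambda>t. w t \<bullet> w t) has_real_derivative 2 * (w t \<bullet> w' t)) (at t)"
      unfolding has_field_derivative_def
      by (rule has_derivative_eq_rhs) (simp add: fun_eq_iff inner_commute)
    have \<psi>_der: "(\<psi> has_real_derivative (w t \<bullet> w' t) / \<psi> t) (at t)"
    proof -
      define a where "a t = w t \<bullet> w t + \<eta>\<^sup>2" for t
      have "(a has_real_derivative 2 * (w t \<bullet> w' t)) (at t)"
        using DERIV_add[OF ww DERIV_const, of "\<eta>\<^sup>2"] by (simp add: a_def[abs_def])
      moreover have "(sqrt has_real_derivative inverse (sqrt (a t)) / 2) (at (a t))"
        using pos[of t] by (intro DERIV_real_sqrt) (simp add: a_def)
      ultimately have "((\<lambda>t. sqrt (a t)) has_real_derivative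
          inverse (sqrt (a t)) / 2 * (2 * (w t \<bullet> w' t))) (at t)"
        by (intro DERIV_chain2[where f = sqrt and g = a])
      moreover have "\<psi> = (\<lambda>t. sqrt (a t))" by (simp add: \<psi>_def[abs_def] a_def)
      moreover have "inverse (sqrt (a t)) / 2 * (2 * (w t \<bullet> w' t)) = (w t \<bullet> w' t) / \<psi> t"
        by (simp add: \<psi>_def a_def inverse_eq_divide)
      ultimately show ?thesis by metis
    qed
    have "((\<lambda>t. \<psi> t * exp (- L * t) - \<beta> * t) has_real_derivative
        ((w t \<bullet> w' t) / \<psi> t - L * \<psi> t) * exp (- L * t) - \<beta>) (at t)"
      by (rule derivative_eq_intros \<psi>_der refl | simp add: field_simps)+
    moreover have "((w t \<bullet> w' t) / \<psi> t - L * \<psi> t) * exp (- L * t) - \<beta> \<le> 0"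
    proof -
      have "w t \<bullet> w' t \<le> norm (w t) * norm (w' t)" by (rule norm_cauchy_schwarz)
      also have "\<dots> \<le> \<psi> t * (L * \<psi> t + \<beta>)"
        using bd[OF t] \<psi>ge[of t] mult_left_mono[OF \<psi>ge[of t] L] \<psi>pos[of t]
        by (intro mult_mono) auto
      finally have "(w t \<bullet> w' t) / \<psi> t - L * \<psi> t \<le> \<beta>"
        using \<psi>pos[of t] by (simp add: field_simps)
      then have "((w t \<bullet> w' t) / \<psi> t - L * \<psi> t) * exp (- L * t) \<le> \<beta> * exp (- L * t)"
        by (intro mult_right_mono) auto
      also have "\<dots> \<le> \<beta> * 1"
        using L \<beta> t by (intro mult_left_mono) auto
      finally show ?thesis by simp
    qed
    ultimately show "\<exists>y. ((\<lambda>t. \<psi> t * exp (- L * t) - \<beta> * t) has_real_derivative y) (at t) \<and> y \<le> 0"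
      by blast
  next
    have "continuous_on {0..T} w"
      unfolding continuous_on_eq_continuous_within
      using w' has_vector_derivative_continuous by blast
    then show "continuous_on {0..T} (\<lambda>t. \<psi> t * exp (- L * t) - \<beta> * t)"
      unfolding \<psi>_def by (intro continuous_intros)
  qed
  ultimately have "\<psi> T * exp (- L * T) \<le> norm (w 0) + \<eta> + \<beta> * T"
    by simp
  then have "\<psi> T \<le> (norm (w 0) + \<eta> + \<beta> * T) * exp (L * T)"
    by (simp add: exp_minus field_simps)
  also have "\<dots> = (norm (w 0) + \<beta> * T) * exp (L * T) + e"
    by (simp add: \<eta>_def algebra_simps)
  finally show "norm (w T) \<le> (norm (w 0) + \<beta> * T) * exp (L * T) + e"
    using \<psi>ge[of T] by simp
qed

lemma gronwall_norm_Icc: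
  fixes w :: "real \<Rightarrow> 'b::real_inner"
  assumes L: "0 \<le> L" and \<beta>: "0 \<le> \<beta>"
    and w': "\<And>t. t \<in> {0..T} \<Longrightarrow> (w has_vector_derivative w' t) (at t within {0..T})"
    and bd: "\<And>t. t \<in> {0..T} \<Longrightarrow> norm (w' t) \<le> L * norm (w t) + \<beta>"
    and t: "t \<in> {0..T}"
  shows "norm (w t) \<le> (norm (w 0) + \<beta> * T) * exp (L * T)"
proof -
  have "norm (w t) \<le> (norm (w 0) + \<beta> * t) * exp (L * t)"
    using t L \<beta> bd by (intro gronwall_norm[where w' = w'])
      (auto intro!: has_vector_derivative_within_subset[OF w'])
  also have "\<dots> \<le> (norm (w 0) + \<beta> * T) * exp (L * T)"
    using t L \<beta> by (intro mult_mono add_mono) (auto intro!: mult_left_mono)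
  finally show ?thesis .
qed

text \<open>Linear maps with coefficients depending on parameters are given by their values on the basis.\<close>

definition basis_comb :: "('a::euclidean_space \<Rightarrow> 'b::real_vector) \<Rightarrow> 'a \<Rightarrow> 'b" where
  "basis_comb m z = (\<Sum>b\<in>Basis. (z \<bullet> b) *\<^sub>R m b)"

lemma linear_basis_comb: "linear (basis_comb m)"
  by (rule linearI)
    (simp_all add: basis_comb_def inner_add_left scaleR_add_left sum.distrib scaleR_sum_right)

lemma basis_comb_diff: "basis_comb m (z - w) = basis_comb m z - basis_comb m w"
  using linear_basis_comb by (rule linear_diff)

lemma basis_comb_add: "basis_comb m (z + w) = basis_comb m z + basis_comb m w"
  using linear_basis_comb by (rule linear_add)

lemma basis_comb_scale: "basis_comb m (c *\<^sub>R z) = c *\<^sub>R basis_comb m z"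
  using linear_basis_comb by (rule linear_scale)

lemma basis_comb_diff_left: "basis_comb (\<lambda>b. m b - m' b) z = basis_comb m z - basis_comb m' z"
  by (simp add: basis_comb_def scaleR_diff_right sum_subtractf)

lemma basis_comb_linear: "linear f \<Longrightarrow> basis_comb f v = f v"
  unfolding basis_comb_def
  by (subst (2) euclidean_representation[of v, symmetric]) (simp add: linear_sum linear_scale)

lemma norm_basis_comb_le:
  fixes m :: "'a::euclidean_space \<Rightarrow> 'b::real_normed_vector"
  assumes "\<And>b. b \<in> Basis \<Longrightarrow> norm (m b) \<le> K"
  shows "norm (basis_comb m z) \<le> real DIM('a) * K * norm z"
proof -
  have "norm (basis_comb m z) \<le> (\<Sum>b\<in>Basis. norm ((z \<bullet> b) *\<^sub>R m b))"
    unfolding basis_comb_def by (rule norm_sum)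
  also have "\<dots> \<le> (\<Sum>b\<in>(Basis::'a set). norm z * K)"
    using assms Basis_le_norm by (intro sum_mono) (auto intro!: mult_mono)
  finally show ?thesis by (simp add: mult_ac)
qed

lemma frechet_derivative_basis_comb:
  assumes "f differentiable (at x)"
  shows "frechet_derivative f (at x) v = basis_comb (frechet_derivative f (at x)) v"
  using basis_comb_linear[OF linear_frechet_derivative[OF assms]] by simp

lemma continuous_on_basis_comb:
  fixes m :: "'b::euclidean_space \<Rightarrow> 'c::topological_space \<Rightarrow> 'd::real_normed_vector"
  assumes "continuous_on S z" "\<And>b. b \<in> Basis \<Longrightarrow> continuous_on S (m b)"
  shows "continuous_on S (\<lambda>t. basis_comb (\<lambda>b. m b t) (z t))"
  unfolding basis_comb_def using assms by (intro continuous_intros)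

section \<open>Uniformity over a compact index set\<close>

text \<open>Tube lemma: compactness of \<open>I\<close> lets one neighbourhood of \<open>x0\<close>
  serve all indices.\<close>

lemma joint_continuity_tube:
  fixes y :: "'i::metric_space \<Rightarrow> 'a::metric_space \<Rightarrow> 'b::real_normed_vector"
  assumes cont: "continuous_on (I \<times> U) (\<lambda>(t, x). y t x)"
    and I: "compact I" and U: "open U" "x0 \<in> U" and "\<eta> > 0"
  obtains \<delta> where "\<delta> > 0" "ball x0 \<delta> \<subseteq> U"
    "\<And>t x. t \<in> I \<Longrightarrow> x \<in> ball x0 \<delta> \<Longrightarrow> norm (y t x - y t x0) \<le> \<eta>"
proof -
  have "continuous_on (U \<times> I) (\<lambda>(x, t). y t x)"
    using continuous_on_compose2[OF cont continuous_on_swap, of "U \<times> I"]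
    by (simp add: case_prod_unfold prod.swap_def image_subset_iff)
  from continuous_on_prod_compactE[OF this I U(2) \<open>\<eta> > 0\<close>] obtain X
    where X: "x0 \<in> X" "open X" "\<forall>x\<in>X \<inter> U. \<forall>t\<in>I. dist (y t x) (y t x0) \<le> \<eta>"
    unfolding prod.case by blast
  have "open (X \<inter> U)" "x0 \<in> X \<inter> U" using X U by auto
  then obtain \<delta> where \<delta>: "\<delta> > 0" "ball x0 \<delta> \<subseteq> X \<inter> U"
    using open_contains_ball by blast
  show ?thesis
  proof (rule that[OF \<delta>(1)])
    show "ball x0 \<delta> \<subseteq> U" using \<delta>(2) by blast
    show "norm (y t x - y t x0) \<le> \<eta>" if "t \<in> I" "x \<in> ball x0 \<delta>" for t x
      using X(3) \<delta>(2) that by (metis dist_norm subsetD)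
  qed
qed

text \<open>Each function is bounded on the compact slice over \<open>x0\<close>, and a tube of
  tolerance 1 carries the bound to a ball. The finite set \<open>B\<close> is there for the columns
  of a coefficient matrix.\<close>

lemma joint_continuity_bound:
  fixes y :: "'j \<Rightarrow> 'i::metric_space \<Rightarrow> 'a::metric_space \<Rightarrow> 'b::real_normed_vector"
  assumes "finite B" and cont: "\<And>b. b \<in> B \<Longrightarrow> continuous_on (I \<times> U) (\<lambda>(t, x). y b t x)"
    and I: "compact I" and U: "open U" "x0 \<in> U"
  obtains \<delta> K where "\<delta> > 0" "ball x0 \<delta> \<subseteq> U" "K \<ge> 0"
    "\<And>b t x. b \<in> B \<Longrightarrow> t \<in> I \<Longrightarrow> x \<in> ball x0 \<delta> \<Longrightarrow> norm (y b t x) \<le> K"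
proof -
  have "\<exists>\<delta>>0. \<exists>K\<ge>0. ball x0 \<delta> \<subseteq> U \<and> (\<forall>b\<in>B. \<forall>t\<in>I. \<forall>x\<in>ball x0 \<delta>. norm (y b t x) \<le> K)"
    using \<open>finite B\<close> cont
  proof (induction B rule: finite_induct)
    case empty
    obtain \<delta> where "\<delta> > 0" "ball x0 \<delta> \<subseteq> U" using U open_contains_ball by blast
    then show ?case by auto
  next
    case (insert b B)
    then obtain \<delta> K where \<delta>: "\<delta> > 0" "K \<ge> 0" "ball x0 \<delta> \<subseteq> U"
      "\<And>b t x. b \<in> B \<Longrightarrow> t \<in> I \<Longrightarrow> x \<in> ball x0 \<delta> \<Longrightarrow> norm (y b t x) \<le> K"
      by auto
    obtain \<delta>' where \<delta>': "\<delta>' > 0"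
      "\<And>t x. t \<in> I \<Longrightarrow> x \<in> ball x0 \<delta>' \<Longrightarrow> norm (y b t x - y b t x0) \<le> 1"
      by (rule joint_continuity_tube[OF insert.prems[of b] I U, of 1]) auto
    have "continuous_on I (\<lambda>t. y b t x0)"
      using continuous_on_compose2[OF insert.prems[of b], of I "\<lambda>t. (t, x0)"] U(2)
      by (simp add: image_subset_iff continuous_on_Pair)
    then have "bounded ((\<lambda>t. y b t x0) ` I)"
      using I compact_continuous_image compact_imp_bounded by blast
    then obtain c where c: "\<And>t. t \<in> I \<Longrightarrow> norm (y b t x0) \<le> c"
      by (auto simp: bounded_iff)
    have "norm (y b' t x) \<le> max K (c + 1)"
      if "b' \<in> insert b B" "t \<in> I" "x \<in> ball x0 (min \<delta> \<delta>')" for b' t x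
    proof (cases "b' \<in> B")
      case True
      then have "norm (y b' t x) \<le> K" using that \<delta>(4)[of b' t x] by auto
      then show ?thesis by simp
    next
      case False
      then have [simp]: "b' = b" using that by simp
      have "norm (y b t x) \<le> norm (y b t x - y b t x0) + norm (y b t x0)"
        by (metis norm_triangle_sub add.commute)
      also have "\<dots> \<le> c + 1"
        using c[of t] \<delta>'(2)[of t x] that by auto
      finally show ?thesis by simp
    qed
    then show ?case
      using \<delta> \<delta>'(1) by (intro exI[of _ "min \<delta> \<delta>'"] conjI exI[of _ "max K (c + 1)"]) auto
  qed
  then show ?thesis using that by blast
qed

text \<open>A mean value argument: on a small ball the derivative of each \<open>y t\<close> differs
  from the one at \<open>x0\<close> by at most \<open>\<eta>\<close> in operator norm, with a radius
  independent of \<open>t\<close>.\<close>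

lemma uniform_taylor:
  fixes y :: "'i::metric_space \<Rightarrow> 'a::euclidean_space \<Rightarrow> 'b::real_normed_vector"
  assumes y: "Ck_family 1 I J W U y" and I: "compact I" and U: "open U" "x0 \<in> U" and "\<eta> > 0"
  obtains \<delta> where "\<delta> > 0" "ball x0 \<delta> \<subseteq> U"
    "\<And>t x. t \<in> I \<Longrightarrow> x \<in> ball x0 \<delta> \<Longrightarrow>
      norm (y t x - y t x0 - frechet_derivative (y t) (at x0) (x - x0)) \<le> \<eta> * norm (x - x0)"
proof -
  let ?D = "\<lambda>b t x. frechet_derivative (y t) (at x) b"
  \<comment> \<open>The dimension is the loss in passing from the basis directions to the operator
    norm (\<open>norm_basis_comb_le\<close>).\<close>
  define \<eta>' where "\<eta>' = \<eta> / real DIM('a)"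
  have "\<eta>' > 0" using \<open>\<eta> > 0\<close> by (simp add: \<eta>'_def)
  have "\<exists>\<delta>>0. ball x0 \<delta> \<subseteq> U \<and> (\<forall>t\<in>I. \<forall>x\<in>ball x0 \<delta>. norm (?D b t x - ?D b t x0) \<le> \<eta>')" for b
  proof -
    have "continuous_on (I \<times> U) (\<lambda>(t, x). ?D b t x)"
      using y by (intro Ck_family_continuous[of 0] Ck_family_derivative) simp
    from joint_continuity_tube[OF this I U \<open>\<eta>' > 0\<close>] show ?thesis by metis
  qed
  then obtain d where d: "\<And>b. d b > 0" "\<And>b. ball x0 (d b) \<subseteq> U"
    "\<And>b t x. t \<in> I \<Longrightarrow> x \<in> ball x0 (d b) \<Longrightarrow> norm (?D b t x - ?D b t x0) \<le> \<eta>'"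
    by metis
  define \<delta> where "\<delta> = Min (d ` Basis)"
  have \<delta>: "\<delta> > 0" "\<And>b. b \<in> Basis \<Longrightarrow> \<delta> \<le> d b"
    using d(1) by (auto simp: \<delta>_def)
  obtain b0 :: 'a where "b0 \<in> Basis" by (meson nonempty_Basis all_not_in_conv)
  then have sub: "ball x0 \<delta> \<subseteq> U"
    using d(2)[of b0] \<delta>(2)[of b0] by (meson order_trans subset_ball)
  have "norm (y t x - y t x0 - frechet_derivative (y t) (at x0) (x - x0)) \<le> \<eta> * norm (x - x0)"
    if t: "t \<in> I" and x: "x \<in> ball x0 \<delta>" for t x
  proof -
    have der: "(y t has_derivative frechet_derivative (y t) (at z)) (at z)" if "z \<in> ball x0 \<delta>" for z
      using y that sub t by (intro Ck_family_has_derivative[of 0 I J W U y]) auto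
    have on: "onorm (frechet_derivative (y t) (at z) - frechet_derivative (y t) (at x0)) \<le> \<eta>"
      if z: "z \<in> ball x0 \<delta>" for z
    proof (rule onorm_le)
      fix v
      have x0: "x0 \<in> ball x0 \<delta>" using \<delta> by simp
      have "norm ((frechet_derivative (y t) (at z) - frechet_derivative (y t) (at x0)) v)
          = norm (basis_comb (\<lambda>b. ?D b t z - ?D b t x0) v)"
        using basis_comb_linear[OF has_derivative_linear[OF der[OF z]], of v]
          basis_comb_linear[OF has_derivative_linear[OF der[OF x0]], of v]
        by (simp add: basis_comb_diff_left)
      also have "\<dots> \<le> real DIM('a) * \<eta>' * norm v"
        using z \<delta>(2) by (intro norm_basis_comb_le d(3) t) force
      finally show "norm ((frechet_derivative (y t) (at z) - frechet_derivative (y t) (at x0)) v)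
          \<le> \<eta> * norm v" by (simp add: \<eta>'_def)
    qed
    have "norm (y t x - y t x0 - frechet_derivative (y t) (at x0) (x - x0)) \<le> norm (x - x0) * \<eta>"
    proof (rule differentiable_bound_linearization)
      fix s :: real assume s: "s \<in> {0..1}"
      have "norm (s *\<^sub>R (x - x0)) \<le> norm (x - x0)"
        using s mult_right_mono[of s 1 "norm (x - x0)"] by simp
      then show "x0 + s *\<^sub>R (x - x0) \<in> ball x0 \<delta>"
        using x by (auto simp: dist_norm norm_minus_commute)
    next
      show "(y t has_derivative frechet_derivative (y t) (at z)) (at z within ball x0 \<delta>)"
        if "z \<in> ball x0 \<delta>" for z
        using der[OF that] by (rule has_derivative_at_withinI)
    qed (use on \<delta> in auto)
    then show ?thesis by (simp add: mult.commute)
  qed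
  then show ?thesis using that \<delta>(1) sub by blast
qed

section \<open>Linear equations and the variational equation\<close>

lemma directional_quotients_tendsto:
  assumes f: "(f has_derivative f') (at x0)" and s: "\<And>n. s n > 0" "s \<longlonglongrightarrow> 0"
  shows "(\<lambda>n. (1 / s n) *\<^sub>R (f (x0 + s n *\<^sub>R v) - f x0)) \<longlonglongrightarrow> f' v"
proof (rule LIMSEQ_I)
  fix \<epsilon> :: real assume "\<epsilon> > 0"
  define \<eta> where "\<eta> = \<epsilon> / (norm v + 1)"
  have pos: "norm v + 1 > 0" by (simp add: add_nonneg_pos)
  have "\<eta> > 0" using \<open>\<epsilon> > 0\<close> pos by (simp add: \<eta>_def)
  then obtain \<delta> where \<delta>: "\<delta> > 0" "\<And>x. norm (x - x0) < \<delta> \<Longrightarrow>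
      norm (f x - f x0 - f' (x - x0)) \<le> \<eta> * norm (x - x0)"
    using f unfolding has_derivative_at_alt by blast
  have "(\<lambda>n. s n * norm v) \<longlonglongrightarrow> 0 * norm v"
    by (intro tendsto_mult s tendsto_const)
  then have "\<forall>\<^sub>F n in sequentially. s n * norm v < \<delta>"
    using \<delta>(1) by (intro order_tendstoD) auto
  then obtain N where N: "\<And>n. n \<ge> N \<Longrightarrow> s n * norm v < \<delta>"
    by (auto simp: eventually_sequentially)
  have "norm ((1 / s n) *\<^sub>R (f (x0 + s n *\<^sub>R v) - f x0) - f' v) < \<epsilon>" if "n \<ge> N" for n
  proof -
    have *: "norm (f (x0 + s n *\<^sub>R v) - f x0 - s n *\<^sub>R f' v) \<le> \<eta> * (s n * norm v)"
      using \<delta>(2)[of "x0 + s n *\<^sub>R v"] N[OF that] s(1)[of n]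
        linear_scale[OF has_derivative_linear[OF f]] by simp
    have "(1 / s n) *\<^sub>R (f (x0 + s n *\<^sub>R v) - f x0) - f' v
        = (1 / s n) *\<^sub>R (f (x0 + s n *\<^sub>R v) - f x0 - s n *\<^sub>R f' v)"
      using s(1)[of n] by (simp add: scaleR_diff_right)
    then have "norm ((1 / s n) *\<^sub>R (f (x0 + s n *\<^sub>R v) - f x0) - f' v)
        = norm (f (x0 + s n *\<^sub>R v) - f x0 - s n *\<^sub>R f' v) / s n"
      using s(1)[of n] by simp
    also have "\<dots> \<le> \<eta> * norm v"
      using * s(1)[of n] by (simp add: divide_le_eq mult_ac)
    also have "\<dots> < \<eta> * (norm v + 1)" using \<open>\<eta> > 0\<close> by simp
    also have "\<dots> = \<epsilon>" using pos by (simp add: \<eta>_def)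
    finally show ?thesis .
  qed
  then show "\<exists>N. \<forall>n\<ge>N. norm ((1 / s n) *\<^sub>R (f (x0 + s n *\<^sub>R v) - f x0) - f' v) < \<epsilon>"
    by blast
qed

text \<open>
  The solution of the variational equation is obtained as the limit of the difference quotients of \<open>y\<close>,
  which are uniformly Cauchy by Gronwall's inequality; no existence theorem for differential
  equations is needed.
\<close>

lemma variation_of_solutions:
  fixes y :: "real \<Rightarrow> 'a::euclidean_space \<Rightarrow> 'b::euclidean_space"
  assumes T: "0 \<le> T" and r: "0 < r"
    and m: "\<And>b. b \<in> Basis \<Longrightarrow> continuous_on {0..T} (m b)"
    and \<beta>: "\<And>t. t \<in> {0..T} \<Longrightarrow> linear (\<beta> t)"
    and y: "\<And>t x. t \<in> {0..T} \<Longrightarrow> x \<in> ball x0 r \<Longrightarrow>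
      ((\<lambda>t. y t x - y t x0) has_vector_derivative
        basis_comb (\<lambda>b. m b t) (y t x - y t x0) + e t x) (at t within {0..T})"
    and e: "\<And>\<eta>. \<eta> > 0 \<Longrightarrow>
      \<exists>\<delta>>0. \<forall>x\<in>ball x0 \<delta>. \<forall>t\<in>{0..T}. norm (e t x - \<beta> t (x - x0)) \<le> \<eta> * norm (x - x0)"
    and y0: "(y 0 has_derivative \<gamma>) (at x0)"
  shows "t \<in> {0..T} \<Longrightarrow> y t differentiable (at x0)"
    and "t \<in> {0..T} \<Longrightarrow> ((\<lambda>t. frechet_derivative (y t) (at x0) v) has_vector_derivative
      basis_comb (\<lambda>b. m b t) (frechet_derivative (y t) (at x0) v) + \<beta> t v) (at t within {0..T})"
proof -
  obtain K where K: "K \<ge> 0" "\<And>t z. t \<in> {0..T} \<Longrightarrow> norm (basis_comb (\<lambda>b. m b t) z) \<le> K * norm z"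
  proof -
    have "\<exists>c. \<forall>t\<in>{0..T}. norm (m b t) \<le> c" if "b \<in> Basis" for b
      using compact_imp_bounded[OF compact_continuous_image[OF m[OF that] compact_Icc]]
      by (auto simp: bounded_iff)
    then obtain c where c: "\<And>b t. b \<in> Basis \<Longrightarrow> t \<in> {0..T} \<Longrightarrow> norm (m b t) \<le> c b"
      by metis
    define C where "C = (\<Sum>b\<in>Basis. \<bar>c b\<bar>)"
    have "norm (m b t) \<le> C" if "b \<in> Basis" "t \<in> {0..T}" for b t
      using c[OF that] member_le_sum[of b Basis "\<lambda>b. \<bar>c b\<bar>"] that by (simp add: C_def)
    then have "norm (basis_comb (\<lambda>b. m b t) z) \<le> (real DIM('b) * C) * norm z"
      if "t \<in> {0..T}" for t z
      using that by (intro norm_basis_comb_le) auto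
    moreover have "real DIM('b) * C \<ge> 0" by (simp add: C_def sum_nonneg)
    ultimately show ?thesis using that by blast
  qed
  define E where "E = exp (K * T)"
  \<comment> \<open>Gronwall for a perturbed linear equation. It is used twice: on differences of
    two difference quotients, for the Cauchy property, and on the first-order remainder, for
    differentiability.\<close>
  have stab: "norm (w t) \<le> (norm (w 0) + \<epsilon> * T) * E"
    if w: "\<And>t. t \<in> {0..T} \<Longrightarrow>
        (w has_vector_derivative basis_comb (\<lambda>b. m b t) (w t) + d t) (at t within {0..T})"
      and d: "\<And>t. t \<in> {0..T} \<Longrightarrow> norm (d t) \<le> \<epsilon>" and t: "t \<in> {0..T}" for w d \<epsilon> t
    unfolding E_def
  proof (rule gronwall_norm_Icc[OF K(1) _ w _ t])
    show "\<epsilon> \<ge> 0" using d[OF t] norm_ge_zero order_trans by blast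
    show "norm (basis_comb (\<lambda>b. m b t) (w t) + d t) \<le> K * norm (w t) + \<epsilon>" if "t \<in> {0..T}" for t
      using K(2) d that by (intro norm_triangle_mono) auto
  qed
  have E: "E > 0" by (simp add: E_def)
  have "\<exists>z. z 0 = \<gamma> v \<and> (\<forall>t\<in>{0..T}. (z has_vector_derivative
      basis_comb (\<lambda>b. m b t) (z t) + \<beta> t v) (at t within {0..T}))" for v
  proof -
    \<comment> \<open>Scaled so that all points \<open>x0 + s n *\<^sub>R v\<close>, from
      \<open>n = 0\<close> on, lie in the ball of radius \<open>r\<close>, whatever the length of
      \<open>v\<close>.\<close>
    define s where "s n = r / (norm v + 1) / real (Suc n)" for n
    have s: "s n > 0" for n using r by (simp add: s_def add_nonneg_pos)
    have s0: "s \<longlonglongrightarrow> 0"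
      unfolding s_def by (rule LIMSEQ_Suc[OF lim_const_over_n])
    have in_ball: "x0 + s n *\<^sub>R v \<in> ball x0 r" for n
    proof -
      have "r / (norm v + 1) / real (Suc n) \<le> r / (norm v + 1) / 1"
        using r by (intro divide_left_mono) auto
      then have "s n * norm v \<le> r / (norm v + 1) * norm v"
        by (intro mult_right_mono) (auto simp: s_def)
      also have "\<dots> = r * (norm v / (norm v + 1))" by simp
      also have "\<dots> < r * 1"
        using r by (intro mult_strict_left_mono) (auto simp: divide_less_eq_1 add_nonneg_pos)
      finally show ?thesis using s[of n] by (simp add: dist_norm)
    qed
    define q where "q n t = (1 / s n) *\<^sub>R (y t (x0 + s n *\<^sub>R v) - y t x0)" for n t
    define d where "d n t = (1 / s n) *\<^sub>R e t (x0 + s n *\<^sub>R v)" for n t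
    have q': "(q n has_vector_derivative basis_comb (\<lambda>b. m b t) (q n t) + d n t) (at t within {0..T})"
      if "t \<in> {0..T}" for n t
      using bounded_linear.has_vector_derivative[OF bounded_linear_scaleR_right y[OF that in_ball], of "1 / s n" n]
      by (simp add: q_def[abs_def] d_def basis_comb_scale scaleR_add_right)
    have d: "\<forall>\<^sub>F n in sequentially. \<forall>t\<in>{0..T}. norm (d n t - \<beta> t v) \<le> \<eta>" if "\<eta> > 0" for \<eta>
    proof -
      define \<eta>' where "\<eta>' = \<eta> / (norm v + 1)"
      have "\<eta>' > 0" using that by (simp add: \<eta>'_def add_nonneg_pos)
      from e[OF this] obtain \<delta> where \<delta>: "\<delta> > 0"
        "\<forall>x\<in>ball x0 \<delta>. \<forall>t\<in>{0..T}. norm (e t x - \<beta> t (x - x0)) \<le> \<eta>' * norm (x - x0)" by blast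
      have "(\<lambda>n. s n * norm v) \<longlonglongrightarrow> 0 * norm v"
        by (intro tendsto_mult s0 tendsto_const)
      then have "\<forall>\<^sub>F n in sequentially. s n * norm v < \<delta>"
        using \<delta>(1) by (intro order_tendstoD) auto
      then show ?thesis
      proof eventually_elim
        case (elim n)
        show ?case
        proof
          fix t assume t: "t \<in> {0..T}"
          have "x0 + s n *\<^sub>R v \<in> ball x0 \<delta>" using elim s[of n] by (simp add: dist_norm)
          then have *: "norm (e t (x0 + s n *\<^sub>R v) - s n *\<^sub>R \<beta> t v) \<le> \<eta>' * (s n * norm v)"
            using \<delta>(2) t s[of n] linear_scale[OF \<beta>[OF t]] by fastforce
          have "d n t - \<beta> t v = (1 / s n) *\<^sub>R (e t (x0 + s n *\<^sub>R v) - s n *\<^sub>R \<beta> t v)"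
            using s[of n] by (simp add: d_def scaleR_diff_right)
          then have "norm (d n t - \<beta> t v) = norm (e t (x0 + s n *\<^sub>R v) - s n *\<^sub>R \<beta> t v) / s n"
            using s[of n] by simp
          also have "\<dots> \<le> \<eta>' * norm v"
            using * s[of n] by (simp add: divide_le_eq mult_ac)
          also have "\<dots> \<le> \<eta>"
            using that by (simp add: \<eta>'_def divide_le_eq add_nonneg_pos mult_left_mono)
          finally show "norm (d n t - \<beta> t v) \<le> \<eta>" .
        qed
      qed
    qed
    have q0: "(\<lambda>n. q n 0) \<longlonglongrightarrow> \<gamma> v"
      unfolding q_def by (rule directional_quotients_tendsto[OF y0 s s0])
    have "uniformly_Cauchy_on {0..T} q"
      unfolding uniformly_Cauchy_on_def
    proof (intro allI impI)
      fix \<epsilon> :: real assume "\<epsilon> > 0"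
      \<comment> \<open>The estimate below ends in \<open>(1 + 2 * T) * E * \<eta>\<close>; the
        factor 3 makes this strictly less than \<open>\<epsilon>\<close>.\<close>
      define \<eta> where "\<eta> = \<epsilon> / (3 * (1 + T) * E)"
      have "\<eta> > 0" using \<open>\<epsilon> > 0\<close> T E by (simp add: \<eta>_def)
      have "Cauchy (\<lambda>n. q n 0)" using q0 by (rule LIMSEQ_imp_Cauchy)
      then obtain N1 where N1: "\<And>k l. k \<ge> N1 \<Longrightarrow> l \<ge> N1 \<Longrightarrow> norm (q k 0 - q l 0) < \<eta>"
        using \<open>\<eta> > 0\<close> unfolding Cauchy_iff by blast
      obtain N2 where N2: "\<And>n t. n \<ge> N2 \<Longrightarrow> t \<in> {0..T} \<Longrightarrow> norm (d n t - \<beta> t v) \<le> \<eta>"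
        using d[OF \<open>\<eta> > 0\<close>] unfolding eventually_sequentially by blast
      have "dist (q k t) (q l t) < \<epsilon>" if "k \<ge> max N1 N2" "l \<ge> max N1 N2" "t \<in> {0..T}" for k l t
      proof -
        have "norm (q k t - q l t) \<le> (norm (q k 0 - q l 0) + (2 * \<eta>) * T) * E"
        proof (rule stab[where w = "\<lambda>t. q k t - q l t" and d = "\<lambda>t. d k t - d l t"])
          fix t assume t: "t \<in> {0..T}"
          show "((\<lambda>t. q k t - q l t) has_vector_derivative
              basis_comb (\<lambda>b. m b t) (q k t - q l t) + (d k t - d l t)) (at t within {0..T})"
            using has_vector_derivative_diff[OF q'[OF t] q'[OF t]]
            by (simp add: basis_comb_diff algebra_simps)
          show "norm (d k t - d l t) \<le> 2 * \<eta>"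
            using norm_triangle_mono[OF N2[of k t] N2[of l t, folded norm_minus_commute[of "\<beta> t v"]]] that t
            by simp
        qed (rule that)
        also have "\<dots> \<le> (\<eta> + (2 * \<eta>) * T) * E"
          using N1[of k l] that E by (intro mult_right_mono add_right_mono) auto
        also have "\<dots> < \<epsilon>"
        proof -
          have "\<eta> + (2 * \<eta>) * T < 3 * (1 + T) * \<eta>"
            using \<open>\<eta> > 0\<close> mult_nonneg_nonneg[OF T, of \<eta>] by (simp add: algebra_simps)
          then have "(\<eta> + (2 * \<eta>) * T) * E < (3 * (1 + T) * \<eta>) * E"
            using E by simp
          also have "\<dots> = \<epsilon>" using E T by (simp add: \<eta>_def)
          finally show ?thesis .
        qed
        finally show ?thesis by (simp add: dist_norm)
      qed
      then show "\<exists>M. \<forall>x\<in>{0..T}. \<forall>m\<ge>M. \<forall>n\<ge>M. dist (q m x) (q n x) < \<epsilon>"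
        by blast
    qed
    then obtain z where z: "uniform_limit {0..T} q z sequentially"
      using Cauchy_uniformly_convergent uniformly_convergent_on_def by blast
    have zlim: "(\<lambda>n. q n t) \<longlonglongrightarrow> z t" if "t \<in> {0..T}" for t
      using tendsto_uniform_limitI[OF z that] .
    \<comment> \<open>The equation expresses the time derivatives of the quotients through the
      quotients themselves, so both converge uniformly and the limit solves the limiting
      equation.\<close>
    have "\<exists>g. \<forall>t\<in>{0..T}. (\<lambda>n. q n t) \<longlonglongrightarrow> g t \<and>
        (g has_derivative (\<lambda>h. h *\<^sub>R (basis_comb (\<lambda>b. m b t) (z t) + \<beta> t v))) (at t within {0..T})"
    proof (rule has_derivative_sequence)
      show "(q n has_derivative (\<lambda>h. h *\<^sub>R (basis_comb (\<lambda>b. m b t) (q n t) + d n t))) (at t within {0..T})"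
        if "t \<in> {0..T}" for n t
        using q'[OF that] by (simp add: has_vector_derivative_def)
      show "(\<lambda>n. q n 0) \<longlonglongrightarrow> \<gamma> v" by (rule q0)
      fix \<epsilon> :: real assume "\<epsilon> > 0"
      define \<eta> where "\<eta> = \<epsilon> / (K + 1)"
      have "\<eta> > 0" using \<open>\<epsilon> > 0\<close> K(1) by (simp add: \<eta>_def add_nonneg_pos)
      have "\<forall>\<^sub>F n in sequentially. \<forall>t\<in>{0..T}. dist (q n t) (z t) < \<eta>"
        using uniform_limitD[OF z \<open>\<eta> > 0\<close>] .
      then show "\<forall>\<^sub>F n in sequentially. \<forall>t\<in>{0..T}. \<forall>h.
          norm (h *\<^sub>R (basis_comb (\<lambda>b. m b t) (q n t) + d n t)
            - h *\<^sub>R (basis_comb (\<lambda>b. m b t) (z t) + \<beta> t v)) \<le> \<epsilon> * norm h"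
        using d[OF \<open>\<eta> > 0\<close>]
      proof eventually_elim
        case (elim n)
        show ?case
        proof (intro ballI allI)
          fix t h assume t: "t \<in> {0..T}"
          let ?D = "basis_comb (\<lambda>b. m b t) (q n t - z t) + (d n t - \<beta> t v)"
          have "norm ?D \<le> K * norm (q n t - z t) + \<eta>"
            using K(2)[OF t] elim(2) t by (intro norm_triangle_mono) auto
          also have "\<dots> \<le> K * \<eta> + \<eta>"
            using elim(1) t K(1) by (auto intro!: mult_left_mono simp: dist_norm less_imp_le)
          also have "\<dots> = (K + 1) * \<eta>" by (simp add: algebra_simps)
          also have "\<dots> = \<epsilon>" using K(1) by (simp add: \<eta>_def)
          finally have "norm (h *\<^sub>R ?D) \<le> norm h * \<epsilon>" by (simp add: mult_left_mono)
          then show "norm (h *\<^sub>R (basis_comb (\<lambda>b. m b t) (q n t) + d n t)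
            - h *\<^sub>R (basis_comb (\<lambda>b. m b t) (z t) + \<beta> t v)) \<le> \<epsilon> * norm h"
            by (simp add: basis_comb_diff algebra_simps)
        qed
      qed
    qed (use T in auto)
    then obtain g where g: "\<And>t. t \<in> {0..T} \<Longrightarrow> (\<lambda>n. q n t) \<longlonglongrightarrow> g t"
      "\<And>t. t \<in> {0..T} \<Longrightarrow>
        (g has_derivative (\<lambda>h. h *\<^sub>R (basis_comb (\<lambda>b. m b t) (z t) + \<beta> t v))) (at t within {0..T})"
      by blast
    have gz: "g t = z t" if "t \<in> {0..T}" for t
      using LIMSEQ_unique g(1) zlim that by blast
    have "g 0 = \<gamma> v"
      using LIMSEQ_unique g(1)[of 0] q0 T by auto
    then show ?thesis
      using g(2) gz by (intro exI[of _ g]) (auto simp: has_vector_derivative_def)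
  qed
  then obtain z where z0: "\<And>v. z v 0 = \<gamma> v"
    and z: "\<And>v t. t \<in> {0..T} \<Longrightarrow> (z v has_vector_derivative
      basis_comb (\<lambda>b. m b t) (z v t) + \<beta> t v) (at t within {0..T})" by metis
  \<comment> \<open>The solutions \<open>z v\<close> are chosen separately for each
    \<open>v\<close>, so their linearity in \<open>v\<close> is not at hand. Combining those for the
    basis directions is linear in \<open>v\<close> by construction, and it solves the same equation
    because \<open>\<beta> t\<close> is linear.\<close>
  have comb: "((\<lambda>t. basis_comb (\<lambda>b. z b t) v) has_vector_derivative
      basis_comb (\<lambda>b. m b t) (basis_comb (\<lambda>b. z b t) v) + \<beta> t v) (at t within {0..T})"
    if t: "t \<in> {0..T}" for t v
  proof -
    have "((\<lambda>t. basis_comb (\<lambda>b. z b t) v) has_vector_derivative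
      basis_comb (\<lambda>i. basis_comb (\<lambda>b. m b t) (z i t) + \<beta> t i) v) (at t within {0..T})"
      unfolding basis_comb_def[of _ v]
      by (intro has_vector_derivative_sum bounded_linear.has_vector_derivative[OF bounded_linear_scaleR_right] z t)
    moreover have "basis_comb (\<lambda>i. basis_comb (\<lambda>b. m b t) (z i t) + \<beta> t i) v
        = basis_comb (\<lambda>b. m b t) (basis_comb (\<lambda>b. z b t) v) + \<beta> t v"
      using basis_comb_linear[OF \<beta>[OF t], of v]
      by (simp add: basis_comb_def[of _ v] scaleR_add_right sum.distrib
          linear_sum[OF linear_basis_comb] basis_comb_scale)
    ultimately show ?thesis by simp
  qed
  \<comment> \<open>Directional limits alone do not give differentiability; \<open>stab\<close>
    bounds the remainder uniformly over all directions.\<close>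
  have frechet: "(y t has_derivative basis_comb (\<lambda>b. z b t)) (at x0)" if t: "t \<in> {0..T}" for t
    unfolding has_derivative_at_alt
  proof (intro conjI allI impI)
    show "bounded_linear (basis_comb (\<lambda>b. z b t))"
      using linear_basis_comb by (simp add: linear_linear)
    fix \<epsilon> :: real assume "\<epsilon> > 0"
    define \<eta> where "\<eta> = \<epsilon> / ((1 + T) * E)"
    have "\<eta> > 0" using \<open>\<epsilon> > 0\<close> T E by (simp add: \<eta>_def)
    obtain \<delta>1 where \<delta>1: "\<delta>1 > 0" "\<And>x. norm (x - x0) < \<delta>1 \<Longrightarrow>
        norm (y 0 x - y 0 x0 - \<gamma> (x - x0)) \<le> \<eta> * norm (x - x0)"
      using y0 \<open>\<eta> > 0\<close> unfolding has_derivative_at_alt by blast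
    obtain \<delta>2 where \<delta>2: "\<delta>2 > 0" "\<And>x t. x \<in> ball x0 \<delta>2 \<Longrightarrow> t \<in> {0..T} \<Longrightarrow>
        norm (e t x - \<beta> t (x - x0)) \<le> \<eta> * norm (x - x0)"
      using e[OF \<open>\<eta> > 0\<close>] by blast
    have "norm (y t x - y t x0 - basis_comb (\<lambda>b. z b t) (x - x0)) \<le> \<epsilon> * norm (x - x0)"
      if x: "norm (x - x0) < min r (min \<delta>1 \<delta>2)" for x
    proof -
      have xb: "x \<in> ball x0 r" "x \<in> ball x0 \<delta>2"
        using x by (auto simp: dist_norm norm_minus_commute)
      have zero: "basis_comb (\<lambda>b. z b 0) v = \<gamma> v" for v
        using basis_comb_linear[OF has_derivative_linear[OF y0]] by (simp add: z0)
      have "norm (y t x - y t x0 - basis_comb (\<lambda>b. z b t) (x - x0))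
        \<le> (norm (y 0 x - y 0 x0 - basis_comb (\<lambda>b. z b 0) (x - x0)) + (\<eta> * norm (x - x0)) * T) * E"
      proof (rule stab[where d = "\<lambda>t. e t x - \<beta> t (x - x0)"])
        fix t assume t: "t \<in> {0..T}"
        show "((\<lambda>t. y t x - y t x0 - basis_comb (\<lambda>b. z b t) (x - x0)) has_vector_derivative
            basis_comb (\<lambda>b. m b t) (y t x - y t x0 - basis_comb (\<lambda>b. z b t) (x - x0))
             + (e t x - \<beta> t (x - x0))) (at t within {0..T})"
          using has_vector_derivative_diff[OF y[OF t xb(1)] comb[OF t, of "x - x0"]]
          by (simp add: basis_comb_diff basis_comb_add algebra_simps)
        show "norm (e t x - \<beta> t (x - x0)) \<le> \<eta> * norm (x - x0)" using \<delta>2(2)[OF xb(2) t] .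
      qed (rule t)
      also have "\<dots> \<le> (\<eta> * norm (x - x0) + (\<eta> * norm (x - x0)) * T) * E"
        using \<delta>1(2)[of x] x E by (intro mult_right_mono add_right_mono) (auto simp: zero)
      also have "\<dots> = (1 + T) * E * \<eta> * norm (x - x0)" by (simp add: algebra_simps)
      also have "(1 + T) * E * \<eta> = \<epsilon>" using T E by (simp add: \<eta>_def)
      finally show ?thesis .
    qed
    then show "\<exists>d>0. \<forall>x. norm (x - x0) < d \<longrightarrow>
        norm (y t x - y t x0 - basis_comb (\<lambda>b. z b t) (x - x0)) \<le> \<epsilon> * norm (x - x0)"
      using r \<delta>1(1) \<delta>2(1) by (intro exI[of _ "min r (min \<delta>1 \<delta>2)"]) auto
  qed
  show "y t differentiable (at x0)" if "t \<in> {0..T}"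
    using frechet[OF that] by (auto simp: differentiable_def)
  have fd: "frechet_derivative (y t) (at x0) = basis_comb (\<lambda>b. z b t)" if "t \<in> {0..T}" for t
    using frechet_derivative_at[OF frechet[OF that]] by simp
  show "((\<lambda>t. frechet_derivative (y t) (at x0) v) has_vector_derivative
      basis_comb (\<lambda>b. m b t) (frechet_derivative (y t) (at x0) v) + \<beta> t v) (at t within {0..T})"
    if "t \<in> {0..T}"
    using has_vector_derivative_transform[OF that _ comb[OF that, of v]] fd that by simp
qed

section \<open>One-sided time derivatives and joint continuity on the half-line\<close>

text \<open>Near \<open>t\<close> the half-line and \<open>{0..t + 1}\<close> coincide; the interval
  \<open>{0..t}\<close> would only see a left derivative.\<close>

lemma has_vector_derivative_within_atLeast:
  assumes "\<And>T. t \<le> T \<Longrightarrow> (f has_vector_derivative f') (at t within {0..T})"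
  shows "(f has_vector_derivative f') (at t within {0::real..})"
proof -
  have "at t within {0..} = at t within {0..t + 1}"
    by (rule at_within_nhd[of t "{..<t + 1}"]) auto
  then show ?thesis using assms[of "t + 1"] by simp
qed

lemma has_vector_derivative_atLeast_Icc:
  "(f has_vector_derivative f') (at t within {0::real..}) \<Longrightarrow>
   (f has_vector_derivative f') (at t within {0..T})"
  by (erule has_vector_derivative_within_subset) auto

lemma has_vector_derivative_time_shift:
  fixes f :: "real \<Rightarrow> 'a::real_normed_vector"
  assumes "(f has_vector_derivative f') (at (s + t) within {0..})" "0 \<le> s"
  shows "((\<lambda>t. f (s + t)) has_vector_derivative f') (at t within {0..})"
proof -
  have "(f has_vector_derivative f') (at (s + t) within (+) s ` {0..})"
    using assms by (auto intro: has_vector_derivative_within_subset)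
  moreover have "((\<lambda>t. s + t) has_vector_derivative 1) (at t within {0..})"
    by (auto intro!: derivative_eq_intros)
  ultimately show ?thesis
    using vector_diff_chain_within[of "\<lambda>t. s + t" 1 t "{0..}" f] by (simp add: o_def)
qed

lemma continuous_on_solution:
  assumes "\<And>t. t \<in> S \<Longrightarrow> (f has_vector_derivative f' t) (at t within S)"
  shows "continuous_on S f"
  unfolding continuous_on_eq_continuous_within
  using assms has_vector_derivative_continuous by blast

lemma Ck_family_parameter_only:
  assumes "continuous_on I p"
  shows "Ck_family k I {} W U (\<lambda>t x. p t)"
proof -
  have base: "Ck_family 0 I {} W U (\<lambda>t x. p t)"
    unfolding Ck_family.simps(1) case_prod_unfold
    by (intro conjI continuous_on_compose2[OF assms] continuous_intros) auto
  show ?thesis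
  proof (cases k)
    case (Suc j)
    then show ?thesis using base Ck_family_zero[of j I "{}" W U]
      by (simp add: Ck_family_Suc del: Ck_family.simps(1))
  qed (use base in simp)
qed

lemma Ck_on_id: "Ck_on k U (\<lambda>x. x)"
proof (cases k)
  case (Suc j)
  then show ?thesis by (simp add: Ck_on_const)
qed simp

lemma uniform_lipschitz:
  fixes y :: "'i::metric_space \<Rightarrow> 'a::euclidean_space \<Rightarrow> 'b::real_normed_vector"
  assumes y: "Ck_family 1 I J W U y" and I: "compact I" and U: "open U" "x0 \<in> U"
  obtains \<delta> L where "\<delta> > 0" "ball x0 \<delta> \<subseteq> U" "L \<ge> 0"
    "\<And>t x. t \<in> I \<Longrightarrow> x \<in> ball x0 \<delta> \<Longrightarrow> norm (y t x - y t x0) \<le> L * norm (x - x0)"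
proof -
  obtain \<delta> where \<delta>: "\<delta> > 0" "ball x0 \<delta> \<subseteq> U"
    "\<And>t x. t \<in> I \<Longrightarrow> x \<in> ball x0 \<delta> \<Longrightarrow>
      norm (y t x - y t x0 - frechet_derivative (y t) (at x0) (x - x0)) \<le> 1 * norm (x - x0)"
    by (rule uniform_taylor[OF y I U, of 1]) auto
  have "continuous_on (I \<times> U) (\<lambda>(t, x). frechet_derivative (y t) (at x) b)" for b
    using y by (intro Ck_family_continuous[of 0] Ck_family_derivative) simp
  then obtain \<delta>' K where K: "K \<ge> 0" "\<delta>' > 0"
    "\<And>b t x. b \<in> Basis \<Longrightarrow> t \<in> I \<Longrightarrow> x \<in> ball x0 \<delta>' \<Longrightarrow>
      norm (frechet_derivative (y t) (at x) b) \<le> K"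
    by (rule joint_continuity_bound[OF finite_Basis _ I U, where y = "\<lambda>b t x. frechet_derivative (y t) (at x) b"])
      auto
  define L where "L = 1 + real DIM('a) * K"
  have "norm (y t x - y t x0) \<le> L * norm (x - x0)" if t: "t \<in> I" and x: "x \<in> ball x0 \<delta>" for t x
  proof -
    have diff: "y t differentiable (at x0)"
      using Ck_family_has_derivative[of 0 I J W U y t x0] y t U(2) by (auto simp: differentiable_def)
    have "norm (y t x - y t x0) \<le> norm (y t x - y t x0 - frechet_derivative (y t) (at x0) (x - x0))
        + norm (frechet_derivative (y t) (at x0) (x - x0))"
      using norm_triangle_ineq[of "y t x - y t x0 - frechet_derivative (y t) (at x0) (x - x0)"
          "frechet_derivative (y t) (at x0) (x - x0)"] by simp
    also have "\<dots> \<le> 1 * norm (x - x0) + real DIM('a) * K * norm (x - x0)"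
    proof (rule add_mono[OF \<delta>(3)[OF t x]])
      show "norm (frechet_derivative (y t) (at x0) (x - x0)) \<le> real DIM('a) * K * norm (x - x0)"
        unfolding frechet_derivative_basis_comb[OF diff, of "x - x0"]
        using K(2) by (intro norm_basis_comb_le K(3) t) auto
    qed
    finally show ?thesis by (simp add: L_def algebra_simps)
  qed
  moreover have "L \<ge> 0" using K(1) by (simp add: L_def)
  ultimately show ?thesis using that \<delta> by blast
qed

text \<open>Uniform closeness of neighbouring curves over compact time intervals reduces joint
  continuity to continuity in time of the single curve at \<open>x0\<close>.\<close>

lemma joint_continuousI:
  fixes y :: "real \<Rightarrow> 'a::metric_space \<Rightarrow> 'b::real_normed_vector"
  assumes cont: "\<And>x. x \<in> U \<Longrightarrow> continuous_on {0..} (\<lambda>t. y t x)"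
    and tube: "\<And>x0 T \<eta>. x0 \<in> U \<Longrightarrow> 0 \<le> T \<Longrightarrow> 0 < \<eta> \<Longrightarrow>
      \<exists>\<delta>>0. \<forall>x\<in>ball x0 \<delta> \<inter> U. \<forall>t\<in>{0..T}. norm (y t x - y t x0) \<le> \<eta>"
  shows "continuous_on ({0..} \<times> U) (\<lambda>(t, x). y t x)"
  unfolding continuous_on_iff
proof (intro ballI allI impI)
  fix p :: "real \<times> 'a" and \<epsilon> :: real assume p: "p \<in> {0..} \<times> U" and "\<epsilon> > 0"
  obtain t0 x0 where [simp]: "p = (t0, x0)" by (cases p)
  have t0: "t0 \<ge> 0" "x0 \<in> U" using p by auto
  obtain \<delta>1 where \<delta>1: "\<delta>1 > 0"
    "\<And>x t. x \<in> ball x0 \<delta>1 \<Longrightarrow> x \<in> U \<Longrightarrow> t \<in> {0..t0 + 1} \<Longrightarrow> norm (y t x - y t x0) \<le> \<epsilon> / 3"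
    using tube[of x0 "t0 + 1" "\<epsilon> / 3"] t0 \<open>\<epsilon> > 0\<close> by (auto simp: Ball_def)
  obtain \<delta>2 where \<delta>2: "\<delta>2 > 0"
    "\<And>t. t \<ge> 0 \<Longrightarrow> dist t t0 < \<delta>2 \<Longrightarrow> dist (y t x0) (y t0 x0) < \<epsilon> / 3"
    using cont[OF t0(2)] t0(1) \<open>\<epsilon> > 0\<close> unfolding continuous_on_iff
    by (metis atLeast_iff divide_pos_pos zero_less_numeral)
  have "dist (y t x) (y t0 x0) < \<epsilon>"
    if "t \<ge> 0" "x \<in> U" "dist (t, x) (t0, x0) < min 1 (min \<delta>1 \<delta>2)" for t x
  proof -
    have d: "dist t t0 < min 1 (min \<delta>1 \<delta>2)" "dist x x0 < min 1 (min \<delta>1 \<delta>2)"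
      using that(3) dist_fst_le[of "(t, x)" "(t0, x0)"] dist_snd_le[of "(t, x)" "(t0, x0)"] by auto
    have "dist (y t x) (y t x0) \<le> \<epsilon> / 3"
      unfolding dist_norm using d that by (intro \<delta>1(2)) (auto simp: dist_real_def dist_commute)
    moreover have "dist (y t x0) (y t0 x0) < \<epsilon> / 3" using d that by (intro \<delta>2(2)) auto
    ultimately show ?thesis using dist_triangle[of "y t x" "y t0 x0" "y t x0"] \<open>\<epsilon> > 0\<close> by linarith
  qed
  then show "\<exists>d>0. \<forall>q\<in>{0..} \<times> U. dist q p < d \<longrightarrow>
      dist (case q of (t, x) \<Rightarrow> y t x) (case p of (t, x) \<Rightarrow> y t x) < \<epsilon>"
    using \<delta>1(1) \<delta>2(1) by (intro exI[of _ "min 1 (min \<delta>1 \<delta>2)"]) auto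
qed

section \<open>Regularity of linear equations in a parameter\<close>

text \<open>The difference to the solution at \<open>x0\<close> solves an equation with the
  coefficients at \<open>x\<close>. All remaining terms form an inhomogeneity \<open>d\<close> that
  contains only the fixed solution at \<open>x0\<close> and vanishes for \<open>x = x0\<close>. The
  tube lemma makes \<open>d\<close> small uniformly in time, and Gronwall concludes.\<close>

lemma linear_ode_continuous:
  fixes y :: "real \<Rightarrow> 'a::euclidean_space \<Rightarrow> 'b::euclidean_space"
  assumes U: "open U"
    and a: "\<And>b. b \<in> Basis \<Longrightarrow> continuous_on ({0..} \<times> U) (\<lambda>(t, x). a b t x)"
    and c: "continuous_on ({0..} \<times> U) (\<lambda>(t, x). c t x)"
    and y0: "continuous_on U (y 0)"
    and y: "\<And>t x. 0 \<le> t \<Longrightarrow> x \<in> U \<Longrightarrow> ((\<lambda>t. y t x) has_vector_derivative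
      basis_comb (\<lambda>b. a b t x) (y t x) + c t x) (at t within {0..})"
  shows "continuous_on ({0..} \<times> U) (\<lambda>(t, x). y t x)"
proof (rule joint_continuousI)
  show cont: "continuous_on {0..} (\<lambda>t. y t x)" if "x \<in> U" for x
    using y that by (intro continuous_on_solution) auto
  fix x0 and T \<eta> :: real assume x0: "x0 \<in> U" and T: "0 \<le> T" and "0 < \<eta>"
  have I: "{0..T} \<times> U \<subseteq> {0..} \<times> U" by auto
  obtain \<delta>1 K where \<delta>1: "\<delta>1 > 0" "ball x0 \<delta>1 \<subseteq> U" "K \<ge> 0"
    "\<And>b t x. b \<in> Basis \<Longrightarrow> t \<in> {0..T} \<Longrightarrow> x \<in> ball x0 \<delta>1 \<Longrightarrow> norm (a b t x) \<le> K"
    by (rule joint_continuity_bound[OF finite_Basis continuous_on_subset[OF a I] compact_Icc U x0]) auto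
  define E where "E = exp (real DIM('b) * K * T)"
  have E: "E > 0" by (simp add: E_def)
  define \<eta>' where "\<eta>' = \<eta> / ((1 + T) * E)"
  have "\<eta>' > 0" using \<open>\<eta> > 0\<close> T E by (simp add: \<eta>'_def)
  define d where "d t x = basis_comb (\<lambda>b. a b t x - a b t x0) (y t x0) + (c t x - c t x0)" for t x
  have at_x0: "continuous_on ({0..T} \<times> U) (\<lambda>z. f (fst z) x0)"
    if "continuous_on ({0..} \<times> U) (\<lambda>(t, x). f t x)" for f :: "real \<Rightarrow> 'a \<Rightarrow> 'b"
    using continuous_on_compose2[OF that, of "{0..T} \<times> U" "\<lambda>z. (fst z, x0)"] x0
    by (simp add: image_subset_iff continuous_on_Pair continuous_on_fst)
  have yx0: "continuous_on ({0..T} \<times> U) (\<lambda>z. y (fst z) x0)"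
    by (rule continuous_on_compose2[OF cont[OF x0]]) (auto intro: continuous_on_fst continuous_on_id)
  have "continuous_on ({0..T} \<times> U) (\<lambda>(t, x). d t x)"
    unfolding d_def case_prod_unfold
    by (intro continuous_on_add continuous_on_basis_comb continuous_on_diff yx0 at_x0 a c
        continuous_on_subset[OF a[unfolded case_prod_unfold] I]
        continuous_on_subset[OF c[unfolded case_prod_unfold] I])
  then obtain \<delta>2 where \<delta>2: "\<delta>2 > 0"
    "\<And>t x. t \<in> {0..T} \<Longrightarrow> x \<in> ball x0 \<delta>2 \<Longrightarrow> norm (d t x - d t x0) \<le> \<eta>'"
    by (rule joint_continuity_tube[OF _ compact_Icc U x0 \<open>\<eta>' > 0\<close>]) auto
  have d0: "d t x0 = 0" for t by (simp add: d_def basis_comb_def)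
  obtain \<delta>3 where \<delta>3: "\<delta>3 > 0" "\<And>x. x \<in> U \<Longrightarrow> dist x x0 < \<delta>3 \<Longrightarrow> dist (y 0 x) (y 0 x0) < \<eta>'"
    using y0 x0 \<open>\<eta>' > 0\<close> unfolding continuous_on_iff by blast
  have "norm (y t x - y t x0) \<le> \<eta>"
    if x: "x \<in> ball x0 (min \<delta>1 (min \<delta>2 \<delta>3)) \<inter> U" and t: "t \<in> {0..T}" for x t
  proof -
    have "norm (y t x - y t x0) \<le> (norm (y 0 x - y 0 x0) + \<eta>' * T) * exp (real DIM('b) * K * T)"
    proof (rule gronwall_norm_Icc[OF _ _ _ _ t])
      fix t assume t: "t \<in> {0..T}"
      have "((\<lambda>t. y t x - y t x0) has_vector_derivative
        (basis_comb (\<lambda>b. a b t x) (y t x) + c t x) - (basis_comb (\<lambda>b. a b t x0) (y t x0) + c t x0))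
        (at t within {0..T})"
        using t x x0
        by (intro has_vector_derivative_diff has_vector_derivative_atLeast_Icc y) auto
      then show "((\<lambda>t. y t x - y t x0) has_vector_derivative
        basis_comb (\<lambda>b. a b t x) (y t x - y t x0) + d t x) (at t within {0..T})"
        by (simp add: d_def basis_comb_diff basis_comb_diff_left algebra_simps)
      show "norm (basis_comb (\<lambda>b. a b t x) (y t x - y t x0) + d t x)
          \<le> real DIM('b) * K * norm (y t x - y t x0) + \<eta>'"
        using \<delta>2(2)[of t x] d0 t x
        by (intro norm_triangle_mono norm_basis_comb_le \<delta>1(4)) auto
    qed (use \<delta>1(3) \<open>\<eta>' > 0\<close> in auto)
    also have "\<dots> \<le> (\<eta>' + \<eta>' * T) * E"
      unfolding E_def using \<delta>3(2)[of x] x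
      by (intro mult_right_mono add_right_mono) (auto simp: dist_norm norm_minus_commute)
    also have "\<dots> = (1 + T) * E * \<eta>'" by (simp add: algebra_simps)
    also have "\<dots> = \<eta>" using E T by (simp add: \<eta>'_def)
    finally show ?thesis .
  qed
  then show "\<exists>\<delta>>0. \<forall>x\<in>ball x0 \<delta> \<inter> U. \<forall>t\<in>{0..T}. norm (y t x - y t x0) \<le> \<eta>"
    using \<delta>1(1) \<delta>2(1) \<delta>3(1) by (intro exI[of _ "min \<delta>1 (min \<delta>2 \<delta>3)"]) auto
qed

lemma linear_ode_derivative:
  fixes y :: "real \<Rightarrow> 'a::euclidean_space \<Rightarrow> 'b::euclidean_space"
  assumes U: "open U" and x0: "x0 \<in> U"
    and a: "\<And>b. b \<in> Basis \<Longrightarrow> Ck_family 1 {0..} {} W U (a b)"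
    and c: "Ck_family 1 {0..} {} W U c"
    and y0: "y 0 differentiable (at x0)"
    and y_cont: "continuous_on ({0..} \<times> U) (\<lambda>(t, x). y t x)"
    and y: "\<And>t x. 0 \<le> t \<Longrightarrow> x \<in> U \<Longrightarrow> ((\<lambda>t. y t x) has_vector_derivative
      basis_comb (\<lambda>b. a b t x) (y t x) + c t x) (at t within {0..})"
    and t: "0 \<le> t"
  shows "y t differentiable (at x0)" (is ?diff)
    and "((\<lambda>t. frechet_derivative (y t) (at x0) v) has_vector_derivative
      basis_comb (\<lambda>b. a b t x0) (frechet_derivative (y t) (at x0) v)
      + (basis_comb (\<lambda>b. frechet_derivative (a b t) (at x0) v) (y t x0)
         + frechet_derivative (c t) (at x0) v)) (at t within {0..})" (is ?der)
proof -
  have cont_x0: "continuous_on {0..} (\<lambda>t. f t x0)"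
    if "continuous_on ({0..} \<times> U) (\<lambda>(t, x). f t x)" for f :: "real \<Rightarrow> 'a \<Rightarrow> 'b"
    using continuous_on_compose2[OF that, of "{0..}" "\<lambda>t. (t, x0)"] x0
    by (simp add: image_subset_iff continuous_on_Pair)
  have main: "y t differentiable (at x0) \<and> ((\<lambda>t. frechet_derivative (y t) (at x0) v) has_vector_derivative
      basis_comb (\<lambda>b. a b t x0) (frechet_derivative (y t) (at x0) v)
      + (basis_comb (\<lambda>b. frechet_derivative (a b t) (at x0) v) (y t x0)
         + frechet_derivative (c t) (at x0) v)) (at t within {0..T})"
    if tT: "t \<in> {0..T}" for T
  proof -
    have T: "T \<ge> 0" using tT by simp
    have I: "{0..T} \<subseteq> {0..}" by auto
    note sub = Ck_family_subset[OF I subset_refl subset_refl]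
    \<comment> \<open>freezing \<open>y\<close> at \<open>x0\<close> moves the inhomogeneity of the difference equation into one smooth family\<close>
    define G where "G t x = basis_comb (\<lambda>b. a b t x) (y t x0) + c t x" for t x
    have "Ck_family 1 {0..T} {} (\<lambda>t. W t * W t) U (\<lambda>t x. basis_comb (\<lambda>b. a b t x) (y t x0))"
      unfolding basis_comb_def
      by (intro Ck_family_inner_scale U sub[OF a] Ck_family_parameter_only
          continuous_on_subset[OF cont_x0[OF y_cont] I]) auto
    then have bc: "Ck_family 1 {0..T} {} W U (\<lambda>t x. basis_comb (\<lambda>b. a b t x) (y t x0))"
      by (rule Ck_family_weight_mono[rotated]) auto
    then have G: "Ck_family 1 {0..T} {} W U G"
      unfolding G_def by (intro Ck_family_add U sub[OF c]) auto
    obtain r where r: "r > 0" "ball x0 r \<subseteq> U"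
      using U x0 open_contains_ball by blast
    \<comment> \<open>Now the coefficients are frozen at \<open>x0\<close>, as
      \<open>variation_of_solutions\<close> demands. The price is a product of two differences: the
      first is \<open>O(norm (x - x0))\<close> by the Lipschitz bound, the second tends to 0 by
      joint continuity. The product is thus \<open>o(norm (x - x0))\<close> while only continuity of
      \<open>y\<close> is known.\<close>
    define e where "e t x = basis_comb (\<lambda>b. a b t x - a b t x0) (y t x - y t x0) + (G t x - G t x0)" for t x
    define \<beta> where "\<beta> t = frechet_derivative (G t) (at x0)" for t
    have Gdiff: "G t differentiable (at x0)" if "t \<in> {0..T}" for t
      using Ck_family_has_derivative[OF G[unfolded One_nat_def] that x0]
      by (auto simp: differentiable_def)
    have linear_\<beta>: "linear (\<beta> t)" if "t \<in> {0..T}" for t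
      unfolding \<beta>_def using Gdiff[OF that] by (rule linear_frechet_derivative)
    have \<beta>_eq: "\<beta> t v = basis_comb (\<lambda>b. frechet_derivative (a b t) (at x0) v) (y t x0)
         + frechet_derivative (c t) (at x0) v" if "t \<in> {0..T}" for t
    proof -
      have "(G t has_derivative (\<lambda>v. basis_comb (\<lambda>b. frechet_derivative (a b t) (at x0) v) (y t x0)
         + frechet_derivative (c t) (at x0) v)) (at x0)"
        unfolding G_def basis_comb_def using that x0 a c
        by (intro has_derivative_add has_derivative_sum has_derivative_scaleR_right
            Ck_family_has_derivative[of 0]) auto
      then show ?thesis unfolding \<beta>_def by (simp add: frechet_derivative_at[symmetric])
    qed
    have der: "((\<lambda>t. y t x - y t x0) has_vector_derivative
        basis_comb (\<lambda>b. a b t x0) (y t x - y t x0) + e t x) (at t within {0..T})"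
      if "t \<in> {0..T}" "x \<in> ball x0 r" for t x
    proof -
      have "((\<lambda>t. y t x - y t x0) has_vector_derivative
        (basis_comb (\<lambda>b. a b t x) (y t x) + c t x) - (basis_comb (\<lambda>b. a b t x0) (y t x0) + c t x0))
        (at t within {0..T})"
        using that x0 r
        by (intro has_vector_derivative_diff has_vector_derivative_atLeast_Icc y) auto
      then show ?thesis
        by (simp add: e_def G_def basis_comb_diff basis_comb_diff_left algebra_simps)
    qed
    have e: "\<exists>\<delta>>0. \<forall>x\<in>ball x0 \<delta>. \<forall>t\<in>{0..T}. norm (e t x - \<beta> t (x - x0)) \<le> \<eta> * norm (x - x0)"
      if "\<eta> > 0" for \<eta>
    proof -
      obtain \<delta>1 where \<delta>1: "\<delta>1 > 0"
        "\<And>t x. t \<in> {0..T} \<Longrightarrow> x \<in> ball x0 \<delta>1 \<Longrightarrow>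
          norm (G t x - G t x0 - \<beta> t (x - x0)) \<le> \<eta> / 2 * norm (x - x0)"
        unfolding \<beta>_def
        by (rule uniform_taylor[OF G compact_Icc U x0, of "\<eta> / 2"]) (use \<open>\<eta> > 0\<close> in auto)
      have "\<exists>\<delta>>0. \<exists>L\<ge>0. \<forall>t\<in>{0..T}. \<forall>x\<in>ball x0 \<delta>. norm (a b t x - a b t x0) \<le> L * norm (x - x0)"
        if "b \<in> Basis" for b
        using uniform_lipschitz[OF sub[OF a[OF that]] compact_Icc U x0] by metis
      then obtain \<delta>b Lb where \<delta>b: "\<And>b. b \<in> Basis \<Longrightarrow> \<delta>b b > 0" "\<And>b. b \<in> Basis \<Longrightarrow> Lb b \<ge> 0"
        "\<And>b t x. b \<in> Basis \<Longrightarrow> t \<in> {0..T} \<Longrightarrow> x \<in> ball x0 (\<delta>b b) \<Longrightarrow>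
          norm (a b t x - a b t x0) \<le> Lb b * norm (x - x0)"
        by metis
      define \<delta>2 where "\<delta>2 = Min (\<delta>b ` Basis)"
      have \<delta>2: "\<delta>2 > 0" "\<And>b. b \<in> Basis \<Longrightarrow> \<delta>2 \<le> \<delta>b b"
        using \<delta>b(1) by (auto simp: \<delta>2_def)
      define L where "L = (\<Sum>b\<in>Basis. Lb b)"
      have L0: "L \<ge> 0" using \<delta>b(2) by (simp add: L_def sum_nonneg)
      have L: "norm (a b t x - a b t x0) \<le> L * norm (x - x0)"
        if "b \<in> Basis" "t \<in> {0..T}" "x \<in> ball x0 \<delta>2" for b t x
      proof -
        have "norm (a b t x - a b t x0) \<le> Lb b * norm (x - x0)"
          using \<delta>2(2)[OF that(1)] that by (intro \<delta>b(3)) auto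
        also have "\<dots> \<le> L * norm (x - x0)"
          unfolding L_def using \<delta>b(2) that(1) by (intro mult_right_mono member_le_sum) auto
        finally show ?thesis .
      qed
      define C where "C = real DIM('b) * L + 1"
      have C: "C > 0" using L0 by (simp add: C_def add_nonneg_pos)
      define \<eta>' where "\<eta>' = \<eta> / (2 * C)"
      have "\<eta>' > 0" using \<open>\<eta> > 0\<close> C by (simp add: \<eta>'_def)
      obtain \<delta>3 where \<delta>3: "\<delta>3 > 0"
        "\<And>t x. t \<in> {0..T} \<Longrightarrow> x \<in> ball x0 \<delta>3 \<Longrightarrow> norm (y t x - y t x0) \<le> \<eta>'"
        by (rule joint_continuity_tube[OF continuous_on_subset[OF y_cont Sigma_mono[OF I subset_refl]]
            compact_Icc U x0 \<open>\<eta>' > 0\<close>]) auto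
      have "norm (e t x - \<beta> t (x - x0)) \<le> \<eta> * norm (x - x0)"
        if x: "x \<in> ball x0 (min \<delta>1 (min \<delta>2 \<delta>3))" and t: "t \<in> {0..T}" for x t
      proof -
        have "norm (basis_comb (\<lambda>b. a b t x - a b t x0) (y t x - y t x0))
          \<le> real DIM('b) * (L * norm (x - x0)) * norm (y t x - y t x0)"
          using x t by (intro norm_basis_comb_le L) auto
        also have "\<dots> \<le> real DIM('b) * (L * norm (x - x0)) * \<eta>'"
          using \<delta>3(2)[OF t, of x] x L0 by (intro mult_left_mono) auto
        also have "\<dots> = (real DIM('b) * L) * \<eta>' * norm (x - x0)" by simp
        also have "\<dots> \<le> C * \<eta>' * norm (x - x0)"
          using \<open>\<eta>' > 0\<close> by (intro mult_right_mono) (auto simp: C_def)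
        also have "C * \<eta>' = \<eta> / 2"
          using C by (simp add: \<eta>'_def)
        finally have "norm (basis_comb (\<lambda>b. a b t x - a b t x0) (y t x - y t x0)) \<le> \<eta> / 2 * norm (x - x0)" .
        moreover have "norm (G t x - G t x0 - \<beta> t (x - x0)) \<le> \<eta> / 2 * norm (x - x0)"
          using \<delta>1(2)[OF t, of x] x by simp
        ultimately have "norm (basis_comb (\<lambda>b. a b t x - a b t x0) (y t x - y t x0)
            + (G t x - G t x0 - \<beta> t (x - x0))) \<le> \<eta> / 2 * norm (x - x0) + \<eta> / 2 * norm (x - x0)"
          by (rule norm_triangle_mono)
        then show ?thesis by (simp add: e_def algebra_simps)
      qed
      then show ?thesis using \<delta>1(1) \<delta>2(1) \<delta>3(1)
        by (intro exI[of _ "min \<delta>1 (min \<delta>2 \<delta>3)"]) auto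
    qed
    have m: "continuous_on {0..T} (\<lambda>t. a b t x0)" if "b \<in> Basis" for b
      using cont_x0[OF Ck_family_continuous[OF a[OF that]]] I by (rule continuous_on_subset)
    show ?thesis
      unfolding \<beta>_eq[OF tT, symmetric]
      using variation_of_solutions[OF T r(1) m linear_\<beta> der e y0[unfolded frechet_derivative_works] tT]
      by simp
  qed
  show ?diff using main[of t] t by simp
  show ?der using main t by (intro has_vector_derivative_within_atLeast) auto
qed

text \<open>The induction hypothesis is applied twice with the same coefficients: to
  \<open>y\<close>, which makes the inhomogeneity of the differentiated equation \<open>C^k\<close>,
  and then to the directional derivative of \<open>y\<close>. Hence \<open>y\<close> and
  \<open>c\<close> vary in the induction while \<open>a\<close> stays fixed.\<close>

lemma Ck_family_linear_ode:
  fixes y :: "real \<Rightarrow> 'a::euclidean_space \<Rightarrow> 'b::euclidean_space"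
  assumes U: "open U"
  shows "(\<And>b. b \<in> Basis \<Longrightarrow> Ck_family k {0..} {} W U (a b)) \<Longrightarrow> Ck_family k {0..} {} W U c \<Longrightarrow>
    Ck_on k U (y 0) \<Longrightarrow>
    (\<And>t x. 0 \<le> t \<Longrightarrow> x \<in> U \<Longrightarrow> ((\<lambda>t. y t x) has_vector_derivative
      basis_comb (\<lambda>b. a b t x) (y t x) + c t x) (at t within {0..})) \<Longrightarrow>
    Ck_family k {0..} {} W U y"
proof (induction k arbitrary: y c)
  case 0
  have "continuous_on ({0..} \<times> U) (\<lambda>(t, x). y t x)"
    by (rule linear_ode_continuous[OF U Ck_family_continuous[OF 0(1)] Ck_family_continuous[OF 0(2)]
        Ck_on_continuous[OF 0(3)] 0(4)])
  then show ?case by simp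
next
  case (Suc k)
  note a = Suc.prems(1) and c = Suc.prems(2) and y0 = Suc.prems(3) and ode = Suc.prems(4)
  have yk: "Ck_family k {0..} {} W U y"
    by (rule Suc.IH[OF Ck_family_Suc_le[OF a] Ck_family_Suc_le[OF c] Ck_on_Suc_le[OF y0] ode])
  have le1: "Ck_family (Suc j) {0..} {} W U f \<Longrightarrow> Ck_family 1 {0..} {} W U f"
    for f :: "real \<Rightarrow> 'a \<Rightarrow> 'b" and j
  proof (induction j)
    case (Suc j)
    then show ?case using Ck_family_Suc_le by blast
  qed simp
  note der = linear_ode_derivative[OF U _ le1[OF a] le1[OF c] Ck_on_differentiable[OF y0]
      Ck_family_continuous[OF yk] ode]
  have D: "Ck_family k {0..} {} W U (\<lambda>t x. frechet_derivative (y t) (at x) v)" for v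
  proof (rule Suc.IH[OF Ck_family_Suc_le[OF a]])
    have "Ck_family k {0..} {} (\<lambda>t. W t * W t) U
        (\<lambda>t x. basis_comb (\<lambda>b. frechet_derivative (a b t) (at x) v) (y t x))"
      unfolding basis_comb_def
      by (intro Ck_family_inner_scale U yk Ck_family_derivative a) auto
    then have "Ck_family k {0..} {} W U
        (\<lambda>t x. basis_comb (\<lambda>b. frechet_derivative (a b t) (at x) v) (y t x))"
      by (rule Ck_family_weight_mono[rotated]) auto
    then show "Ck_family k {0..} {} W U
        (\<lambda>t x. basis_comb (\<lambda>b. frechet_derivative (a b t) (at x) v) (y t x)
          + frechet_derivative (c t) (at x) v)"
      by (intro Ck_family_add U Ck_family_derivative c) auto
    show "Ck_on k U (\<lambda>x. frechet_derivative (y 0) (at x) v)" using y0 by simp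
  qed (assumption | rule der(2))+
  show ?case
    unfolding Ck_family_Suc using Ck_family_0[OF yk] D der(1) by auto
qed

section \<open>Smoothness of semiflows\<close>

text \<open>Recentring turns a neighbourhood of a whole path into a fixed ball around 0, so that
  Taylor and Lipschitz estimates at a single base point apply uniformly along the path.\<close>

lemma path_tube_family:
  fixes F :: "'a::euclidean_space \<Rightarrow> 'b::real_normed_vector" and p :: "real \<Rightarrow> 'a"
  assumes F: "Ck_on k \<Omega> F" and \<Omega>: "open \<Omega>" and T: "0 \<le> T"
    and p: "continuous_on {0..T} p" "\<And>t. t \<in> {0..T} \<Longrightarrow> p t \<in> \<Omega>"
  obtains \<epsilon> where "\<epsilon> > 0" "\<And>t. t \<in> {0..T} \<Longrightarrow> ball (p t) \<epsilon> \<subseteq> \<Omega>"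
    "Ck_family k {0..T} {} (\<lambda>_. 1) (ball 0 \<epsilon>) (\<lambda>t \<xi>. F (p t + \<xi>))"
proof -
  have K: "compact (p ` {0..T})" "p ` {0..T} \<noteq> {}" "p ` {0..T} \<subseteq> \<Omega>"
    using compact_continuous_image[OF p(1) compact_Icc] p(2) T by auto
  then obtain \<epsilon> where \<epsilon>: "\<epsilon> > 0" "{x. infdist x (p ` {0..T}) \<le> \<epsilon>} \<subseteq> \<Omega>"
    using compact_in_open_separated \<Omega> by metis
  have tube: "ball (p t) \<epsilon> \<subseteq> \<Omega>" if "t \<in> {0..T}" for t
  proof
    fix x assume "x \<in> ball (p t) \<epsilon>"
    then have "infdist x (p ` {0..T}) \<le> \<epsilon>"
      using infdist_le[of "p t" "p ` {0..T}" x] that by (simp add: dist_commute)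
    then show "x \<in> \<Omega>" using \<epsilon>(2) by auto
  qed
  have "Ck_family k {0..T} {} (\<lambda>_. 1) (ball 0 \<epsilon>) (\<lambda>t \<xi>. p t + \<xi>)"
    by (intro Ck_family_add Ck_family_parameter_only p Ck_on_family Ck_on_id) auto
  moreover have "p t + \<xi> \<in> \<Omega>" if "t \<in> {0..T}" "\<xi> \<in> ball 0 \<epsilon>" for t \<xi>
    using tube[OF that(1)] that(2) by (auto simp: subset_eq dist_norm)
  ultimately have "Ck_family k {0..T} {} (\<lambda>_. 1) (ball 0 \<epsilon>) (\<lambda>t \<xi>. F (p t + \<xi>))"
    using F \<Omega> by (intro Ck_family_compose[where K = "{}" and y = "\<lambda>t \<xi>. p t + \<xi>" and F = F]) auto
  then show ?thesis using that \<epsilon>(1) tube by blast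
qed

text \<open>First exit argument: while \<open>q\<close> is within \<open>\<epsilon>\<close> of
  \<open>p\<close>, Gronwall bounds the distance by \<open>K\<close> times its initial value, and a
  start closer than \<open>\<epsilon> / K\<close> rules out an exit. That \<open>q\<close> stays
  near \<open>p\<close>, hence in the domain, is a result and not a hypothesis; for equal initial
  values the estimate is uniqueness.\<close>

lemma solutions_stay_close:
  fixes F :: "'a::euclidean_space \<Rightarrow> 'a"
  assumes F: "Ck_on 1 \<Omega> F" and \<Omega>: "open \<Omega>" and T: "0 \<le> T"
    and p: "\<And>t. t \<in> {0..T} \<Longrightarrow> p t \<in> \<Omega>"
      "\<And>t. t \<in> {0..T} \<Longrightarrow> (p has_vector_derivative F (p t)) (at t within {0..T})"
  obtains \<delta> K where "\<delta> > 0" "K \<ge> 0"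
    "\<And>q t. (\<And>t. t \<in> {0..T} \<Longrightarrow> (q has_vector_derivative F (q t)) (at t within {0..T})) \<Longrightarrow>
      norm (q 0 - p 0) < \<delta> \<Longrightarrow> t \<in> {0..T} \<Longrightarrow> norm (q t - p t) \<le> K * norm (q 0 - p 0)"
proof -
  have pc: "continuous_on {0..T} p"
    using p(2) by (rule continuous_on_solution)
  obtain \<epsilon>0 where \<epsilon>0: "\<epsilon>0 > 0"
    "Ck_family 1 {0..T} {} (\<lambda>_. 1) (ball 0 \<epsilon>0) (\<lambda>t \<xi>. F (p t + \<xi>))"
    by (rule path_tube_family[OF F \<Omega> T pc p(1)])
  obtain \<epsilon> L where \<epsilon>: "\<epsilon> > 0" "L \<ge> 0"
    "\<And>t \<xi>. t \<in> {0..T} \<Longrightarrow> \<xi> \<in> ball 0 \<epsilon> \<Longrightarrow> norm (F (p t + \<xi>) - F (p t + 0)) \<le> L * norm (\<xi> - 0)"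
    by (rule uniform_lipschitz[OF \<epsilon>0(2) compact_Icc open_ball, of 0]) (use \<epsilon>0 in auto)
  define K where "K = exp (L * T)"
  have K: "K > 0" by (simp add: K_def)
  show ?thesis
  proof (rule that[of "\<epsilon> / K" K])
    fix q t
    assume q: "\<And>t. t \<in> {0..T} \<Longrightarrow> (q has_vector_derivative F (q t)) (at t within {0..T})"
      and small: "norm (q 0 - p 0) < \<epsilon> / K" and t: "t \<in> {0..T}"
    have bd: "norm (q s - p s) \<le> K * norm (q 0 - p 0)"
      if s: "s \<in> {0..T}" and before: "\<And>r. 0 < r \<Longrightarrow> r < s \<Longrightarrow> norm (q r - p r) < \<epsilon>" for s
    proof -
      have "norm (q s - p s) \<le> (norm (q 0 - p 0) + 0 * s) * exp (L * s)"
      proof (rule gronwall_norm[where w' = "\<lambda>t. F (q t) - F (p t)"])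
        show "((\<lambda>t. q t - p t) has_vector_derivative F (q t) - F (p t)) (at t within {0..s})"
          if "t \<in> {0..s}" for t
          using that s
          by (intro has_vector_derivative_diff has_vector_derivative_within_subset[OF q]
              has_vector_derivative_within_subset[OF p(2)]) auto
        show "norm (F (q t) - F (p t)) \<le> L * norm (q t - p t) + 0" if "0 < t" "t < s" for t
          using \<epsilon>(3)[of t "q t - p t"] before[OF that] that s by simp
      qed (use s \<epsilon> in auto)
      also have "\<dots> \<le> norm (q 0 - p 0) * K"
        using s \<epsilon>(2) by (auto simp: K_def intro!: mult_left_mono)
      finally show ?thesis by (simp add: mult.commute)
    qed
    have lt: "norm (q s - p s) < \<epsilon>" if "s \<in> {0..T}" for s
    proof (rule ccontr)
      assume "\<not> norm (q s - p s) < \<epsilon>"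
      \<comment> \<open>The exit times form a closed set, so there is a first one; before it the
        distance is below \<open>\<epsilon>\<close>, which is what \<open>bd\<close> asks
        for.\<close>
      define S where "S = {t \<in> {0..T}. norm (q t - p t) \<in> {\<epsilon>..}}"
      have "s \<in> S" using that \<open>\<not> norm (q s - p s) < \<epsilon>\<close> by (auto simp: S_def)
      have "continuous_on {0..T} q" using q by (rule continuous_on_solution)
      then have "closed S" unfolding S_def
        by (intro continuous_closed_preimage[unfolded vimage_def Int_def mem_Collect_eq]
            continuous_intros pc) auto
      moreover have bdd: "bdd_below S" unfolding S_def by (rule bdd_belowI[of _ 0]) auto
      ultimately have inf: "Inf S \<in> S"
        using \<open>s \<in> S\<close> closed_contains_Inf by blast
      have "norm (q r - p r) < \<epsilon>" if "0 < r" "r < Inf S" for r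
      proof (rule ccontr)
        assume "\<not> norm (q r - p r) < \<epsilon>"
        then have "r \<in> S" using that inf by (auto simp: S_def)
        then show False using cInf_lower[OF _ bdd] that(2) by fastforce
      qed
      then have "norm (q (Inf S) - p (Inf S)) \<le> K * norm (q 0 - p 0)"
        using inf by (intro bd) (auto simp: S_def)
      also have "\<dots> < \<epsilon>" using small K by (simp add: field_simps)
      finally show False using inf by (auto simp: S_def)
    qed
    show "norm (q t - p t) \<le> K * norm (q 0 - p 0)"
      using bd[OF t] lt t by auto
  qed (use \<epsilon> K in auto)
qed

text \<open>The semigroup law is not an axiom, because \<open>\<phi>\<close> will consist of
  independently chosen solutions; uniqueness yields it as \<open>flow_add\<close>. Derivatives are
  taken within \<open>{0..}\<close> since nothing is known at negative times.\<close>

locale smooth_semiflow =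
  fixes \<Omega> :: "'a::euclidean_space set" and F :: "'a \<Rightarrow> 'a" and \<phi> :: "real \<Rightarrow> 'a \<Rightarrow> 'a"
  assumes open_dom: "open \<Omega>"
    and smooth: "smooth_on \<Omega> F"
    and start: "x \<in> \<Omega> \<Longrightarrow> \<phi> 0 x = x"
    and stays: "x \<in> \<Omega> \<Longrightarrow> 0 \<le> t \<Longrightarrow> \<phi> t x \<in> \<Omega>"
    and solves: "x \<in> \<Omega> \<Longrightarrow> 0 \<le> t \<Longrightarrow>
      ((\<lambda>t. \<phi> t x) has_vector_derivative F (\<phi> t x)) (at t within {0..})"
begin

lemma field_Ck: "Ck_on k \<Omega> F"
  using smooth by (simp add: smooth_on_def)

lemma flow_continuous_time: "x \<in> \<Omega> \<Longrightarrow> continuous_on {0..} (\<lambda>t. \<phi> t x)"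
  using solves by (intro continuous_on_solution) auto

lemma solves_Icc: "x \<in> \<Omega> \<Longrightarrow> t \<in> {0..T} \<Longrightarrow>
    ((\<lambda>t. \<phi> t x) has_vector_derivative F (\<phi> t x)) (at t within {0..T})"
  using solves by (intro has_vector_derivative_atLeast_Icc) auto

lemma flow_unique:
  assumes x: "x \<in> \<Omega>" and q: "\<And>t. 0 \<le> t \<Longrightarrow> (q has_vector_derivative F (q t)) (at t within {0..})"
    "q 0 = x" and t: "0 \<le> t"
  shows "q t = \<phi> t x"
proof -
  obtain \<delta> K where *: "\<delta> > 0"
    "\<And>q s. (\<And>s. s \<in> {0..t} \<Longrightarrow> (q has_vector_derivative F (q s)) (at s within {0..t})) \<Longrightarrow>
      norm (q 0 - \<phi> 0 x) < \<delta> \<Longrightarrow> s \<in> {0..t} \<Longrightarrow> norm (q s - \<phi> s x) \<le> K * norm (q 0 - \<phi> 0 x)"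
    by (rule solutions_stay_close[OF field_Ck open_dom t, of "\<lambda>t. \<phi> t x"])
      (use x stays solves_Icc in auto)
  have "norm (q t - \<phi> t x) \<le> K * norm (q 0 - \<phi> 0 x)"
    using q t x *(1) by (intro *(2) has_vector_derivative_atLeast_Icc) (auto simp: start)
  then show ?thesis using q x by (simp add: start)
qed

lemma flow_add:
  assumes x: "x \<in> \<Omega>" and s: "0 \<le> s" and t: "0 \<le> t"
  shows "\<phi> (s + t) x = \<phi> t (\<phi> s x)"
proof (rule flow_unique[OF stays[OF x s] _ _ t])
  show "((\<lambda>t. \<phi> (s + t) x) has_vector_derivative F (\<phi> (s + t) x)) (at t within {0..})"
    if "0 \<le> t" for t
    using s that by (intro has_vector_derivative_time_shift solves x) auto
qed simp

lemma flow_close: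
  assumes x0: "x0 \<in> \<Omega>" and T: "0 \<le> T"
  obtains \<delta> K where "\<delta> > 0" "K \<ge> 0" "ball x0 \<delta> \<subseteq> \<Omega>"
    "\<And>x t. x \<in> ball x0 \<delta> \<Longrightarrow> t \<in> {0..T} \<Longrightarrow> norm (\<phi> t x - \<phi> t x0) \<le> K * norm (x - x0)"
proof -
  obtain \<delta> K where *: "\<delta> > 0" "K \<ge> 0"
    "\<And>q t. (\<And>t. t \<in> {0..T} \<Longrightarrow> (q has_vector_derivative F (q t)) (at t within {0..T})) \<Longrightarrow>
      norm (q 0 - \<phi> 0 x0) < \<delta> \<Longrightarrow> t \<in> {0..T} \<Longrightarrow> norm (q t - \<phi> t x0) \<le> K * norm (q 0 - \<phi> 0 x0)"
    by (rule solutions_stay_close[OF field_Ck open_dom T, of "\<lambda>t. \<phi> t x0"])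
      (use x0 stays solves_Icc in auto)
  obtain r where r: "r > 0" "ball x0 r \<subseteq> \<Omega>"
    using open_dom x0 open_contains_ball by blast
  have "norm (\<phi> t x - \<phi> t x0) \<le> K * norm (x - x0)" if x: "x \<in> ball x0 (min \<delta> r)" and t: "t \<in> {0..T}" for x t
  proof -
    have "x \<in> \<Omega>" using x r by auto
    then have "norm (\<phi> t x - \<phi> t x0) \<le> K * norm (\<phi> 0 x - \<phi> 0 x0)"
      using x x0 t
      by (intro *(3) has_vector_derivative_atLeast_Icc solves)
        (auto simp: start dist_norm norm_minus_commute)
    then show ?thesis using x0 \<open>x \<in> \<Omega>\<close> by (simp add: start)
  qed
  moreover have "ball x0 (min \<delta> r) \<subseteq> \<Omega>" using r by auto
  moreover have "min \<delta> r > 0" using *(1) r(1) by simp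
  ultimately show ?thesis using that[of "min \<delta> r" K] *(2) by blast
qed

lemma flow_continuous: "continuous_on ({0..} \<times> \<Omega>) (\<lambda>(t, x). \<phi> t x)"
proof (rule joint_continuousI[OF flow_continuous_time])
  fix x0 and T \<eta> :: real assume "x0 \<in> \<Omega>" "0 \<le> T" "0 < \<eta>"
  then obtain \<delta> K where *: "\<delta> > 0" "K \<ge> 0" "ball x0 \<delta> \<subseteq> \<Omega>"
    "\<And>x t. x \<in> ball x0 \<delta> \<Longrightarrow> t \<in> {0..T} \<Longrightarrow> norm (\<phi> t x - \<phi> t x0) \<le> K * norm (x - x0)"
    using flow_close by metis
  have "norm (\<phi> t x - \<phi> t x0) \<le> \<eta>"
    if x: "x \<in> ball x0 (min \<delta> (\<eta> / (K + 1)))" and t: "t \<in> {0..T}" for x t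
  proof -
    have "norm (\<phi> t x - \<phi> t x0) \<le> K * norm (x - x0)" using x t by (intro *(4)) auto
    also have "\<dots> \<le> (K + 1) * (\<eta> / (K + 1))"
      using x *(2) \<open>0 < \<eta>\<close> by (intro mult_mono) (auto simp: dist_norm norm_minus_commute)
    also have "\<dots> = \<eta>" using *(2) by simp
    finally show ?thesis .
  qed
  then show "\<exists>\<delta>>0. \<forall>x\<in>ball x0 \<delta> \<inter> \<Omega>. \<forall>t\<in>{0..T}. norm (\<phi> t x - \<phi> t x0) \<le> \<eta>"
    using *(1,2) \<open>0 < \<eta>\<close> by (intro exI[of _ "min \<delta> (\<eta> / (K + 1))"]) (auto simp: add_nonneg_pos)
qed

text \<open>The error \<open>e\<close> is the Taylor remainder of \<open>F\<close> along the
  trajectory of \<open>x0\<close>. It is \<open>o(norm (\<phi> t x - \<phi> t x0))\<close>, and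
  \<open>flow_close\<close> turns this into \<open>o(norm (x - x0))\<close>, uniformly over
  \<open>{0..T}\<close>. Thus \<open>\<beta>\<close> is 0 in
  \<open>variation_of_solutions\<close>.\<close>

lemma flow_derivative:
  assumes x0: "x0 \<in> \<Omega>" and t: "0 \<le> t"
  shows "\<phi> t differentiable (at x0)" (is ?diff)
    and "((\<lambda>t. frechet_derivative (\<phi> t) (at x0) v) has_vector_derivative
      basis_comb (frechet_derivative F (at (\<phi> t x0))) (frechet_derivative (\<phi> t) (at x0) v))
      (at t within {0..})" (is ?der)
proof -
  have main: "\<phi> t differentiable (at x0) \<and> ((\<lambda>t. frechet_derivative (\<phi> t) (at x0) v) has_vector_derivative
      basis_comb (frechet_derivative F (at (\<phi> t x0))) (frechet_derivative (\<phi> t) (at x0) v) + 0)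
      (at t within {0..T})"
    if tT: "t \<in> {0..T}" for T
  proof -
    have T: "T \<ge> 0" using tT by simp
    have pc: "continuous_on {0..T} (\<lambda>t. \<phi> t x0)"
      using flow_continuous_time[OF x0] by (rule continuous_on_subset) auto
    obtain r K where r: "r > 0" "K \<ge> 0" "ball x0 r \<subseteq> \<Omega>"
      "\<And>x t. x \<in> ball x0 r \<Longrightarrow> t \<in> {0..T} \<Longrightarrow> norm (\<phi> t x - \<phi> t x0) \<le> K * norm (x - x0)"
      using flow_close[OF x0 T] by metis
    define e where "e t x = F (\<phi> t x) - F (\<phi> t x0)
      - basis_comb (frechet_derivative F (at (\<phi> t x0))) (\<phi> t x - \<phi> t x0)" for t x
    have Fdiff: "F differentiable (at (\<phi> t x0))" if "t \<in> {0..T}" for t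
      using Ck_on_differentiable[OF field_Ck stays[OF x0]] that by simp
    have der: "((\<lambda>t. \<phi> t x - \<phi> t x0) has_vector_derivative
        basis_comb (\<lambda>b. frechet_derivative F (at (\<phi> t x0)) b) (\<phi> t x - \<phi> t x0) + e t x) (at t within {0..T})"
      if "t \<in> {0..T}" "x \<in> ball x0 r" for t x
      using has_vector_derivative_diff[OF has_vector_derivative_atLeast_Icc[OF solves[of x t]]
          has_vector_derivative_atLeast_Icc[OF solves[OF x0, of t]], of T] that r(3)
      by (auto simp: e_def)
    have e: "\<exists>\<delta>>0. \<forall>x\<in>ball x0 \<delta>. \<forall>t\<in>{0..T}. norm (e t x - 0) \<le> \<eta> * norm (x - x0)"
      if "\<eta> > 0" for \<eta>
    proof -
      obtain \<epsilon> where \<epsilon>: "\<epsilon> > 0"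
        "Ck_family 1 {0..T} {} (\<lambda>_. 1) (ball 0 \<epsilon>) (\<lambda>t \<xi>. F (\<phi> t x0 + \<xi>))"
        by (rule path_tube_family[OF field_Ck open_dom T pc stays[OF x0]]) auto
      define \<eta>' where "\<eta>' = \<eta> / (K + 1)"
      have "\<eta>' > 0" using that r(2) by (simp add: \<eta>'_def)
      obtain \<delta> where \<delta>: "\<delta> > 0"
        "\<And>t \<xi>. t \<in> {0..T} \<Longrightarrow> \<xi> \<in> ball 0 \<delta> \<Longrightarrow>
          norm (F (\<phi> t x0 + \<xi>) - F (\<phi> t x0 + 0)
            - frechet_derivative (\<lambda>\<xi>. F (\<phi> t x0 + \<xi>)) (at 0) (\<xi> - 0)) \<le> \<eta>' * norm (\<xi> - 0)"
        by (rule uniform_taylor[OF \<epsilon>(2) compact_Icc open_ball _ \<open>\<eta>' > 0\<close>, of 0]) (use \<epsilon>(1) in auto)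
      have shift: "frechet_derivative (\<lambda>\<xi>. F (\<phi> t x0 + \<xi>)) (at 0) = frechet_derivative F (at (\<phi> t x0))"
        if "t \<in> {0..T}" for t
      proof -
        have "((\<lambda>\<xi>. \<phi> t x0 + \<xi>) has_derivative (\<lambda>v. v)) (at 0)"
          by (auto intro!: derivative_eq_intros)
        then have "((\<lambda>\<xi>. F (\<phi> t x0 + \<xi>)) has_derivative frechet_derivative F (at (\<phi> t x0))) (at 0)"
          using has_derivative_compose[of "\<lambda>\<xi>. \<phi> t x0 + \<xi>" "\<lambda>v. v" 0 UNIV F]
            Fdiff[OF that] by (simp add: frechet_derivative_works)
        then show ?thesis by (simp add: frechet_derivative_at[symmetric])
      qed
      have "norm (e t x - 0) \<le> \<eta> * norm (x - x0)"
        if x: "x \<in> ball x0 (min r (\<delta> / (K + 1)))" and t: "t \<in> {0..T}" for x t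
      proof -
        have le: "norm (\<phi> t x - \<phi> t x0) \<le> K * norm (x - x0)" using x t by (intro r(4)) auto
        also have "\<dots> \<le> (K + 1) * norm (x - x0)" by (intro mult_right_mono) auto
        also have "\<dots> < (K + 1) * (\<delta> / (K + 1))"
          using x r(2) by (intro mult_strict_left_mono) (auto simp: dist_norm norm_minus_commute)
        also have "\<dots> = \<delta>" using r(2) by simp
        finally have "norm (e t x) \<le> \<eta>' * norm (\<phi> t x - \<phi> t x0)"
          using \<delta>(2)[OF t, of "\<phi> t x - \<phi> t x0"] shift[OF t]
          by (simp add: e_def frechet_derivative_basis_comb[OF Fdiff[OF t]])
        also have "\<dots> \<le> \<eta>' * ((K + 1) * norm (x - x0))"
          using \<open>\<eta>' > 0\<close> by (intro mult_left_mono order_trans[OF le] mult_right_mono) auto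
        also have "\<dots> = \<eta> * norm (x - x0)" using r(2) by (simp add: \<eta>'_def)
        finally show ?thesis by simp
      qed
      then show ?thesis using r(1,2) \<delta>(1)
        by (intro exI[of _ "min r (\<delta> / (K + 1))"]) (auto simp: add_nonneg_pos)
    qed
    have m: "continuous_on {0..T} (\<lambda>t. frechet_derivative F (at (\<phi> t x0)) b)" for b
    proof (rule continuous_on_compose2[OF _ pc])
      show "continuous_on \<Omega> (\<lambda>x. frechet_derivative F (at x) b)"
        using field_Ck[of 1] by simp
    qed (use stays[OF x0] in auto)
    have y0: "(\<phi> 0 has_derivative (\<lambda>v. v)) (at x0)"
      by (rule has_derivative_transform_within_open[OF has_derivative_ident open_dom x0]) (simp add: start)
    have zero: "linear (\<lambda>v. 0 :: 'a)" by (rule linear_zero)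
    show ?thesis
      using variation_of_solutions[where \<beta> = "\<lambda>t v. 0" and y = \<phi> and e = e, OF T r(1) m zero der e y0 tT] by simp
  qed
  show ?diff using main[of t] t by simp
  show ?der using main t by (intro has_vector_derivative_within_atLeast) auto
qed

text \<open>Bootstrapping: the derivative of \<open>F\<close> along the flow is as regular as
  \<open>\<phi>\<close>, that is \<open>C^k\<close> by induction, and the linear equation hands this
  regularity to the directional derivatives of \<open>\<phi>\<close>, which gains one order.\<close>

lemma flow_Ck: "Ck_family k {0..} {} (\<lambda>_. 1) \<Omega> \<phi>"
proof (induction k)
  case 0
  then show ?case using flow_continuous by simp
next
  case (Suc k)
  have "Ck_family k {0..} {} (\<lambda>_. 1) \<Omega> (\<lambda>t x. frechet_derivative (\<phi> t) (at x) v)" for v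
  proof (rule Ck_family_linear_ode[OF open_dom _ Ck_family_zero])
    show "Ck_family k {0..} {} (\<lambda>_. 1) \<Omega> (\<lambda>t x. frechet_derivative F (at (\<phi> t x)) b)" for b
      using field_Ck[of "Suc k"] stays open_dom Suc.IH
      by (intro Ck_family_compose[where K = "{}" and \<Omega> = \<Omega> and y = \<phi>
            and F = "\<lambda>x. frechet_derivative F (at x) b"]) auto
    show "Ck_on k \<Omega> (\<lambda>x. frechet_derivative (\<phi> 0) (at x) v)"
    proof (rule Ck_on_cong[OF open_dom Ck_on_const])
      fix x assume "x \<in> \<Omega>"
      then show "v = frechet_derivative (\<phi> 0) (at x) v"
        using fun_cong[OF frechet_derivative_cong_open[OF open_dom, of x "\<lambda>x. x" "\<phi> 0"], of v]
        by (simp add: start)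
    qed
    show "((\<lambda>t. frechet_derivative (\<phi> t) (at x) v) has_vector_derivative
      basis_comb (\<lambda>b. frechet_derivative F (at (\<phi> t x)) b) (frechet_derivative (\<phi> t) (at x) v) + 0)
      (at t within {0..})" if "0 \<le> t" "x \<in> \<Omega>" for t x
      using flow_derivative(2)[OF that(2,1)] by simp
  qed
  then show ?case
    unfolding Ck_family_Suc using flow_derivative(1) flow_continuous by auto
qed

text \<open>An integral along the flow solves a linear equation with zero coefficients and
  inhomogeneity \<open>r (\<phi> t x)\<close>. Its smoothness in \<open>x\<close> thus follows
  without differentiating under the integral sign.\<close>

lemma flow_integral_Ck:
  assumes r: "\<And>k. Ck_on k \<Omega> r"
    and Y: "\<And>t x. 0 \<le> t \<Longrightarrow> x \<in> \<Omega> \<Longrightarrow>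
      ((\<lambda>t. Y t x) has_vector_derivative (r (\<phi> t x) :: 'b::euclidean_space)) (at t within {0..})"
    and Y0: "\<And>x. x \<in> \<Omega> \<Longrightarrow> Y 0 x = 0"
  shows "Ck_family k {0..} {} (\<lambda>_. 1) \<Omega> Y"
proof (rule Ck_family_linear_ode[OF open_dom Ck_family_zero, where c = "\<lambda>t x. r (\<phi> t x)"])
  show "Ck_family k {0..} {} (\<lambda>_. 1) \<Omega> (\<lambda>t x. r (\<phi> t x))"
    using r stays open_dom flow_Ck 
    by (intro Ck_family_compose[where K = "{}" and \<Omega> = \<Omega> and y = \<phi> and F = r]) auto
  show "Ck_on k \<Omega> (Y 0)"
    by (rule Ck_on_cong[OF open_dom Ck_on_const]) (simp add: Y0)
  show "((\<lambda>t. Y t x) has_vector_derivative basis_comb (\<lambda>b. 0) (Y t x) + r (\<phi> t x)) (at t within {0..})"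
    if "0 \<le> t" "x \<in> \<Omega>" for t x
    using Y[OF that] by (simp add: basis_comb_def)
qed

end

section \<open>Iterates of a contraction\<close>

text \<open>The tail bound is explicit so that it is uniform wherever \<open>c\<close> is; the
  series of derivatives needs it uniformly in the point and proportional to the length of the
  direction.\<close>

lemma geometric_tail:
  fixes f :: "nat \<Rightarrow> 'b::banach"
  assumes f: "\<And>n. norm (f n) \<le> c * \<rho> ^ n" and \<rho>: "0 \<le> \<rho>" "\<rho> < 1"
  shows "summable f" and "norm ((\<Sum>i<n. f i) - suminf f) \<le> c / (1 - \<rho>) * \<rho> ^ n"
proof -
  have geo: "summable (\<lambda>n. c * \<rho> ^ n)"
    using \<rho> by (intro summable_mult summable_geometric) auto
  then show sf: "summable f"
    using f by (rule summable_comparison_test'[where N = 0])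
  have bd: "norm (f (i + n)) \<le> c * \<rho> ^ n * \<rho> ^ i" for i
    using f[of "i + n"] by (simp add: power_add mult_ac)
  have geo': "(\<lambda>i. c * \<rho> ^ n * \<rho> ^ i) sums (c * \<rho> ^ n * (1 / (1 - \<rho>)))"
    using \<rho> by (intro sums_mult geometric_sums) auto
  have "suminf f = (\<Sum>i. f (i + n)) + (\<Sum>i<n. f i)"
    using suminf_split_initial_segment[OF sf] .
  then have "norm ((\<Sum>i<n. f i) - suminf f) = norm (\<Sum>i. f (i + n))"
    by (simp add: norm_minus_commute)
  also have "\<dots> \<le> (\<Sum>i. c * \<rho> ^ n * \<rho> ^ i)"
    using geo' bd by (intro norm_suminf_le) (auto simp: sums_iff)
  also have "\<dots> = c / (1 - \<rho>) * \<rho> ^ n"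
    using sums_unique[OF geo'] by simp
  finally show "norm ((\<Sum>i<n. f i) - suminf f) \<le> c / (1 - \<rho>) * \<rho> ^ n" .
qed

text \<open>Termwise differentiation; \<open>has_derivative_series\<close> is what asks for a convex
  \<open>U\<close>. The series of directional derivatives satisfies the same hypothesis at one order
  less, so the induction closes.\<close>

lemma Ck_on_suminf:
  fixes y :: "nat \<Rightarrow> 'a::euclidean_space \<Rightarrow> 'b::banach"
  assumes U: "open U" "convex U" and \<rho>: "0 \<le> \<rho>" "\<rho> < 1"
  shows "Ck_family k UNIV UNIV (\<lambda>n. \<rho> ^ n) U y \<Longrightarrow> Ck_on k U (\<lambda>x. \<Sum>n. y n x)"
proof (induction k arbitrary: y)
  case 0
  obtain c where c: "\<And>n x. x \<in> U \<Longrightarrow> norm (y n x) \<le> c * \<rho> ^ n"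
    using Ck_family_bound[OF 0] by (metis UNIV_I)
  have "uniform_limit U (\<lambda>n x. \<Sum>i<n. y i x) (\<lambda>x. \<Sum>i. y i x) sequentially"
    using c \<rho> by (intro Weierstrass_m_test[where M = "\<lambda>n. c * \<rho> ^ n"] summable_mult summable_geometric) auto
  moreover have "continuous_on U (y n)" for n
    using continuous_on_compose2[OF Ck_family_continuous[OF 0], of U "\<lambda>x. (n, x)"]
    by (simp add: image_subset_iff continuous_on_Pair)
  then have "\<forall>\<^sub>F n in sequentially. continuous_on U (\<lambda>x. \<Sum>i<n. y i x)"
    by (intro always_eventually allI continuous_on_sum) auto
  ultimately show ?case
    using uniform_limit_theorem[OF _ _ sequentially_bot] by simp
next
  case (Suc k)
  let ?D = "\<lambda>n x. frechet_derivative (y n) (at x)"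
  obtain c where c: "\<And>n x. x \<in> U \<Longrightarrow> norm (y n x) \<le> c * \<rho> ^ n"
    using Ck_family_bound[OF Suc.prems] by (metis UNIV_I)
  have "\<exists>d. \<forall>n. \<forall>x\<in>U. norm (?D n x v) \<le> d * \<rho> ^ n" for v
    using Ck_family_bound[OF Ck_family_derivative[OF Suc.prems]] by (metis UNIV_I)
  then obtain d where d: "\<And>v n x. x \<in> U \<Longrightarrow> norm (?D n x v) \<le> d v * \<rho> ^ n" by metis
  \<comment> \<open>The bounds \<open>d v\<close> depend on \<open>v\<close> in an unknown way.
    Summing over the basis gives a bound proportional to \<open>norm v\<close>, as needed for
    uniform convergence of the derivatives as linear maps.\<close>
  define C where "C = (\<Sum>b\<in>Basis. \<bar>d b\<bar>)"
  have C: "norm (?D n x v) \<le> (real DIM('a) * C * norm v) * \<rho> ^ n" if "x \<in> U" for n x v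
  proof -
    have "y n differentiable (at x)"
      using Suc.prems that by (simp add: Ck_family_Suc)
    then have "?D n x v = basis_comb (?D n x) v" by (rule frechet_derivative_basis_comb)
    also have "norm \<dots> \<le> real DIM('a) * (C * \<rho> ^ n) * norm v"
    proof (rule norm_basis_comb_le)
      fix b :: 'a assume "b \<in> Basis"
      have "norm (?D n x b) \<le> d b * \<rho> ^ n" using that by (rule d)
      also have "\<dots> \<le> C * \<rho> ^ n"
        using member_le_sum[of b Basis "\<lambda>b. \<bar>d b\<bar>"] \<open>b \<in> Basis\<close> \<rho>(1)
        by (intro mult_right_mono) (auto simp: C_def)
      finally show "norm (?D n x b) \<le> C * \<rho> ^ n" .
    qed
    finally show ?thesis by (simp add: mult_ac)
  qed
  define S where "S x v = (\<Sum>n. ?D n x v)" for x v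
  have series: "((\<lambda>x. \<Sum>n. y n x) has_derivative S x) (at x)" if "x \<in> U" for x
  proof -
    have "\<exists>g. \<forall>x\<in>U. (\<lambda>n. y n x) sums g x \<and> (g has_derivative S x) (at x within U)"
    proof (rule has_derivative_series[OF U(2) _ _ that])
      show "(y n has_derivative ?D n x) (at x within U)" if "x \<in> U" for n x
        using Ck_family_has_derivative[OF Suc.prems _ that] by (auto intro: has_derivative_at_withinI)
      show "(\<lambda>n. y n x) sums (\<Sum>n. y n x)"
        using geometric_tail(1)[OF c[OF that] \<rho>] by (rule summable_sums)
      fix e :: real assume "e > 0"
      have "(\<lambda>n. real DIM('a) * C / (1 - \<rho>) * \<rho> ^ n) \<longlonglongrightarrow> real DIM('a) * C / (1 - \<rho>) * 0"
        using \<rho> by (intro tendsto_mult tendsto_const LIMSEQ_power_zero) auto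
      then have "\<forall>\<^sub>F n in sequentially. real DIM('a) * C / (1 - \<rho>) * \<rho> ^ n < e"
        using \<open>e > 0\<close> by (intro order_tendstoD) auto
      then show "\<forall>\<^sub>F n in sequentially. \<forall>x\<in>U. \<forall>h. norm ((\<Sum>i<n. ?D i x h) - S x h) \<le> e * norm h"
      proof eventually_elim
        case (elim n)
        show ?case
        proof (intro ballI allI)
          fix x h assume "x \<in> U"
          have "norm ((\<Sum>i<n. ?D i x h) - S x h) \<le> (real DIM('a) * C * norm h) / (1 - \<rho>) * \<rho> ^ n"
            unfolding S_def using geometric_tail(2)[OF C[OF \<open>x \<in> U\<close>] \<rho>] .
          also have "\<dots> = (real DIM('a) * C / (1 - \<rho>) * \<rho> ^ n) * norm h" by simp
          also have "\<dots> \<le> e * norm h" using elim by (intro mult_right_mono) auto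
          finally show "norm ((\<Sum>i<n. ?D i x h) - S x h) \<le> e * norm h" .
        qed
      qed
    qed
    then obtain g where g: "\<And>x. x \<in> U \<Longrightarrow> (\<lambda>n. y n x) sums g x"
      "\<And>x. x \<in> U \<Longrightarrow> (g has_derivative S x) (at x within U)" by blast
    have "(g has_derivative S x) (at x)"
      using g(2)[OF that] at_within_open[OF that U(1)] by simp
    then show ?thesis
      by (rule has_derivative_transform_within_open[OF _ U(1) that]) (simp add: sums_unique g(1))
  qed
  have "Ck_on k U (\<lambda>x. S x v)" for v
    unfolding S_def by (rule Suc.IH[OF Ck_family_derivative[OF Suc.prems]])
  then have "Ck_on k U (\<lambda>x. frechet_derivative (\<lambda>x. \<Sum>n. y n x) (at x) v)" for v
    by (rule Ck_on_cong[OF U(1)]) (simp add: frechet_derivative_at[OF series, symmetric])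
  then show ?case using series by (auto simp: differentiable_def)
qed

text \<open>Discrete counterpart of \<open>Ck_family_linear_ode\<close>: a directional derivative
  obeys the same recursion, with a source of weight \<open>\<rho> ^ n * 1\<close>. Differentiability
  is part of the hypothesis on \<open>y\<close>; what is gained is the bound, assumed at
  \<open>n = 0\<close> only.\<close>

lemma Ck_family_linear_recursion:
  fixes y :: "nat \<Rightarrow> 'a::euclidean_space \<Rightarrow> 'b::euclidean_space"
  assumes U: "open U" and \<rho>: "0 \<le> q" "q < \<rho>" "\<rho> \<le> 1"
    and contr: "\<And>n x z. x \<in> U \<Longrightarrow> norm (basis_comb (\<lambda>b. a b n x) z) \<le> q * norm z"
  shows "(\<And>b. b \<in> Basis \<Longrightarrow> Ck_family k UNIV UNIV (\<lambda>_. 1) U (a b)) \<Longrightarrow>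
    Ck_family k UNIV UNIV (\<lambda>n. \<rho> ^ n) U c \<Longrightarrow>
    Ck_family k UNIV {0} (\<lambda>_. 1) U y \<Longrightarrow>
    (\<And>n x. x \<in> U \<Longrightarrow> y (Suc n) x = basis_comb (\<lambda>b. a b n x) (y n x) + c n x) \<Longrightarrow>
    Ck_family k UNIV UNIV (\<lambda>n. \<rho> ^ n) U y"
proof (induction k arbitrary: y c)
  case 0
  obtain c1 where c1: "\<And>n x. x \<in> U \<Longrightarrow> norm (c n x) \<le> c1 * \<rho> ^ n"
    using Ck_family_bound[OF 0(2)] by (metis UNIV_I)
  obtain c0 where c0: "\<And>x. x \<in> U \<Longrightarrow> norm (y 0 x) \<le> c0"
    using Ck_family_bound[OF 0(3)] by (metis mult.right_neutral singletonI)
  \<comment> \<open>The step needs \<open>q * C + c1 \<le> \<rho> * C\<close>, that is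
    \<open>C \<ge> c1 / (\<rho> - q)\<close>; the bound \<open>c0\<close> covers
    \<open>n = 0\<close>.\<close>
  define C where "C = max c0 (c1 / (\<rho> - q))"
  have "norm (y n x) \<le> C * \<rho> ^ n" if x: "x \<in> U" for n x
  proof (induction n)
    case 0
    then show ?case using c0[OF x] by (simp add: C_def)
  next
    case (Suc n)
    have "norm (y (Suc n) x) \<le> q * norm (y n x) + c1 * \<rho> ^ n"
      unfolding "0.prems"(4)[OF x] by (intro norm_triangle_mono contr c1 x)
    also have "\<dots> \<le> q * (C * \<rho> ^ n) + (C * (\<rho> - q)) * \<rho> ^ n"
    proof (intro add_mono mult_left_mono mult_right_mono)
      have "c1 / (\<rho> - q) \<le> C" by (simp add: C_def)
      then show "c1 \<le> C * (\<rho> - q)" using \<rho> by (simp add: pos_divide_le_eq)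
    qed (use Suc \<rho> in auto)
    also have "\<dots> = C * \<rho> ^ Suc n" by (simp add: algebra_simps)
    finally show ?case .
  qed
  then show ?case using 0(3) by auto
next
  case (Suc k)
  note a = Suc.prems(1) and c = Suc.prems(2) and y = Suc.prems(3) and rec = Suc.prems(4)
  have yk: "Ck_family k UNIV UNIV (\<lambda>n. \<rho> ^ n) U y"
    by (rule Suc.IH[OF Ck_family_Suc_le[OF a] Ck_family_Suc_le[OF c] Ck_family_Suc_le[OF y] rec])
  have D: "Ck_family k UNIV UNIV (\<lambda>n. \<rho> ^ n) U (\<lambda>n x. frechet_derivative (y n) (at x) v)" for v
  proof (rule Suc.IH[OF Ck_family_Suc_le[OF a] _ Ck_family_derivative[OF y]])
    have "Ck_family k UNIV UNIV (\<lambda>n. \<rho> ^ n * 1) U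
        (\<lambda>n x. basis_comb (\<lambda>b. frechet_derivative (a b n) (at x) v) (y n x))"
      unfolding basis_comb_def using \<rho>
      by (intro Ck_family_inner_scale U yk Ck_family_derivative a) auto
    then show "Ck_family k UNIV UNIV (\<lambda>n. \<rho> ^ n) U
        (\<lambda>n x. basis_comb (\<lambda>b. frechet_derivative (a b n) (at x) v) (y n x)
          + frechet_derivative (c n) (at x) v)"
      using Ck_family_derivative[OF c] by (intro Ck_family_add U) auto
    fix n x assume x: "x \<in> U"
    have "((\<lambda>x. basis_comb (\<lambda>b. a b n x) (y n x) + c n x) has_derivative
      (\<lambda>v. (\<Sum>b\<in>Basis. (y n x \<bullet> b) *\<^sub>R frechet_derivative (a b n) (at x) v
          + (frechet_derivative (y n) (at x) v \<bullet> b) *\<^sub>R a b n x)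
        + frechet_derivative (c n) (at x) v)) (at x)"
      unfolding basis_comb_def using x a
      by (intro has_derivative_add has_derivative_sum has_derivative_scaleR has_derivative_inner_left
          Ck_family_has_derivative[OF c] Ck_family_has_derivative[OF y] Ck_family_has_derivative[OF a]) auto
    then have "(y (Suc n) has_derivative
      (\<lambda>v. (\<Sum>b\<in>Basis. (y n x \<bullet> b) *\<^sub>R frechet_derivative (a b n) (at x) v
          + (frechet_derivative (y n) (at x) v \<bullet> b) *\<^sub>R a b n x)
        + frechet_derivative (c n) (at x) v)) (at x)"
      by (rule has_derivative_transform_within_open[OF _ U x]) (simp add: rec)
    from frechet_derivative_at[OF this, symmetric]
    show "frechet_derivative (y (Suc n)) (at x) v =
      basis_comb (\<lambda>b. a b n x) (frechet_derivative (y n) (at x) v)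
      + (basis_comb (\<lambda>b. frechet_derivative (a b n) (at x) v) (y n x) + frechet_derivative (c n) (at x) v)"
      by (simp add: basis_comb_def sum.distrib)
  qed auto
  show ?case
    unfolding Ck_family_Suc using Ck_family_0[OF yk] D y[unfolded Ck_family_Suc] by auto
qed

text \<open>Order zero is the mean value inequality, which also makes the ball invariant. By the
  chain rule the derivative of \<open>X (Suc n)\<close> is that of \<open>P\<close> at
  \<open>X n x\<close> applied to that of \<open>X n\<close>: a recursion without source. Its
  coefficients are bounded up to order \<open>k\<close> as soon as \<open>X\<close> is, so decay at
  order \<open>k\<close> gives decay at order \<open>k + 1\<close>. The compact
  \<open>cball 0 \<delta>\<close> supplies the bounds on the derivatives of
  \<open>P\<close>.\<close>

lemma Ck_family_iterates:
  fixes P :: "'a::euclidean_space \<Rightarrow> 'a"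
  assumes \<Omega>: "open \<Omega>" "cball 0 \<delta> \<subseteq> \<Omega>" and \<rho>: "0 \<le> q" "q < \<rho>" "\<rho> \<le> 1"
    and P: "\<And>k. Ck_on k \<Omega> P" "P 0 = 0"
    and contr: "\<And>x z. x \<in> ball 0 \<delta> \<Longrightarrow> norm (frechet_derivative P (at x) z) \<le> q * norm z"
    and X: "\<And>k. Ck_family k UNIV {} (\<lambda>_. 1) (ball 0 \<delta>) X"
      "\<And>x. x \<in> ball 0 \<delta> \<Longrightarrow> X 0 x = x"
      "\<And>n x. x \<in> ball 0 \<delta> \<Longrightarrow> X (Suc n) x = P (X n x)"
  shows "Ck_family k UNIV UNIV (\<lambda>n. \<rho> ^ n) (ball 0 \<delta>) X"
    and "x \<in> ball 0 \<delta> \<Longrightarrow> X n x \<in> ball 0 \<delta>"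
proof -
  have sub: "ball 0 \<delta> \<subseteq> \<Omega>" using \<Omega>(2) ball_subset_cball by blast
  have Pdiff: "P differentiable (at x)" if "x \<in> ball 0 \<delta>" for x
    using P(1)[of 1] sub that by auto
  have Pbd: "norm (P x) \<le> q * norm x" if "x \<in> ball 0 \<delta>" for x
  proof -
    have "norm (P x - P 0) \<le> q * norm (x - 0)"
    proof (rule differentiable_bound[OF convex_ball])
      show "(P has_derivative frechet_derivative P (at z)) (at z within ball 0 \<delta>)"
        if "z \<in> ball 0 \<delta>" for z
        using Pdiff[OF that] by (simp add: frechet_derivative_works has_derivative_at_withinI)
      show "onorm (frechet_derivative P (at z)) \<le> q" if "z \<in> ball 0 \<delta>" for z
        using contr[OF that] by (rule onorm_le)
      have "\<delta> > 0" using that by (metis ball_eq_empty empty_iff not_le)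
      then show "0 \<in> ball 0 \<delta>" by simp
    qed (rule that)
    then show ?thesis using P(2) by simp
  qed
  have Xbd: "norm (X n x) \<le> q ^ n * norm x \<and> X n x \<in> ball 0 \<delta>" if x: "x \<in> ball 0 \<delta>" for n x
  proof (induction n)
    case 0
    then show ?case using x X(2) by simp
  next
    case (Suc n)
    have "norm (X (Suc n) x) \<le> q * norm (X n x)"
      using Suc Pbd X(3)[OF x] by simp
    also have "\<dots> \<le> q * (q ^ n * norm x)" using Suc \<rho> by (intro mult_left_mono) auto
    finally have *: "norm (X (Suc n) x) \<le> q ^ Suc n * norm x" by (simp add: mult_ac)
    also have "\<dots> \<le> 1 * norm x" using \<rho> by (intro mult_right_mono power_le_one) auto
    finally show ?case using x * by simp
  qed
  show "x \<in> ball 0 \<delta> \<Longrightarrow> X n x \<in> ball 0 \<delta>" using Xbd by blast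
  have base: "Ck_family 0 UNIV UNIV (\<lambda>n. \<rho> ^ n) (ball 0 \<delta>) X"
  proof -
    have "norm (X n x) \<le> \<delta> * \<rho> ^ n" if x: "x \<in> ball 0 \<delta>" for n x
    proof -
      have "norm (X n x) \<le> q ^ n * norm x" using Xbd[OF x] by blast
      also have "\<dots> \<le> \<rho> ^ n * \<delta>" using \<rho> x by (intro mult_mono power_mono) auto
      finally show ?thesis by (simp add: mult.commute)
    qed
    then show ?thesis using X(1)[of 0] unfolding Ck_family.simps(1) by blast
  qed
  show "Ck_family k UNIV UNIV (\<lambda>n. \<rho> ^ n) (ball 0 \<delta>) X"
  proof (induction k)
    case 0
    show ?case by (rule base)
  next
    case (Suc k)
    have X1: "Ck_family k UNIV UNIV (\<lambda>_. 1) (ball 0 \<delta>) X"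
      using Suc.IH by (rule Ck_family_weight_mono[rotated]) (use \<rho> in \<open>auto intro: power_le_one\<close>)
    have "Ck_family k UNIV UNIV (\<lambda>n. \<rho> ^ n) (ball 0 \<delta>) (\<lambda>n x. frechet_derivative (X n) (at x) v)" for v
    proof (rule Ck_family_linear_recursion[OF open_ball \<rho>, where
          a = "\<lambda>b n x. frechet_derivative P (at (X n x)) b" and c = "\<lambda>n x. 0"])
      show "norm (basis_comb (\<lambda>b. frechet_derivative P (at (X n x)) b) z) \<le> q * norm z"
        if "x \<in> ball 0 \<delta>" for n x z
        using contr[of "X n x" z] Xbd[OF that] frechet_derivative_basis_comb[OF Pdiff, of "X n x" z] by simp
      show "Ck_family k UNIV UNIV (\<lambda>_. 1) (ball 0 \<delta>) (\<lambda>n x. frechet_derivative P (at (X n x)) b)" for b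
        using P(1)[of "Suc k"] Xbd sub \<Omega> X1
        by (intro Ck_family_compose[where F = "\<lambda>x. frechet_derivative P (at x) b" and y = X
              and \<Omega> = \<Omega> and K = "cball 0 \<delta>"]) (auto simp: less_imp_le)
      have X0: "frechet_derivative (X 0) (at x) v = v" if "x \<in> ball 0 \<delta>" for x
        using fun_cong[OF frechet_derivative_cong_open[OF open_ball that, of "\<lambda>x. x" "X 0"], of v] X(2)
        by simp
      show "Ck_family k UNIV {0} (\<lambda>_. 1) (ball 0 \<delta>) (\<lambda>n x. frechet_derivative (X n) (at x) v)"
      proof (rule Ck_family_combine[OF Ck_family_derivative[OF X(1)]])
        show "Ck_family k {0} {0} (\<lambda>_. 1) (ball 0 \<delta>) (\<lambda>n x. frechet_derivative (X n) (at x) v)"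
          by (rule Ck_family_cong[OF open_ball subset_refl Ck_family_const[of _ _ _ _ _ v]]) (auto simp: X0)
      qed
      show "frechet_derivative (X (Suc n)) (at x) v = basis_comb (\<lambda>b. frechet_derivative P (at (X n x)) b)
          (frechet_derivative (X n) (at x) v) + 0" if x: "x \<in> ball 0 \<delta>" for n x
      proof -
        have "((\<lambda>x. P (X n x)) has_derivative (\<lambda>v. frechet_derivative P (at (X n x))
            (frechet_derivative (X n) (at x) v))) (at x)"
          using has_derivative_compose[OF Ck_family_has_derivative[OF X(1)[of "Suc 0"] UNIV_I x]]
            Pdiff[of "X n x"] Xbd[OF x] by (simp add: frechet_derivative_works)
        then have "(X (Suc n) has_derivative (\<lambda>v. frechet_derivative P (at (X n x))
            (frechet_derivative (X n) (at x) v))) (at x)"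
          by (rule has_derivative_transform_within_open[OF _ open_ball x]) (simp add: X(3))
        from frechet_derivative_at[OF this, symmetric] show ?thesis
          using frechet_derivative_basis_comb[OF Pdiff, of "X n x" "frechet_derivative (X n) (at x) v"]
            Xbd[OF x] by simp
      qed
    qed (rule Ck_family_zero)
    then show ?case
      unfolding Ck_family_Suc using base X(1)[of "Suc 0"] by (auto simp: Ck_family_Suc)
  qed
qed

text \<open>At order zero, \<open>w 0 = 0\<close> gives \<open>norm (w x) \<le> L * norm x\<close>,
  so \<open>w\<close> inherits the decay of \<open>X\<close>. In the derivatives the chain rule
  supplies a factor from the derivative of \<open>X\<close>, which decays by itself.\<close>

lemma Ck_family_compose_vanishing:
  fixes w :: "'a::euclidean_space \<Rightarrow> 'b::real_normed_vector" and X :: "nat \<Rightarrow> 'a \<Rightarrow> 'a"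
  assumes \<Omega>: "open \<Omega>" "cball 0 \<delta> \<subseteq> \<Omega>" and \<rho>: "0 \<le> \<rho>" "\<rho> \<le> 1"
    and w: "\<And>k. Ck_on k \<Omega> w" "w 0 = 0"
    and X: "\<And>k. Ck_family k UNIV UNIV (\<lambda>n. \<rho> ^ n) (ball 0 \<delta>) X"
      "\<And>n x. x \<in> ball 0 \<delta> \<Longrightarrow> X n x \<in> ball 0 \<delta>"
  shows "Ck_family k UNIV UNIV (\<lambda>n. \<rho> ^ n) (ball 0 \<delta>) (\<lambda>n x. w (X n x))"
proof -
  have sub: "ball 0 \<delta> \<subseteq> \<Omega>" using \<Omega>(2) ball_subset_cball by blast
  have wdiff: "w differentiable (at x)" if "x \<in> ball 0 \<delta>" for x
    using w(1)[of 1] sub that by auto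
  have X1: "Ck_family k UNIV UNIV (\<lambda>_. 1) (ball 0 \<delta>) X" for k
    using X(1) by (rule Ck_family_weight_mono[rotated]) (use \<rho> in \<open>auto intro: power_le_one\<close>)
  have comp: "Ck_family k UNIV UNIV (\<lambda>_. 1) (ball 0 \<delta>) (\<lambda>n x. f (X n x))"
    if "Ck_on k \<Omega> f" for f :: "'a \<Rightarrow> 'b" and k
    using that X(2) sub \<Omega> X1
    by (intro Ck_family_compose[where F = f and y = X and \<Omega> = \<Omega> and K = "cball 0 \<delta>"]) (auto simp: less_imp_le)
  have "\<exists>c. \<forall>x\<in>cball 0 \<delta>. norm (frechet_derivative w (at x) b) \<le> c" for b
  proof -
    have "continuous_on \<Omega> (\<lambda>x. frechet_derivative w (at x) b)" using w(1)[of 1] by simp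
    then have "compact ((\<lambda>x. frechet_derivative w (at x) b) ` cball 0 \<delta>)"
      using \<Omega>(2) continuous_on_subset by (intro compact_continuous_image) auto
    then show ?thesis using compact_imp_bounded by (fastforce simp: bounded_iff)
  qed
  then obtain c where c: "\<And>b x. x \<in> cball 0 \<delta> \<Longrightarrow> norm (frechet_derivative w (at x) b) \<le> c b"
    by metis
  define L where "L = real DIM('a) * (\<Sum>b\<in>Basis. \<bar>c b\<bar>)"
  have L: "norm (frechet_derivative w (at x) v) \<le> L * norm v" if "x \<in> ball 0 \<delta>" for x v
    unfolding frechet_derivative_basis_comb[OF wdiff[OF that], of v] L_def
  proof (rule norm_basis_comb_le)
    fix b :: 'a assume "b \<in> Basis"
    then show "norm (frechet_derivative w (at x) b) \<le> (\<Sum>b\<in>Basis. \<bar>c b\<bar>)"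
      using c[of x b] that member_le_sum[of b Basis "\<lambda>b. \<bar>c b\<bar>"] by force
  qed
  have wbd: "norm (w x) \<le> L * norm x" if "x \<in> ball 0 \<delta>" for x
  proof -
    have "norm (w x - w 0) \<le> L * norm (x - 0)"
    proof (rule differentiable_bound[OF convex_ball])
      show "(w has_derivative frechet_derivative w (at z)) (at z within ball 0 \<delta>)"
        if "z \<in> ball 0 \<delta>" for z
        using wdiff[OF that] by (simp add: frechet_derivative_works has_derivative_at_withinI)
      show "onorm (frechet_derivative w (at z)) \<le> L" if "z \<in> ball 0 \<delta>" for z
        using L[OF that] by (rule onorm_le)
      have "\<delta> > 0" using that by (metis ball_eq_empty empty_iff not_le)
      then show "0 \<in> ball 0 \<delta>" by simp
    qed (rule that)
    then show ?thesis using w(2) by simp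
  qed
  have L0: "L \<ge> 0" by (simp add: L_def sum_nonneg)
  have base: "Ck_family 0 UNIV UNIV (\<lambda>n. \<rho> ^ n) (ball 0 \<delta>) (\<lambda>n x. w (X n x))"
  proof -
    obtain d where d: "\<And>n x. x \<in> ball 0 \<delta> \<Longrightarrow> norm (X n x) \<le> d * \<rho> ^ n"
      using Ck_family_bound[OF X(1)[of 0]] by (metis UNIV_I)
    have "norm (w (X n x)) \<le> (L * d) * \<rho> ^ n" if "x \<in> ball 0 \<delta>" for n x
      using order_trans[OF wbd[OF X(2)[OF that]] mult_left_mono[OF d[OF that] L0]] by (simp add: mult_ac)
    then show ?thesis
      using Ck_family_continuous[OF comp[OF w(1)[of 0]]] unfolding Ck_family.simps(1) by blast
  qed
  show ?thesis
  proof (cases k)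
    case (Suc j)
    have "Ck_family j UNIV UNIV (\<lambda>n. \<rho> ^ n) (ball 0 \<delta>) (\<lambda>n x. frechet_derivative (\<lambda>x. w (X n x)) (at x) v)" for v
    proof (rule Ck_family_cong[OF open_ball subset_refl])
      show "Ck_family j UNIV UNIV (\<lambda>n. \<rho> ^ n) (ball 0 \<delta>) (\<lambda>n x. \<Sum>b\<in>Basis.
          (frechet_derivative (X n) (at x) v \<bullet> b) *\<^sub>R frechet_derivative w (at (X n x)) b)"
      proof -
        have "Ck_family j UNIV UNIV (\<lambda>n. \<rho> ^ n * 1) (ball 0 \<delta>) (\<lambda>n x. \<Sum>b\<in>Basis.
          (frechet_derivative (X n) (at x) v \<bullet> b) *\<^sub>R frechet_derivative w (at (X n x)) b)"
          using \<rho>(1) w(1)[of "Suc j"]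
          by (intro Ck_family_inner_scale Ck_family_derivative X comp) auto
        then show ?thesis by simp
      qed
      fix n x assume x: "x \<in> ball (0::'a) \<delta>"
      have "((\<lambda>x. w (X n x)) has_derivative (\<lambda>v. frechet_derivative w (at (X n x))
            (frechet_derivative (X n) (at x) v))) (at x)"
        using has_derivative_compose[OF Ck_family_has_derivative[OF X(1)[of "Suc 0"] UNIV_I x]]
            wdiff[OF X(2)[OF x, of n]] by (simp add: frechet_derivative_works)
      from frechet_derivative_at[OF this, symmetric]
      show "(\<Sum>b\<in>Basis. (frechet_derivative (X n) (at x) v \<bullet> b) *\<^sub>R frechet_derivative w (at (X n x)) b)
          = frechet_derivative (\<lambda>x. w (X n x)) (at x) v"
        using frechet_derivative_expand[OF wdiff[OF X(2)[OF x, of n]],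
            of "frechet_derivative (X n) (at x) v"] by simp
    qed
    then show ?thesis
      using Suc base comp[OF w(1)[of "Suc j"]] unfolding Suc Ck_family_Suc by auto
  qed (use base in simp)
qed

section \<open>The cost of an exponentially stable semiflow\<close>

lemma Ck_on_local:
  "(\<And>x. x \<in> S \<Longrightarrow> \<exists>N. open N \<and> x \<in> N \<and> Ck_on k N f) \<Longrightarrow> Ck_on k S f"
proof (induction k arbitrary: f)
  case 0
  have "isCont f x" if x: "x \<in> S" for x
    using 0[OF x] by (auto simp: continuous_on_eq_continuous_at)
  then show ?case by (simp add: continuous_at_imp_continuous_on)
next
  case (Suc k)
  have "f differentiable (at x)" if "x \<in> S" for x
    using Suc.prems[OF that] by auto
  moreover have "Ck_on k S (\<lambda>x. frechet_derivative f (at x) v)" for v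
    using Suc.prems by (intro Suc.IH) (metis Ck_on.simps(2))
  ultimately show ?case by simp
qed

locale stable_semiflow = smooth_semiflow \<Omega> F \<phi>
  for \<Omega> :: "'a::euclidean_space set" and F :: "'a \<Rightarrow> 'a" and \<phi> :: "real \<Rightarrow> 'a \<Rightarrow> 'a" +
  fixes r :: "'a \<Rightarrow> real" and \<epsilon> C \<nu> :: real
  assumes zero_dom: "0 \<in> \<Omega>"
    and cost_smooth: "smooth_on \<Omega> r" and cost_zero: "r 0 = 0"
    and cost_nonneg: "x \<in> \<Omega> \<Longrightarrow> 0 \<le> r x"
    and attracted: "x \<in> \<Omega> \<Longrightarrow> ((\<lambda>t. norm (\<phi> t x)) \<longlongrightarrow> 0) at_top"
    and rates: "\<epsilon> > 0" "C > 0" "\<nu> > 0" "ball 0 \<epsilon> \<subseteq> \<Omega>"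
    and decay: "x \<in> ball 0 \<epsilon> \<Longrightarrow> 0 \<le> t \<Longrightarrow> norm (\<phi> t x) \<le> C * exp (- \<nu> * t) * norm x"
begin

lemma cost_Ck: "Ck_on k \<Omega> r"
  using cost_smooth by (simp add: smooth_on_def)

text \<open>At \<open>x = 0\<close> the decay estimate has right-hand side 0.\<close>

lemma flow_zero: "0 \<le> t \<Longrightarrow> \<phi> t 0 = 0"
  using decay[of 0 t] rates by simp

lemma flow_time_Ck:
  assumes "0 \<le> T"
  shows "Ck_on k \<Omega> (\<phi> T)"
  using Ck_family_at[OF flow_Ck] assms by simp

lemma contraction_time:
  obtains T \<delta> where "T > 0" "\<delta> > 0" "cball 0 \<delta> \<subseteq> \<Omega>"
    "\<And>x z. x \<in> ball 0 \<delta> \<Longrightarrow> norm (frechet_derivative (\<phi> T) (at x) z) \<le> (1 / 2) * norm z"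
proof -
  \<comment> \<open>This gives \<open>C * exp (- \<nu> * T) = C / (4 * C + 4) \<le> 1 / 4\<close>;
    the argument of \<open>ln\<close> exceeds 1, so \<open>T > 0\<close>.\<close>
  define T where "T = ln (4 * C + 4) / \<nu>"
  have T: "T > 0" using rates by (simp add: T_def)
  have *: "exp (- \<nu> * T) = 1 / (4 * C + 4)"
    using rates by (simp add: T_def exp_minus inverse_eq_divide)
  have "C * exp (- \<nu> * T) \<le> 1 / 4"
    unfolding * using rates by (simp add: pos_divide_le_eq)
  then have quarter: "norm (\<phi> T x) \<le> (1 / 4) * norm x" if "x \<in> ball 0 \<epsilon>" for x
    using decay[OF that, of T] T mult_right_mono[of "C * exp (- \<nu> * T)" "1 / 4" "norm x"] by simp
  let ?D = "\<lambda>x. frechet_derivative (\<phi> T) (at x)"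
  have diff: "\<phi> T differentiable (at x)" if "x \<in> \<Omega>" for x
    using flow_derivative(1)[OF that] T by simp
  \<comment> \<open>Since \<open>\<phi> T 0 = 0\<close>, the difference quotients at the origin
    inherit the factor \<open>1 / 4\<close> from \<open>quarter\<close>.\<close>
  have D0: "norm (?D 0 z) \<le> (1 / 4) * norm z" for z
  proof -
    define s where "s n = 1 / real (Suc n)" for n
    have s: "s n > 0" for n by (simp add: s_def)
    have s0: "s \<longlonglongrightarrow> 0" unfolding s_def by (rule LIMSEQ_Suc[OF lim_const_over_n])
    have lim: "(\<lambda>n. (1 / s n) *\<^sub>R (\<phi> T (0 + s n *\<^sub>R z) - \<phi> T 0)) \<longlonglongrightarrow> ?D 0 z"
      using directional_quotients_tendsto[OF _ s s0] diff[OF zero_dom] frechet_derivative_works by blast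
    have "(\<lambda>n. s n * norm z) \<longlonglongrightarrow> 0 * norm z"
      by (intro tendsto_mult s0 tendsto_const)
    then have "\<forall>\<^sub>F n in sequentially. s n * norm z < \<epsilon>"
      using rates(1) by (intro order_tendstoD) auto
    then have "\<forall>\<^sub>F n in sequentially. norm ((1 / s n) *\<^sub>R (\<phi> T (0 + s n *\<^sub>R z) - \<phi> T 0)) \<le> (1 / 4) * norm z"
    proof eventually_elim
      case (elim n)
      then have "norm (\<phi> T (s n *\<^sub>R z)) \<le> (1 / 4) * norm (s n *\<^sub>R z)"
        using s[of n] by (intro quarter) simp
      then show ?case
        using s[of n] flow_zero[of T] T by (simp add: divide_le_eq mult_ac)
    qed
    then show ?thesis
      by (rule Lim_norm_ubound[OF sequentially_bot lim])
  qed
  \<comment> \<open>A majorant of the operator norm of \<open>?D x - ?D 0\<close> whose continuity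
    can be read off the directional derivatives. Below \<open>1 / 4\<close> it leaves
    \<open>1 / 4 + 1 / 4 = 1 / 2\<close>.\<close>
  define M where "M x = (\<Sum>b\<in>Basis. norm (?D x b - ?D 0 b))" for x
  have "continuous_on \<Omega> M"
    unfolding M_def using flow_time_Ck[of T 1] T
    by (intro continuous_on_sum continuous_on_norm continuous_on_diff continuous_on_const) auto
  moreover have "M 0 = 0" by (simp add: M_def)
  ultimately obtain d where d: "d > 0" "\<And>x. x \<in> \<Omega> \<Longrightarrow> dist x 0 < d \<Longrightarrow> dist (M x) 0 < 1 / 4"
    using zero_dom unfolding continuous_on_iff by (metis zero_less_divide_1_iff zero_less_numeral)
  \<comment> \<open>Half of \<open>\<epsilon>\<close>, so that the closed ball still lies in the
    open ball contained in \<open>\<Omega>\<close>.\<close>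
  define \<delta> where "\<delta> = min d (\<epsilon> / 2)"
  have \<delta>: "\<delta> > 0" using d rates by (simp add: \<delta>_def)
  have sub: "cball 0 \<delta> \<subseteq> \<Omega>"
    using rates(1,4) by (auto simp: \<delta>_def subset_eq)
  have "norm (?D x z) \<le> (1 / 2) * norm z" if x: "x \<in> ball 0 \<delta>" for x z
  proof -
    have x\<Omega>: "x \<in> \<Omega>" using x sub by (auto simp: subset_eq)
    have "M x < 1 / 4" using d(2)[OF x\<Omega>] x by (simp add: \<delta>_def dist_real_def)
    have "?D x z - ?D 0 z = basis_comb (\<lambda>b. ?D x b - ?D 0 b) z"
      using frechet_derivative_basis_comb[OF diff[OF x\<Omega>], of z]
        frechet_derivative_basis_comb[OF diff[OF zero_dom], of z] by (simp add: basis_comb_diff_left)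
    also have "norm \<dots> \<le> (\<Sum>b\<in>Basis. norm z * norm (?D x b - ?D 0 b))"
      unfolding basis_comb_def
      by (intro sum_norm_le) (auto intro!: mult_right_mono Basis_le_norm)
    also have "\<dots> = norm z * M x" by (simp add: M_def sum_distrib_left)
    also have "\<dots> \<le> norm z * (1 / 4)" using \<open>M x < 1 / 4\<close> by (intro mult_left_mono) auto
    finally have "norm (?D x z) \<le> norm (?D 0 z) + norm z * (1 / 4)"
      using norm_triangle_sub[of "?D x z" "?D 0 z"] by linarith
    then show ?thesis using D0[of z] by linarith
  qed
  then show ?thesis using that T \<delta> sub by blast
qed

section \<open>Cost over finite and infinite horizons\<close>

definition partial_cost :: "real \<Rightarrow> 'a \<Rightarrow> real" where
  "partial_cost t x = integral {0..t} (\<lambda>s. r (\<phi> s x))"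

definition total_cost :: "'a \<Rightarrow> real" where
  "total_cost x = integral {0..} (\<lambda>s. r (\<phi> s x))"

lemma cost_continuous: "x \<in> \<Omega> \<Longrightarrow> continuous_on {0..} (\<lambda>t. r (\<phi> t x))"
  using stays by (intro continuous_on_compose2[OF Ck_on_continuous[OF cost_Ck[of 0]] flow_continuous_time]) auto

lemma partial_cost_has_integral:
  assumes "x \<in> \<Omega>"
  shows "((\<lambda>s. r (\<phi> s x)) has_integral partial_cost t x) {0..t}"
  unfolding partial_cost_def
  by (intro integrable_integral integrable_continuous_real continuous_on_subset[OF cost_continuous[OF assms]]) auto

lemma partial_cost_derivative:
  assumes "x \<in> \<Omega>" "0 \<le> t"
  shows "((\<lambda>t. partial_cost t x) has_vector_derivative r (\<phi> t x)) (at t within {0..})"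
proof (rule has_vector_derivative_within_atLeast)
  fix T assume "t \<le> T"
  have "continuous_on {0..T} (\<lambda>s. r (\<phi> s x))"
    using cost_continuous[OF assms(1)] by (rule continuous_on_subset) auto
  then show "((\<lambda>t. partial_cost t x) has_vector_derivative r (\<phi> t x)) (at t within {0..T})"
    unfolding partial_cost_def using assms(2) \<open>t \<le> T\<close> by (intro integral_has_vector_derivative) auto
qed

lemma partial_cost_0 [simp]: "partial_cost 0 x = 0"
  by (simp add: partial_cost_def)

lemma partial_cost_Ck: "Ck_family k {0..} {} (\<lambda>_. 1) \<Omega> partial_cost"
  by (rule flow_integral_Ck[OF cost_Ck partial_cost_derivative]) auto

lemma partial_cost_time_Ck:
  assumes "0 \<le> T"
  shows "Ck_on k \<Omega> (partial_cost T)"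
  using Ck_family_at[OF partial_cost_Ck] assms by simp

lemma partial_cost_nonneg:
  assumes "x \<in> \<Omega>"
  shows "0 \<le> partial_cost t x"
  by (rule has_integral_nonneg[OF partial_cost_has_integral[OF assms]])
    (simp add: stays cost_nonneg assms)

lemma partial_cost_add:
  assumes x: "x \<in> \<Omega>" and s: "0 \<le> s" and t: "0 \<le> t"
  shows "partial_cost (s + t) x = partial_cost s x + partial_cost t (\<phi> s x)"
proof -
  have "((\<lambda>q. r (\<phi> q (\<phi> s x))) has_integral partial_cost (s + t) x - partial_cost (s + 0) x) {0..t}"
  proof (rule fundamental_theorem_of_calculus[OF t])
    fix q assume q: "q \<in> {0..t}"
    have "((\<lambda>t. partial_cost (s + t) x) has_vector_derivative r (\<phi> (s + q) x)) (at q within {0..})"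
      using q s by (intro has_vector_derivative_time_shift partial_cost_derivative x) auto
    then show "((\<lambda>t. partial_cost (s + t) x) has_vector_derivative r (\<phi> q (\<phi> s x))) (at q within {0..t})"
      using q by (intro has_vector_derivative_atLeast_Icc) (simp add: flow_add[OF x s])
  qed
  then show ?thesis
    using has_integral_unique[OF _ partial_cost_has_integral[OF stays[OF x s], of t]] by fastforce
qed

text \<open>One tail function \<open>W\<close> serves all starting points and all times
  \<open>s\<close> at which the trajectory is in the ball. So a single \<open>s\<close> can be used
  on a neighbourhood (\<open>total_cost_Ck\<close>), and expansions of the cost from two points of
  one trajectory can be compared (\<open>total_cost_split\<close>). Existence and value of the
  improper integral come together from monotone convergence, the cost being nonnegative.\<close>

lemma total_cost_near_zero:
  obtains \<delta> W where "\<delta> > 0" "ball 0 \<delta> \<subseteq> \<Omega>" "\<And>k. Ck_on k (ball 0 \<delta>) W"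
    "\<And>x s. x \<in> \<Omega> \<Longrightarrow> 0 \<le> s \<Longrightarrow> \<phi> s x \<in> ball 0 \<delta> \<Longrightarrow>
      ((\<lambda>t. r (\<phi> t x)) has_integral partial_cost s x + W (\<phi> s x)) {0..}"
proof -
  obtain T \<delta> where T: "T > 0" and \<delta>: "\<delta> > 0" "cball 0 \<delta> \<subseteq> \<Omega>"
    and contr: "\<And>x z. x \<in> ball 0 \<delta> \<Longrightarrow> norm (frechet_derivative (\<phi> T) (at x) z) \<le> (1 / 2) * norm z"
    using contraction_time by metis
  have sub: "ball 0 \<delta> \<subseteq> \<Omega>" using \<delta>(2) ball_subset_cball by blast
  define X where "X n x = \<phi> (real n * T) x" for n x
  define w where "w = partial_cost T"
  have XS: "X (Suc n) x = \<phi> T (X n x)" if "x \<in> \<Omega>" for n x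
    using flow_add[OF that, of "real n * T" T] T by (simp add: X_def algebra_simps)
  have X_Ck: "Ck_family k UNIV {} (\<lambda>_. 1) (ball 0 \<delta>) X" for k
    unfolding X_def using T
    by (intro Ck_family_reindex[OF _ _ Ck_family_subset[OF subset_refl subset_refl sub flow_Ck]]
        continuous_intros) auto
  \<comment> \<open>The rate \<open>3 / 4\<close> stands for any number strictly between the
    contraction factor \<open>1 / 2\<close> and 1.\<close>
  have X_geo: "Ck_family k UNIV UNIV (\<lambda>n. (3 / 4) ^ n) (ball 0 \<delta>) X" for k
    by (rule Ck_family_iterates[OF open_dom \<delta>(2) _ _ _ flow_time_Ck flow_zero contr X_Ck])
      (use T sub XS in \<open>auto simp: X_def start subset_eq\<close>)
  have X_in: "X n x \<in> ball 0 \<delta>" if "x \<in> ball 0 \<delta>" for n x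
    by (rule Ck_family_iterates(2)[OF open_dom \<delta>(2) _ _ _ flow_time_Ck flow_zero contr X_Ck, of "3 / 4"])
      (use T sub XS that in \<open>auto simp: X_def start subset_eq\<close>)
  have w0: "w 0 = 0"
  proof -
    have "((\<lambda>s. r (\<phi> s 0)) has_integral 0) {0..T}"
      by (rule has_integral_is_0) (simp add: flow_zero cost_zero)
    then show ?thesis unfolding w_def partial_cost_def by (rule integral_unique)
  qed
  have wX: "Ck_family k UNIV UNIV (\<lambda>n. (3 / 4) ^ n) (ball 0 \<delta>) (\<lambda>n x. w (X n x))" for k
    by (rule Ck_family_compose_vanishing[where w = w, OF open_dom \<delta>(2) _ _ _ w0 X_geo X_in])
      (use T in \<open>auto simp: w_def intro!: partial_cost_time_Ck\<close>)
  define W where "W x = (\<Sum>n. w (X n x))" for x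
  have W_Ck: "Ck_on k (ball 0 \<delta>) W" for k
    unfolding W_def by (rule Ck_on_suminf[OF open_ball convex_ball _ _ wX]) auto
  have Wlim: "(\<lambda>n. partial_cost (real n * T) x) \<longlonglongrightarrow> W x" if x: "x \<in> ball 0 \<delta>" for x
  proof -
    have x\<Omega>: "x \<in> \<Omega>" using x sub by auto
    have "partial_cost (real n * T) x = (\<Sum>i<n. w (X i x))" for n
    proof (induction n)
      case (Suc n)
      \<comment> \<open>The summand \<open>w (X i x)\<close> is the cost over the time window from
        \<open>i * T\<close> to \<open>(i + 1) * T\<close>.\<close>
      have "partial_cost (real n * T + T) x = partial_cost (real n * T) x + w (X n x)"
        using partial_cost_add[OF x\<Omega>, of "real n * T" T] T by (simp add: w_def X_def)
      then show ?case using Suc by (simp add: algebra_simps)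
    qed simp
    moreover obtain c where "\<And>n. norm (w (X n x)) \<le> c * (3 / 4) ^ n"
      using Ck_family_bound[OF wX[of 0]] x by (metis UNIV_I)
    then have "summable (\<lambda>n. w (X n x))" by (rule geometric_tail(1)) auto
    ultimately show ?thesis unfolding W_def by (simp add: summable_LIMSEQ)
  qed
  have "((\<lambda>t. r (\<phi> t x)) has_integral partial_cost s x + W (\<phi> s x)) {0..}"
    if x: "x \<in> \<Omega>" and s: "0 \<le> s" and xs: "\<phi> s x \<in> ball 0 \<delta>" for x s
  proof (rule has_integral_monotone_convergence_increasing)
    \<comment> \<open>Truncating at \<open>s + n * T\<close> makes the integrals equal to
      \<open>partial_cost s x\<close> plus the partial sums of
      \<open>W (\<phi> s x)\<close>.\<close>
    let ?I = "\<lambda>n. {0..s + real n * T}"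
    show "((\<lambda>t. if t \<in> ?I n then r (\<phi> t x) else 0) has_integral partial_cost (s + real n * T) x) {0..}" for n
      using partial_cost_has_integral[OF x] by (subst has_integral_restrict) auto
    show "(if t \<in> ?I n then r (\<phi> t x) else 0) \<le> (if t \<in> ?I (Suc n) then r (\<phi> t x) else 0)"
      if "t \<in> {0..}" for n t
      using that T cost_nonneg stays[OF x] by (auto simp: algebra_simps)
    show "(\<lambda>n. if t \<in> ?I n then r (\<phi> t x) else 0) \<longlonglongrightarrow> r (\<phi> t x)" if "t \<in> {0..}" for t
    proof (rule tendsto_eventually)
      obtain N where "t / T < real N" using reals_Archimedean2 by blast
      then have N: "t < real N * T" using T by (simp add: pos_divide_less_eq)
      have "t \<in> ?I n" if "n \<ge> N" for n
      proof -
        have "real N * T \<le> real n * T" using that T by (intro mult_right_mono) auto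
        then show ?thesis using N s \<open>t \<in> {0..}\<close> by auto
      qed
      then show "\<forall>\<^sub>F n in sequentially. (if t \<in> ?I n then r (\<phi> t x) else 0) = r (\<phi> t x)"
        unfolding eventually_sequentially by auto
    qed
    have "(\<lambda>n. partial_cost s x + partial_cost (real n * T) (\<phi> s x)) \<longlonglongrightarrow> partial_cost s x + W (\<phi> s x)"
      by (intro tendsto_add tendsto_const Wlim xs)
    then show "(\<lambda>n. partial_cost (s + real n * T) x) \<longlonglongrightarrow> partial_cost s x + W (\<phi> s x)"
      using partial_cost_add[OF x s] T by simp
  qed
  then show ?thesis using that \<delta>(1) sub W_Ck by blast
qed

lemma reaches_ball:
  assumes "x \<in> \<Omega>" "\<delta> > 0"
  obtains s where "0 \<le> s" "\<phi> s x \<in> ball 0 \<delta>"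
proof -
  have "\<forall>\<^sub>F t in at_top. norm (\<phi> t x) < \<delta>"
    using order_tendstoD(2)[OF attracted[OF assms(1)] assms(2)] .
  then have "\<forall>\<^sub>F t in at_top. norm (\<phi> t x) < \<delta> \<and> 0 \<le> t"
    using eventually_ge_at_top eventually_conj by blast
  then show ?thesis
    using that by (auto dest!: eventually_happens'[rotated])
qed

lemma total_cost_has_integral:
  assumes "x \<in> \<Omega>"
  shows "((\<lambda>t. r (\<phi> t x)) has_integral total_cost x) {0..}"
proof -
  obtain \<delta> W where *: "\<delta> > 0"
    "\<And>x s. x \<in> \<Omega> \<Longrightarrow> 0 \<le> s \<Longrightarrow> \<phi> s x \<in> ball 0 \<delta> \<Longrightarrow>
      ((\<lambda>t. r (\<phi> t x)) has_integral partial_cost s x + W (\<phi> s x)) {0..}"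
    using total_cost_near_zero by metis
  obtain s where "0 \<le> s" "\<phi> s x \<in> ball 0 \<delta>" using reaches_ball[OF assms *(1)] .
  with *(2)[OF assms] show ?thesis
    unfolding total_cost_def by (metis integrable_integral integrable_on_def)
qed

lemma total_cost_Ck: "Ck_on k \<Omega> total_cost"
proof -
  obtain \<delta> W where *: "\<delta> > 0" "ball 0 \<delta> \<subseteq> \<Omega>" "\<And>k. Ck_on k (ball 0 \<delta>) W"
    "\<And>x s. x \<in> \<Omega> \<Longrightarrow> 0 \<le> s \<Longrightarrow> \<phi> s x \<in> ball 0 \<delta> \<Longrightarrow>
      ((\<lambda>t. r (\<phi> t x)) has_integral partial_cost s x + W (\<phi> s x)) {0..}"
    using total_cost_near_zero by metis
  show ?thesis
  proof (rule Ck_on_local)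
    fix x0 assume x0: "x0 \<in> \<Omega>"
    obtain s where s: "0 \<le> s" "\<phi> s x0 \<in> ball 0 \<delta>" using reaches_ball[OF x0 *(1)] .
    \<comment> \<open>The time \<open>s\<close> was found for \<open>x0\<close> and is kept on all
      of \<open>N\<close>; continuity of \<open>\<phi> s\<close> makes \<open>N\<close>
      open.\<close>
    define N where "N = {x \<in> \<Omega>. \<phi> s x \<in> ball 0 \<delta>}"
    have "N = \<Omega> \<inter> \<phi> s -` ball 0 \<delta>" by (auto simp: N_def)
    then have N: "open N" "N \<subseteq> \<Omega>"
      using continuous_open_preimage[OF Ck_on_continuous[OF flow_time_Ck[OF s(1), of 0]] open_dom open_ball]
      by auto
    note sub = Ck_family_subset[OF subset_refl subset_refl N(2), of k "{0::real}" "{}" "\<lambda>_. 1"]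
    have "Ck_family k {0::real} {} (\<lambda>_. 1) N (\<lambda>_ x. W (\<phi> s x))"
      using *(3) sub[OF flow_time_Ck[OF s(1), unfolded Ck_on_iff_Ck_family[where W = "\<lambda>_. 1"]]] N
      by (intro Ck_family_compose[where \<Omega> = "ball 0 \<delta>" and K = "{}" and F = W and y = "\<lambda>_. \<phi> s"])
        (auto simp: N_def)
    then have "Ck_family k {0::real} {} (\<lambda>_. 1) N (\<lambda>_ x. partial_cost s x + W (\<phi> s x))"
      using sub[OF partial_cost_time_Ck[OF s(1), unfolded Ck_on_iff_Ck_family[where W = "\<lambda>_. 1"]]]
      by (intro Ck_family_add N) auto
    then have "Ck_on k N (\<lambda>x. partial_cost s x + W (\<phi> s x))"
      unfolding Ck_on_iff_Ck_family[where W = "\<lambda>_. 1"] .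
    then have "Ck_on k N total_cost"
    proof (rule Ck_on_cong[OF N(1)])
      fix x assume "x \<in> N"
      then have "((\<lambda>t. r (\<phi> t x)) has_integral partial_cost s x + W (\<phi> s x)) {0..}"
        using s by (intro *(4)) (auto simp: N_def)
      then show "partial_cost s x + W (\<phi> s x) = total_cost x"
        unfolding total_cost_def by (simp add: integral_unique)
    qed
    then show "\<exists>N. open N \<and> x0 \<in> N \<and> Ck_on k N total_cost"
      using x0 s N(1) by (auto simp: N_def)
  qed
qed

section \<open>Dynamic programming and the generalized Hamilton-Jacobi-Bellman equation\<close>

text \<open>Bellman's principle. At a time \<open>t + s\<close> when the trajectory is near the
  origin, both total costs are a partial cost plus the same tail
  \<open>W (\<phi> (t + s) x)\<close>.\<close>

lemma total_cost_split:
  assumes x: "x \<in> \<Omega>" and t: "0 \<le> t"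
  shows "total_cost x = partial_cost t x + total_cost (\<phi> t x)"
proof -
  obtain \<delta> W where *: "\<delta> > 0"
    "\<And>x s. x \<in> \<Omega> \<Longrightarrow> 0 \<le> s \<Longrightarrow> \<phi> s x \<in> ball 0 \<delta> \<Longrightarrow>
      ((\<lambda>t. r (\<phi> t x)) has_integral partial_cost s x + W (\<phi> s x)) {0..}"
    using total_cost_near_zero by metis
  obtain s where s: "0 \<le> s" "\<phi> s (\<phi> t x) \<in> ball 0 \<delta>" using reaches_ball[OF stays[OF x t] *(1)] .
  have "total_cost (\<phi> t x) = partial_cost s (\<phi> t x) + W (\<phi> s (\<phi> t x))"
    unfolding total_cost_def by (intro integral_unique *(2) stays x t s)
  moreover have "total_cost x = partial_cost (t + s) x + W (\<phi> (t + s) x)"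
    unfolding total_cost_def using s flow_add[OF x t s(1)] t by (intro integral_unique *(2) x) auto
  ultimately show ?thesis using partial_cost_add[OF x t s(1)] flow_add[OF x t s(1)] by simp
qed

lemma total_cost_nonneg:
  assumes "x \<in> \<Omega>"
  shows "0 \<le> total_cost x"
  by (rule has_integral_nonneg[OF total_cost_has_integral[OF assms]])
    (simp add: stays cost_nonneg assms)

lemma total_cost_zero: "total_cost 0 = 0"
proof -
  have "((\<lambda>s. r (\<phi> s 0)) has_integral 0) {0..}"
    by (rule has_integral_is_0) (simp add: flow_zero cost_zero)
  then show ?thesis unfolding total_cost_def by (rule integral_unique)
qed

lemma derivative_along_flow:
  fixes v :: "'a \<Rightarrow> real"
  assumes "x \<in> \<Omega>" "0 \<le> t" "v differentiable (at (\<phi> t x))"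
  shows "((\<lambda>t. v (\<phi> t x)) has_vector_derivative frechet_derivative v (at (\<phi> t x)) (F (\<phi> t x)))
    (at t within {0..})"
  using vector_derivative_diff_chain_within[OF solves[OF assms(1,2)], of v "frechet_derivative v (at (\<phi> t x))"]
    assms(3) by (simp add: o_def frechet_derivative_works has_derivative_at_withinI)

text \<open>Makes the one-sided derivative at time 0 unique; trajectories are controlled only
  forward in time.\<close>

lemma not_trivial_limit_0: "at (0::real) within {0..} \<noteq> bot"
  using at_le[of "{0<..}" "{0..}" "0::real"] trivial_limit_at_right_real[of 0]
  by (auto simp: subset_eq bot_unique)

text \<open>The right derivative at time 0 of the total cost along the trajectory is computed twice:
  by the chain rule, and through \<open>total_cost_split\<close> as minus the derivative of the
  partial cost.\<close>

lemma total_cost_hjb: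
  assumes x: "x \<in> \<Omega>"
  shows "frechet_derivative total_cost (at x) (F x) + r x = 0"
proof -
  have "((\<lambda>t. total_cost (\<phi> t x)) has_vector_derivative frechet_derivative total_cost (at x) (F x)) (at 0 within {0..})"
    using derivative_along_flow[OF x, of 0 total_cost] total_cost_Ck[of 1] x by (simp add: start)
  moreover have "((\<lambda>t. total_cost (\<phi> t x)) has_vector_derivative - r x) (at 0 within {0..})"
  proof (rule has_vector_derivative_transform)
    show "((\<lambda>t. total_cost x - partial_cost t x) has_vector_derivative - r x) (at 0 within {0..})"
      using has_vector_derivative_diff[OF has_vector_derivative_const partial_cost_derivative[OF x, of 0]] x
      by (simp add: start)
  qed (use total_cost_split[OF x] in auto)
  ultimately have "frechet_derivative total_cost (at x) (F x) = - r x"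
    using vector_derivative_unique_within[OF not_trivial_limit_0] by blast
  then show ?thesis by simp
qed

text \<open>Otherwise nonnegativity forces every partial cost to vanish, and with them their
  derivative at time 0, which is \<open>r x\<close>.\<close>

lemma total_cost_pos:
  assumes x: "x \<in> \<Omega>" and r: "r x > 0"
  shows "total_cost x > 0"
proof (rule ccontr)
  assume "\<not> total_cost x > 0"
  then have "partial_cost t x = 0" if "0 \<le> t" for t
    using total_cost_split[OF x that] total_cost_nonneg[OF stays[OF x that]]
      partial_cost_nonneg[OF x, of t] by linarith
  then have "((\<lambda>t. partial_cost t x) has_vector_derivative 0) (at 0 within {0..})"
    by (intro has_vector_derivative_transform[OF _ _ has_vector_derivative_const]) auto
  moreover have "((\<lambda>t. partial_cost t x) has_vector_derivative r x) (at 0 within {0..})"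
    using partial_cost_derivative[OF x, of 0] x by (simp add: start)
  ultimately have "r x = 0"
    using vector_derivative_unique_within[OF not_trivial_limit_0] by blast
  then show False using r by simp
qed

lemma total_cost_unique:
  assumes v: "Ck_on 1 \<Omega> v" "v 0 = 0"
    and hjb: "\<And>x. x \<in> \<Omega> \<Longrightarrow> frechet_derivative v (at x) (F x) + r x = 0" and x: "x \<in> \<Omega>"
  shows "v x = total_cost x"
proof -
  define d where "d t = v (\<phi> t x) - total_cost (\<phi> t x)" for t
  have d': "(d has_vector_derivative 0) (at t within {0..})" if "0 \<le> t" for t
  proof -
    have "(d has_vector_derivative frechet_derivative v (at (\<phi> t x)) (F (\<phi> t x))
        - frechet_derivative total_cost (at (\<phi> t x)) (F (\<phi> t x))) (at t within {0..})"
      unfolding d_def using that stays[OF x that] v(1) total_cost_Ck[of 1]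
      by (intro has_vector_derivative_diff derivative_along_flow x) auto
    then show ?thesis
      using hjb[OF stays[OF x that]] total_cost_hjb[OF stays[OF x that]]
      by (simp add: eq_neg_iff_add_eq_0[symmetric])
  qed
  obtain c where "\<And>t. t \<in> {0..} \<Longrightarrow> d t = c"
    by (rule has_vector_derivative_zero_constant[OF convex_real_interval(1) d']) auto
  then have const: "d t = d 0" if "0 \<le> t" for t
    using that by auto
  have lim: "((\<lambda>t. \<phi> t x) \<longlongrightarrow> 0) at_top"
    using attracted[OF x] by (simp add: tendsto_norm_zero_iff)
  have "isCont v 0" "isCont total_cost 0"
    using Ck_on_continuous[OF v(1)] Ck_on_continuous[OF total_cost_Ck[of 0]] zero_dom open_dom
    by (simp_all add: continuous_on_eq_continuous_at)
  then have "(d \<longlongrightarrow> v 0 - total_cost 0) at_top"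
    unfolding d_def by (intro tendsto_diff isCont_tendsto_compose[OF _ lim])
  moreover have "(d \<longlongrightarrow> d 0) at_top"
    by (rule tendsto_eventually, rule eventually_mono[OF eventually_ge_at_top[of 0]]) (rule const)
  ultimately have "d 0 = 0"
    using tendsto_unique[OF trivial_limit_at_top_linorder] v(2) total_cost_zero by fastforce
  then show ?thesis using x by (simp add: d_def start)
qed

end

section \<open>The value function\<close>

lemma Ck_on_subset: "Ck_on k U f \<Longrightarrow> V \<subseteq> U \<Longrightarrow> Ck_on k V f"
  by (induction k arbitrary: f) (auto elim: continuous_on_subset)

lemma smooth_on_subset: "smooth_on U f \<Longrightarrow> V \<subseteq> U \<Longrightarrow> smooth_on V f"
  unfolding smooth_on_def using Ck_on_subset by blast

lemma smooth_on_add: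
  assumes "open U" "smooth_on U f" "smooth_on U g"
  shows "smooth_on U (\<lambda>x. f x + g x)"
  using assms Ck_family_add[OF \<open>open U\<close> empty_subsetI, of _ "{0::real}" "\<lambda>_. 1" "\<lambda>_. f" "\<lambda>_. g"]
  by (simp add: smooth_on_def Ck_on_iff_Ck_family[where W = "\<lambda>_. 1"])

lemma smooth_on_linear:
  assumes "bounded_linear L" "open U" "smooth_on U f"
  shows "smooth_on U (\<lambda>x. L (f x))"
  using assms Ck_family_linear[OF \<open>bounded_linear L\<close> \<open>open U\<close> empty_subsetI, of "\<lambda>_. 1" _ "{0::real}" "\<lambda>_. f"]
  by (simp add: smooth_on_def Ck_on_iff_Ck_family[where W = "\<lambda>_. 1"])

lemma smooth_on_bilinear:
  assumes "bounded_bilinear B" "open U" "smooth_on U f" "smooth_on U g"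
  shows "smooth_on U (\<lambda>x. B (f x) (g x))"
  using assms Ck_family_bilinear[OF \<open>bounded_bilinear B\<close> \<open>open U\<close> empty_subsetI,
      of "\<lambda>_. 1" "\<lambda>_. 1" _ "{0::real}" "\<lambda>_. f" "\<lambda>_. g"]
  by (simp add: smooth_on_def Ck_on_iff_Ck_family[where W = "\<lambda>_. 1"])

lemma smooth_on_sum:
  assumes "open U" "\<And>i. i \<in> A \<Longrightarrow> smooth_on U (f i)"
  shows "smooth_on U (\<lambda>x. \<Sum>i\<in>A. f i x)"
  using assms Ck_family_sum[OF \<open>open U\<close> empty_subsetI, of A _ "{0::real}" "\<lambda>_. 1" "\<lambda>i _. f i"]
  by (simp add: smooth_on_def Ck_on_iff_Ck_family[where W = "\<lambda>_. 1"])

lemma smooth_on_cong: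
  "open U \<Longrightarrow> smooth_on U f \<Longrightarrow> (\<And>x. x \<in> U \<Longrightarrow> f x = g x) \<Longrightarrow> smooth_on U g"
  unfolding smooth_on_def using Ck_on_cong by blast

lemma smooth_on_frechet_derivative:
  assumes "smooth_on U f"
  shows "smooth_on U (\<lambda>x. frechet_derivative f (at x) v)"
  unfolding smooth_on_def
proof
  fix k
  have "Ck_on (Suc k) U f" using assms by (simp add: smooth_on_def)
  then show "Ck_on k U (\<lambda>x. frechet_derivative f (at x) v)" by simp
qed

lemma bounded_bilinear_matrix_vector_mult:
  "bounded_bilinear ((*v) :: real^'m^'n \<Rightarrow> real^'m \<Rightarrow> real^'n)"
  unfolding bilinear_conv_bounded_bilinear[symmetric] bilinear_def
  by (auto intro!: linearI simp: matrix_vector_mult_add_rdistrib matrix_vector_right_distrib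
      scaleR_matrix_vector_assoc matrix_vector_mult_scaleR)

lemma bounded_linear_transpose: "bounded_linear (transpose :: real^'m^'n \<Rightarrow> real^'n^'m)"
  unfolding linear_conv_bounded_linear[symmetric]
  by (rule linearI) (simp_all add: transpose_def vec_eq_iff)

text \<open>\<open>gradient\<close> is a definite description. The formula resolves it and exhibits
  its coordinates as directional derivatives, from which smoothness of the gradient can be read
  off.\<close>

lemma gradient_eq:
  fixes v :: "'a::euclidean_space \<Rightarrow> real"
  assumes "v differentiable (at x)"
  shows "gradient v x = (\<Sum>b\<in>Basis. frechet_derivative v (at x) b *\<^sub>R b)"
proof -
  let ?G = "\<Sum>b\<in>Basis. frechet_derivative v (at x) b *\<^sub>R b"
  have eq: "frechet_derivative v (at x) z = z \<bullet> ?G" for z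
    by (subst frechet_derivative_expand[OF assms]) (simp add: inner_sum_right mult.commute)
  then have "frechet_derivative v (at x) = (\<lambda>z. z \<bullet> ?G)" by blast
  then have G: "GDERIV v x :> ?G"
    using assms[unfolded frechet_derivative_works] by (simp add: gderiv_def)
  show ?thesis
    unfolding gradient_def
  proof (rule the_equality[where P = "\<lambda>D. GDERIV v x :> D", OF G])
    fix D assume "GDERIV v x :> D"
    then have "frechet_derivative v (at x) = (\<lambda>z. z \<bullet> D)"
      unfolding gderiv_def by (rule frechet_derivative_at[symmetric])
    then have "z \<bullet> D = z \<bullet> ?G" for z using eq[of z] by simp
    then show "D = ?G" by (metis vector_eq_ldot)
  qed
qed

lemma inner_gradient:
  fixes v :: "'a::euclidean_space \<Rightarrow> real"
  assumes "v differentiable (at x)"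
  shows "z \<bullet> gradient v x = frechet_derivative v (at x) z"
  unfolding gradient_eq[OF assms]
  by (subst frechet_derivative_expand[OF assms]) (simp add: inner_sum_right mult.commute)

lemma smooth_on_gradient:
  fixes v :: "'a::euclidean_space \<Rightarrow> real"
  assumes "open U" "smooth_on U v"
  shows "smooth_on U (gradient v)"
proof (rule smooth_on_cong[OF assms(1)])
  show "smooth_on U (\<lambda>x. \<Sum>b\<in>Basis. frechet_derivative v (at x) b *\<^sub>R b)"
    by (intro smooth_on_sum smooth_on_linear[OF bounded_linear_scaleR_left] assms
        smooth_on_frechet_derivative)
  fix x assume "x \<in> U"
  moreover have "Ck_on 1 U v" using assms(2) unfolding smooth_on_def by blast
  ultimately have "v differentiable (at x)" by simp
  then show "(\<Sum>b\<in>Basis. frechet_derivative v (at x) b *\<^sub>R b) = gradient v x"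
    using gradient_eq by metis
qed

text \<open>The integrability conjunct guarantees that \<open>value_fun\<close> is a genuine
  integral, since \<open>integral\<close> takes a default value on functions that are not
  integrable. Uniqueness compares values on \<open>\<Omega>\<close> only, because solutions are
  total functions and unconstrained elsewhere.\<close>

theorem theorem2p4:
  fixes f :: "real^'n \<Rightarrow> real^'n"
    and g :: "real^'n \<Rightarrow> real^'m^'n"
    and h :: "real^'n \<Rightarrow> real"
    and R :: "real^'m^'m"
    and u :: "real^'n \<Rightarrow> real^'m"
    and \<Omega> :: "(real^'n) set"
  assumes "smooth_on UNIV f" and "smooth_on UNIV g" and "smooth_on UNIV h"
    and "sym_pos_def_matrix R"
    and "f 0 = 0"
    and "pos_def_fun_on UNIV h"
    and "admissible f g u \<Omega>"
    and "smooth_on \<Omega> u"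
  shows
    "(\<forall>x\<in>\<Omega>. (\<lambda>t. running_cost h R u (closed_loop_traj f g u \<Omega> x t)) integrable_on {0..}) \<and>
     smooth_on \<Omega> (value_fun f g h R u \<Omega>) \<and>
     pos_def_fun_on \<Omega> (value_fun f g h R u \<Omega>) \<and>
     ghjb_solution f g h R u \<Omega> (value_fun f g h R u \<Omega>) \<and>
     (\<forall>v. ghjb_solution f g h R u \<Omega> v \<longrightarrow> (\<forall>x\<in>\<Omega>. v x = value_fun f g h R u \<Omega> x)) \<and>
     (\<forall>x\<in>\<Omega> - {0}. gradient (value_fun f g h R u \<Omega>) x \<noteq> 0) \<and>
     smooth_on \<Omega> (updated_controller g R (value_fun f g h R u \<Omega>))"
proof -
  let ?F = "closed_loop_field f g u" and ?r = "running_cost h R u"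
  define \<phi> where "\<phi> t x = closed_loop_traj f g u \<Omega> x t" for t x
  note adm = \<open>admissible f g u \<Omega>\<close>[unfolded admissible_def is_domain_def]
  have \<Omega>: "open \<Omega>" "0 \<in> \<Omega>" and u0: "u 0 = 0" using adm by auto
  \<comment> \<open>Admissibility says that the curve picked by \<open>SOME\<close> is indeed a
    solution in \<open>\<Omega>\<close>; this is all that the semiflow locale needs to know about
    the choice.\<close>
  have sol: "closed_loop_solution f g u \<Omega> x (\<lambda>t. \<phi> t x)" if "x \<in> \<Omega>" for x
    using adm that by (simp add: \<phi>_def)
  obtain \<epsilon> C \<nu> where decay: "\<epsilon> > 0" "C > 0" "\<nu> > 0" "ball 0 \<epsilon> \<subseteq> \<Omega>"
    "\<And>x t. x \<in> ball 0 \<epsilon> \<Longrightarrow> 0 \<le> t \<Longrightarrow> norm (\<phi> t x) \<le> C * exp (- \<nu> * t) * norm x"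
    using adm unfolding \<phi>_def by blast
  have f\<Omega>: "smooth_on \<Omega> f" and g\<Omega>: "smooth_on \<Omega> g" and h\<Omega>: "smooth_on \<Omega> h"
    using assms(1-3) smooth_on_subset by blast+
  have F_smooth: "smooth_on \<Omega> ?F"
    unfolding closed_loop_field_def[abs_def]
    by (intro smooth_on_add \<Omega> f\<Omega> smooth_on_bilinear[OF bounded_bilinear_matrix_vector_mult] g\<Omega> assms(8))
  have r_smooth: "smooth_on \<Omega> ?r"
    unfolding running_cost_def[abs_def]
    by (intro smooth_on_add \<Omega> h\<Omega> smooth_on_bilinear[OF bounded_bilinear_inner] assms(8)
        smooth_on_linear[OF matrix_vector_mul_bounded_linear])
  have quad: "u x \<bullet> (R *v u x) \<ge> 0" for x
    using \<open>sym_pos_def_matrix R\<close> unfolding sym_pos_def_matrix_def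
    by (cases "u x = 0") (auto simp: less_imp_le)
  have r0: "?r 0 = 0"
    using \<open>pos_def_fun_on UNIV h\<close> u0 by (simp add: running_cost_def pos_def_fun_on_def)
  have r_pos: "?r x > 0" if "x \<noteq> 0" for x
    using \<open>pos_def_fun_on UNIV h\<close> quad[of x] that
    by (simp add: running_cost_def pos_def_fun_on_def add_pos_nonneg)
  interpret stable_semiflow \<Omega> ?F \<phi> ?r \<epsilon> C \<nu>
  proof
    show "0 \<le> ?r x" for x using r0 r_pos[of x] by (cases "x = 0") auto
    show "((\<lambda>t. norm (\<phi> t x)) \<longlongrightarrow> 0) at_top" if "x \<in> \<Omega>" for x
      using adm that by (simp add: \<phi>_def)
  qed (use \<Omega> F_smooth r_smooth r0 decay sol in \<open>auto simp: closed_loop_solution_def\<close>)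
  \<comment> \<open>An equality of total functions: also outside \<open>\<Omega>\<close> both sides
    are the same integral along the same chosen curve.\<close>
  have V: "value_fun f g h R u \<Omega> = total_cost"
    by (rule ext) (simp add: value_fun_def total_cost_def \<phi>_def)
  have V_smooth: "smooth_on \<Omega> total_cost"
    using total_cost_Ck by (simp add: smooth_on_def)
  have V_diff: "total_cost differentiable (at x)" if "x \<in> \<Omega>" for x
    using total_cost_Ck[of 1] that by simp
  have ghjb_iff: "?F x \<bullet> gradient v x + ?r x = (f x + g x *v u x) \<bullet> gradient v x + h x + u x \<bullet> (R *v u x)"
    for v x by (simp add: closed_loop_field_def running_cost_def)
  have ghjb: "?F x \<bullet> gradient total_cost x + ?r x = 0" if "x \<in> \<Omega>" for x
    using total_cost_hjb[OF that] inner_gradient[OF V_diff[OF that]] by simp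
  have "(\<lambda>t. ?r (closed_loop_traj f g u \<Omega> x t)) integrable_on {0..}" if "x \<in> \<Omega>" for x
    using total_cost_has_integral[OF that] by (auto simp: \<phi>_def integrable_on_def)
  moreover have "pos_def_fun_on \<Omega> total_cost"
    using total_cost_zero total_cost_pos r_pos by (simp add: pos_def_fun_on_def)
  moreover have "ghjb_solution f g h R u \<Omega> total_cost"
    using total_cost_Ck[of 1] total_cost_zero ghjb ghjb_iff by (simp add: ghjb_solution_def)
  moreover have "v x = total_cost x" if v: "ghjb_solution f g h R u \<Omega> v" and x: "x \<in> \<Omega>" for v x
  proof (rule total_cost_unique[OF _ _ _ x])
    show v1: "Ck_on 1 \<Omega> v" and "v 0 = 0" using v unfolding ghjb_solution_def by auto
    fix x assume x: "x \<in> \<Omega>"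
    have "?F x \<bullet> gradient v x + ?r x = 0"
      using v x unfolding ghjb_iff ghjb_solution_def by blast
    moreover have "v differentiable (at x)" using v1 x by simp
    ultimately show "frechet_derivative v (at x) (?F x) + ?r x = 0"
      by (simp add: inner_gradient)
  qed
  \<comment> \<open>A zero gradient would reduce the equation to \<open>?r x = 0\<close>, against
    the positivity of the running cost away from the origin.\<close>
  moreover have "gradient total_cost x \<noteq> 0" if "x \<in> \<Omega> - {0}" for x
    using ghjb[of x] r_pos[of x] that by auto
  moreover have "smooth_on \<Omega> (updated_controller g R total_cost)"
    unfolding updated_controller_def[abs_def]
    by (intro smooth_on_linear[OF bounded_linear_minus[OF bounded_linear_scaleR_right]]
        smooth_on_linear[OF matrix_vector_mul_bounded_linear] \<Omega> V_smooth
        smooth_on_bilinear[OF bounded_bilinear_matrix_vector_mult] g\<Omega>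
        smooth_on_linear[OF bounded_linear_transpose] smooth_on_gradient)
  ultimately show ?thesis
    unfolding V using V_smooth by blast
qed

end
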